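(* Let $f:\mathbb{R}^n\to\mathbb{R}^n$ be a polynomial vector field. Suppose $A^*\subset\mathbb{R}^n$ is a minimal attractor set of the ODE $\dot{x}(t)=f(x(t))$, $\sigma>0$, and $\Omega\subset\mathbb{R}^n$ is some compact set such that $B(A^*,\sigma)\subseteq\Omega$, $\Omega\subset BOA_f(A^* )$, $\Omega=\{x\in\mathbb{R}^n:g_\Omega(x)\ge 0\}$ and $\partial\Omega=\{x\in\mathbb{R}^n:g_\Omega(x)=0\}$, where $g_\Omega\in\mathcal{P}(\mathbb{R}^n,\mathbb{R})$. For $d\in\mathbb{N}$ and $\alpha>0$ consider the $d$-degree optimization problem $$J_{d,\alpha}\in\arg\inf_{J}\ \mu(\{x\in\Omega:J(x)\le 1\})$$ subject to $J,s_0,k_0,k_1\in\sum_{SOS}^d$ and $p_0\in\mathcal{P}_d(\mathbb{R}^n,\mathbb{R})$, where $$k_0(x)=-\nabla J(x)^T f(x)-(J(x)-1)-s_0(x)g_\Omega(x),\qquad k_1(x)=(J(x)-1-\alpha)-p_0(x)g_\Omega(x).$$ Suppose $\{J_{d,\alpha}\}_{d\in\mathbb{N}}$ is such that $J_{d,\alpha}$ solves this $d$-degree optimization problem for $\alpha>0$. Then: 1. $\{x\in\Omega:J_{d,\alpha}(x)\le 1\}$ is an attractor set of the ODE for each $d\in\mathbb{N}$ and $\alpha>0$. 2. $A^*\subseteq\{x\in\Omega:J_{d,\alpha}(x)\le 1\}$ for each $d\in\mathbb{N}$ and $\alpha>0$. 3. There exists $\beta>0$ such that for any $\alpha\in(0,\beta)$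 we have $$\lim_{d\to\infty}D_V(A^*,\{x\in\Omega:J_{d,\alpha}(x)\le 1\})=0.$$
   Context: $\partial\Omega$ denotes the boundary of $\Omega$. For $x\in\mathbb{R}^n$ and $A\subset\mathbb{R}^n$, $D(x,A)=D(A,x):=\inf_{y\in A}\|x-y\|_2$; $B(x,\eta):=\{y\in\mathbb{R}^n:\|x-y\|_2<\eta\}$ and $B(A,\eta):=\bigcup_{x\in A}B(x,\eta)$ for $\eta>0$. $\mu$ is the Lebesgue measure on $\mathbb{R}^n$, and the volume metric is $D_V(A,B):=\mu((A\setminus B)\cup(B\setminus A))$. $\mathcal{P}(\mathbb{R}^n,\mathbb{R})$ is the set of real polynomials on $\mathbb{R}^n$ and $\mathcal{P}_d(\mathbb{R}^n,\mathbb{R})$ the set of those of degree at most $d$. A polynomial $p:\mathbb{R}^n\to\mathbb{R}$ is Sum-of-Squares (SOS) if $p=\sum_{i=1}^k p_i^2$ for finitely many real polynomials $p_i$; $\sum_{SOS}^d$ is the set of SOS polynomials on $\mathbb{R}^n$ of degree at most $d$. The solution map $\phi_f:\mathbb{R}^n\times[0,\infty)\to\mathbb{R}^n$ of the ODE satisfies $\frac{\partial}{\partial t}\phi_f(x,t)=f(\phi_f(x,t))$, $\phi_f(x,0)=x$, and $\phi_f(\phi_f(x,t),s)=\phi_f(x,t+s)$ for all $x\in\mathbb{R}^n$ and $s,t\ge 0$. Standing assumption: such a solution map exists and is unique on $\mathbb{R}^n\times[0,\infty)$. Attractor set (short for stable compact attractor set): a set $A\subset\mathbb{R}^n$ is an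 attractor set of the ODE $\dot x=f(x)$ if (1) $A$ is compact and nonempty; (2) $\phi_f(x,t)\in A$ for all $x\in A$ and $t\ge 0$; (3) for all $x\in A$ there exists $\delta>0$ such that for any $\varepsilon>0$ there exists $T\ge0$ for which $D(\phi_f(y,t),A)<\varepsilon$ for all $y\in B(x,\delta)$ and $t\ge T$; (4) for all $\varepsilon>0$ there exists $\delta>0$ such that $x\in B(A,\delta)$ implies $D(A,\phi_f(x,t))<\varepsilon$ for all $t\ge 0$. An attractor set $A$ is a minimal attractor set if there is no other attractor set $B$ of the same ODE that is strictly contained in $A$. Basin of attraction of an attractor set $A$: $BOA_f(A):=\{x\in\mathbb{R}^n:\lim_{t\to\infty}D(A,\phi_f(x,t))=0\}$. *)

theory Defs
  imports "HOL-Analysis.Analysis"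
begin

section \<open>Polynomials of bounded degree and sums of squares\<close>

definition monomial_fun :: "('n \<Rightarrow> nat) \<Rightarrow> real ^ 'n \<Rightarrow> real" where
  "monomial_fun m x = (\<Prod>i\<in>UNIV. (x $ i) ^ m i)"

definition poly_deg_le :: "nat \<Rightarrow> (real ^ 'n \<Rightarrow> real) set" where
  "poly_deg_le d = {p. \<exists>c. p = (\<lambda>x. \<Sum>m | (\<Sum>i\<in>UNIV. m i) \<le> d. c m * monomial_fun m x)}"

definition sos :: "(real ^ 'n \<Rightarrow> real) \<Rightarrow> bool" where
  "sos p \<longleftrightarrow> (\<exists>(k::nat) q. (\<forall>i<k. real_polynomial_function (q i)) \<and> p = (\<lambda>x. \<Sum>i<k. (q i x)\<^sup>2))"

definition sos_deg_le :: "nat \<Rightarrow> (real ^ 'n \<Rightarrow> real) set" where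
  "sos_deg_le d = {p \<in> poly_deg_le d. sos p}"

text \<open>The union of the sets \<open>poly_deg_le d\<close> is the library's set of real polynomial functions.\<close>

lemma finite_exponents: "finite {m :: 'n::finite \<Rightarrow> nat. (\<Sum>i\<in>UNIV. m i) \<le> d}"
proof (rule finite_subset)
  show "{m :: 'n \<Rightarrow> nat. (\<Sum>i\<in>UNIV. m i) \<le> d} \<subseteq> PiE UNIV (\<lambda>_. {..d})"
  proof
    fix m :: "'n \<Rightarrow> nat"
    assume m: "m \<in> {m. (\<Sum>i\<in>UNIV. m i) \<le> d}"
    have "m i \<le> d" for i
    proof -
      have "m i \<le> (\<Sum>i\<in>UNIV. m i)"
        by (rule member_le_sum) auto
      with m show ?thesis
        by simp
    qed
    then show "m \<in> PiE UNIV (\<lambda>_. {..d})"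
      by (simp add: PiE_def)
  qed
  show "finite (PiE (UNIV :: 'n set) (\<lambda>_. {..d}))"
    by (intro finite_PiE) auto
qed

lemma poly_deg_leI:
  assumes "finite M" "\<And>m. m \<in> M \<Longrightarrow> (\<Sum>i\<in>UNIV. m i) \<le> d"
    and "\<And>x. p x = (\<Sum>m\<in>M. c m * monomial_fun m x)"
  shows "p \<in> poly_deg_le d"
proof -
  have "p x = (\<Sum>m | (\<Sum>i\<in>UNIV. m i) \<le> d. (if m \<in> M then c m else 0) * monomial_fun m x)" for x
    unfolding assms(3)
    by (rule sum.mono_neutral_cong_left) (use assms finite_exponents in auto)
  then have "p = (\<lambda>x. \<Sum>m | (\<Sum>i\<in>UNIV. m i) \<le> d. (if m \<in> M then c m else 0) * monomial_fun m x)"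
    by (rule ext)
  then show ?thesis
    unfolding poly_deg_le_def mem_Collect_eq by (intro exI[of _ "\<lambda>m. if m \<in> M then c m else 0"])
qed

lemma poly_deg_le_mono: "p \<in> poly_deg_le d \<Longrightarrow> d \<le> e \<Longrightarrow> p \<in> poly_deg_le e"
proof -
  assume "p \<in> poly_deg_le d" "d \<le> e"
  then obtain c where "p = (\<lambda>x. \<Sum>m | (\<Sum>i\<in>UNIV. m i) \<le> d. c m * monomial_fun m x)"
    by (auto simp: poly_deg_le_def)
  with \<open>d \<le> e\<close> show ?thesis
    by (intro poly_deg_leI[OF finite_exponents[of d], where c = c]) simp_all
qed

lemma poly_deg_le_add:
  assumes "p \<in> poly_deg_le d" "q \<in> poly_deg_le d"
  shows "(\<lambda>x. p x + q x) \<in> poly_deg_le d"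
proof -
  obtain a b where "p = (\<lambda>x. \<Sum>m | (\<Sum>i\<in>UNIV. m i) \<le> d. a m * monomial_fun m x)"
    and "q = (\<lambda>x. \<Sum>m | (\<Sum>i\<in>UNIV. m i) \<le> d. b m * monomial_fun m x)"
    using assms by (auto simp: poly_deg_le_def)
  then show ?thesis
    by (intro poly_deg_leI[OF finite_exponents[of d], where c = "\<lambda>m. a m + b m"])
      (auto simp: sum.distrib ring_distribs)
qed

lemma poly_deg_le_0: "(\<lambda>x. 0) \<in> poly_deg_le d"
  by (rule poly_deg_leI[of "{}"]) auto

lemma poly_deg_le_sum:
  "finite S \<Longrightarrow> (\<And>s. s \<in> S \<Longrightarrow> p s \<in> poly_deg_le d) \<Longrightarrow> (\<lambda>x. \<Sum>s\<in>S. p s x) \<in> poly_deg_le d"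
  by (induction S rule: finite_induct) (auto intro: poly_deg_le_add poly_deg_le_0)

lemma poly_deg_le_monomial:
  "(\<Sum>i\<in>UNIV. m i) \<le> d \<Longrightarrow> (\<lambda>x. c * monomial_fun m x) \<in> poly_deg_le d"
  by (rule poly_deg_leI[of "{m}" _ _ "\<lambda>_. c"]) auto

lemma poly_deg_le_mult:
  assumes "p \<in> poly_deg_le d" "q \<in> poly_deg_le e"
  shows "(\<lambda>x. p x * q x) \<in> poly_deg_le (d + e)"
proof -
  obtain a b where p: "p = (\<lambda>x. \<Sum>m | (\<Sum>i\<in>UNIV. m i) \<le> d. a m * monomial_fun m x)"
    and q: "q = (\<lambda>x. \<Sum>m | (\<Sum>i\<in>UNIV. m i) \<le> e. b m * monomial_fun m x)"
    using assms by (auto simp: poly_deg_le_def)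
  have "(\<lambda>x. p x * q x) =
      (\<lambda>x. \<Sum>m | (\<Sum>i\<in>UNIV. m i) \<le> d. \<Sum>l | (\<Sum>i\<in>UNIV. l i) \<le> e.
        (a m * b l) * monomial_fun (\<lambda>i. m i + l i) x)"
    by (auto simp: p q sum_product monomial_fun_def power_add prod.distrib mult_ac)
  also have "\<dots> \<in> poly_deg_le (d + e)"
    by (intro poly_deg_le_sum poly_deg_le_monomial finite_exponents)
      (auto simp: sum.distrib intro: add_mono)
  finally show ?thesis .
qed

lemma real_polynomial_function_iff_poly_deg_le:
  fixes p :: "real ^ 'n \<Rightarrow> real"
  shows "real_polynomial_function p \<longleftrightarrow> (\<exists>d. p \<in> poly_deg_le d)"
proof
  assume "real_polynomial_function p"
  then show "\<exists>d. p \<in> poly_deg_le d"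
  proof (induction rule: real_polynomial_function.induct)
    case (linear f)
    have "f = (\<lambda>x. \<Sum>j\<in>UNIV. f (axis j 1) * monomial_fun (\<lambda>i. if i = j then 1 else 0) x)"
    proof
      fix x :: "real ^ 'n"
      have "f x = f (\<Sum>j\<in>UNIV. x $ j *\<^sub>R axis j 1)"
        by (subst basis_expansion[symmetric]) (simp add: scalar_mult_eq_scaleR)
      also have "\<dots> = (\<Sum>j\<in>UNIV. x $ j * f (axis j 1))"
        using linear by (simp add: bounded_linear.linear linear_sum linear_cmul)
      finally show "f x = (\<Sum>j\<in>UNIV. f (axis j 1) * monomial_fun (\<lambda>i. if i = j then 1 else 0) x)"
        by (simp add: monomial_fun_def if_distrib prod.delta mult.commute cong: if_cong)
    qed
    also have "\<dots> \<in> poly_deg_le 1"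
      by (intro poly_deg_le_sum poly_deg_le_monomial) auto
    finally show ?case ..
  next
    case (const c)
    show ?case
      using poly_deg_le_monomial[of "\<lambda>_. 0" 0 c] by (auto simp: monomial_fun_def)
  next
    case (add f g)
    then obtain d e where "f \<in> poly_deg_le d" "g \<in> poly_deg_le e"
      by blast
    then have "f \<in> poly_deg_le (max d e)" "g \<in> poly_deg_le (max d e)"
      by (auto intro: poly_deg_le_mono)
    then show ?case
      by (blast intro: poly_deg_le_add)
  next
    case (mult f g)
    then show ?case
      by (blast intro: poly_deg_le_mult)
  qed
next
  have coord: "real_polynomial_function (\<lambda>x :: real ^ 'n. x $ i)" for i
    by (intro real_polynomial_function.intros(1) bounded_linear_vec_nth)
  have pow: "real_polynomial_function (\<lambda>x :: real ^ 'n. (x $ i) ^ k)" for i k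
    by (induction k) (auto intro: coord)
  assume "\<exists>d. p \<in> poly_deg_le d"
  then show "real_polynomial_function p"
    unfolding poly_deg_le_def monomial_fun_def
    by (auto intro!: real_polynomial_function_sum real_polynomial_function_prod
        real_polynomial_function.intros(2,4) finite_exponents pow)
qed

section \<open>Flows and attractor sets\<close>

text \<open>Time derivatives at \<open>t = 0\<close> are one-sided. Values \<open>\<phi> x t\<close> for \<open>t < 0\<close> are irrelevant.\<close>

definition solution_map :: "(real ^ 'n \<Rightarrow> real ^ 'n) \<Rightarrow> (real ^ 'n \<Rightarrow> real \<Rightarrow> real ^ 'n) \<Rightarrow> bool" where
  "solution_map f \<phi> \<longleftrightarrow>
     (\<forall>x. \<forall>t\<ge>0. (\<phi> x has_vector_derivative f (\<phi> x t)) (at t within {0..})) \<and>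
     (\<forall>x. \<phi> x 0 = x) \<and>
     (\<forall>x. \<forall>s\<ge>0. \<forall>t\<ge>0. \<phi> (\<phi> x t) s = \<phi> x (t + s))"

definition unique_solution_map ::
    "(real ^ 'n \<Rightarrow> real ^ 'n) \<Rightarrow> (real ^ 'n \<Rightarrow> real \<Rightarrow> real ^ 'n) \<Rightarrow> bool" where
  "unique_solution_map f \<phi> \<longleftrightarrow>
     solution_map f \<phi> \<and> (\<forall>\<psi>. solution_map f \<psi> \<longrightarrow> (\<forall>x. \<forall>t\<ge>0. \<psi> x t = \<phi> x t))"

definition nhd :: "(real ^ 'n) set \<Rightarrow> real \<Rightarrow> (real ^ 'n) set" where
  "nhd A \<eta> = (\<Union>x\<in>A. ball x \<eta>)"

definition attractor_set :: "(real ^ 'n \<Rightarrow> real \<Rightarrow> real ^ 'n) \<Rightarrow> (real ^ 'n) set \<Rightarrow> bool" where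
  "attractor_set \<phi> A \<longleftrightarrow>
     compact A \<and> A \<noteq> {} \<and>
     (\<forall>x\<in>A. \<forall>t\<ge>0. \<phi> x t \<in> A) \<and>
     (\<forall>x\<in>A. \<exists>\<delta>>0. \<forall>\<epsilon>>0. \<exists>T\<ge>0. \<forall>y\<in>ball x \<delta>. \<forall>t\<ge>T. infdist (\<phi> y t) A < \<epsilon>) \<and>
     (\<forall>\<epsilon>>0. \<exists>\<delta>>0. \<forall>x\<in>nhd A \<delta>. \<forall>t\<ge>0. infdist (\<phi> x t) A < \<epsilon>)"

definition minimal_attractor_set :: "(real ^ 'n \<Rightarrow> real \<Rightarrow> real ^ 'n) \<Rightarrow> (real ^ 'n) set \<Rightarrow> bool" where
  "minimal_attractor_set \<phi> A \<longleftrightarrow> attractor_set \<phi> A \<and> \<not> (\<exists>B. attractor_set \<phi> B \<and> B \<subset> A)"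

definition basin_of_attraction :: "(real ^ 'n \<Rightarrow> real \<Rightarrow> real ^ 'n) \<Rightarrow> (real ^ 'n) set \<Rightarrow> (real ^ 'n) set" where
  "basin_of_attraction \<phi> A = {x. ((\<lambda>t. infdist (\<phi> x t) A) \<longlongrightarrow> 0) at_top}"

section \<open>The volume metric and the optimization problem\<close>

definition vol_dist :: "(real ^ 'n) set \<Rightarrow> (real ^ 'n) set \<Rightarrow> ennreal" where
  "vol_dist A B = emeasure lebesgue ((A - B) \<union> (B - A))"

definition gradient :: "(real ^ 'n \<Rightarrow> real) \<Rightarrow> real ^ 'n \<Rightarrow> real ^ 'n" where
  "gradient J x = (THE D. GDERIV J x :> D)"

lemma gradient_eq:
  assumes "GDERIV J x :> D"
  shows "gradient J x = D"
  unfolding gradient_def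
proof (rule the_equality)
  fix E
  assume "GDERIV J x :> E"
  with assms have "(\<lambda>h. inner h E) = (\<lambda>h. inner h D)"
    unfolding gderiv_def by (rule has_derivative_unique[OF _ _, rotated])
  then show "E = D"
    by (metis vector_eq_ldot)
qed (rule assms)

definition feasible ::
    "(real ^ 'n \<Rightarrow> real ^ 'n) \<Rightarrow> (real ^ 'n \<Rightarrow> real) \<Rightarrow> nat \<Rightarrow> real \<Rightarrow> (real ^ 'n \<Rightarrow> real) \<Rightarrow> bool" where
  "feasible f g d \<alpha> J \<longleftrightarrow>
     (\<exists>s0 k0 k1 p0.
        J \<in> sos_deg_le d \<and> s0 \<in> sos_deg_le d \<and> k0 \<in> sos_deg_le d \<and> k1 \<in> sos_deg_le d \<and>
        p0 \<in> poly_deg_le d \<and>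
        (\<forall>x. k0 x = - (gradient J x \<bullet> f x) - (J x - 1) - s0 x * g x) \<and>
        (\<forall>x. k1 x = (J x - 1 - \<alpha>) - p0 x * g x))"

definition solves ::
    "(real ^ 'n \<Rightarrow> real ^ 'n) \<Rightarrow> (real ^ 'n \<Rightarrow> real) \<Rightarrow> (real ^ 'n) set \<Rightarrow> nat \<Rightarrow> real
      \<Rightarrow> (real ^ 'n \<Rightarrow> real) \<Rightarrow> bool" where
  "solves f g \<Omega> d \<alpha> J \<longleftrightarrow>
     is_arg_min (\<lambda>J. emeasure lebesgue {x\<in>\<Omega>. J x \<le> 1}) (feasible f g d \<alpha>) J"

end

theory Submission
  imports "HOL-Algebra.Algebraic_Closure_Type" Defs
begin

text \<open>Along the flow, a feasible \<open>J\<close> satisfies \<open>d/dt J \<le> - (J - 1)\<close> on \<open>\<Omega>\<close> and \<open>J \<ge> 1 + \<alpha>\<close> on the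
  boundary, so the sublevel set is an attractor set, and its intersection with \<open>A\<close> is one too; minimality of
  \<open>A\<close> gives the inclusion. For the limit it suffices to find one feasible \<open>J\<close> whose sublevel set is
  close to \<open>A\<close>. The supremum over \<open>t\<close> of \<open>exp (2 t) max 0 (D(\<phi> x t, A) - r)\<close> is a Lipschitz function
  decaying at rate \<open>2\<close>; convolution with a polynomial kernel makes it a polynomial \<open>V\<close> up to a small
  error, and \<open>J\<close> is the square of an affine function of \<open>V\<close>. The constraints of \<open>J\<close> then hold with a strict
  margin on \<open>\<Omega>\<close>, and become SOS identities by the Positivstellensatz: a polynomial positive on a compact
  set \<open>g \<ge> 0\<close> has the form \<open>s + t g\<close> with \<open>s\<close>, \<open>t\<close> SOS.

  A certificate \<open>1 + t = s (R - |x|^2)\<close> with \<open>t\<close> and \<open>s\<close> in the preorder of \<open>g\<close> exists because a prime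
  cone of polynomials orders a quotient ring, and sign conditions that hold in the real closure of its
  fraction field already hold at a real point, by Hoermander's elimination with sign tables. Woermann's
  trick turns the certificate into the archimedean property, which reduces positivity on \<open>g \<ge> 0\<close> to positivity
  on a box, where Bernstein polynomials have positive coefficients.\<close>

text \<open>Feasibility demands exact polynomial identities, whereas the natural Lyapunov function
  of an attractor is only Lipschitz. Every inequality is therefore proved with room to spare before
  it is approximated: the level is lowered by \<delta>, and after scaling the smoothing error is a
  small fraction of \<delta>. Squaring makes \<open>J\<close> SOS and loses no information, since
  the affine function stays above \<open>1/2\<close> on \<Omega>. The parameter \<alpha> affects
  only the slope of the affine function and the errors chosen after it, so any \<beta> will do.

  Optimality is used once: \<open>A\<close> lies in the sublevel set of every feasible function, so
  the volume distance to \<open>A\<close> is the measure of that set minus a constant, and a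
  feasible function stays a competitor in all larger degrees.

  In the algebraic half, an ordering of polynomials has to be replaced by a real point. The
  elimination treats two real closed fields side by side and compares only signs of evaluated
  expressions. Having a single constraint \<open>g\<close> makes the quadratic module closed under
  products.\<close>

hide_const (open) Polynomials.degree Polynomials.lead_coeff

section \<open>The real closure of an ordered field\<close>

text \<open>\<open>T\<close> is a cone of the subfield \<open>T - T\<close> of the algebraic closure; for a maximal \<open>T\<close> this
  subfield is the real closure.\<close>

definition field_cone :: "'a::linordered_field alg_closure set \<Rightarrow> bool" where
  "field_cone T \<longleftrightarrow>
    (\<forall>x\<in>T. \<forall>y\<in>T. x + y \<in> T \<and> x * y \<in> T \<and> (x - y)\<^sup>2 \<in> T) \<and> (\<forall>x\<in>T. inverse x \<in> T) \<and>
    - 1 \<notin> T \<and> to_ac ` {0..} \<subseteq> T"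

lemma field_cone_chain:
  assumes "C \<noteq> {}" "subset.chain (Collect field_cone) C"
  shows "field_cone (\<Union>C)"
proof -
  have fc: "field_cone T" if "T \<in> C" for T
    using assms that by (auto simp: subset.chain_def)
  have tot: "S \<subseteq> T \<or> T \<subseteq> S" if "S \<in> C" "T \<in> C" for S T
    using assms(2) that unfolding subset.chain_def by blast
  have pair: "\<exists>T\<in>C. x \<in> T \<and> y \<in> T" if "x \<in> \<Union>C" "y \<in> \<Union>C" for x y
    using that tot by blast
  obtain T0 where "T0 \<in> C" using assms by auto
  show ?thesis
    unfolding field_cone_def
  proof (intro conjI ballI)
    fix x y assume "x \<in> \<Union>C" "y \<in> \<Union>C"
    then obtain T where "T \<in> C" "x \<in> T" "y \<in> T" using pair by blast
    then show "x + y \<in> \<Union>C" "x * y \<in> \<Union>C" "(x - y)\<^sup>2 \<in> \<Union>C"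
      using fc[of T] unfolding field_cone_def by blast+
  next
    fix x assume "x \<in> \<Union>C"
    then show "inverse x \<in> \<Union>C" using fc unfolding field_cone_def by blast
  next
    show "- 1 \<notin> \<Union>C" using fc unfolding field_cone_def by blast
    show "to_ac ` {0..} \<subseteq> \<Union>C" using fc \<open>T0 \<in> C\<close> unfolding field_cone_def by blast
  qed
qed

lemma field_cone_base: "field_cone (to_ac ` {0::'a::linordered_field..})"
  unfolding field_cone_def
proof (intro conjI ballI)
  fix x y :: "'a alg_closure" assume "x \<in> to_ac ` {0..}" "y \<in> to_ac ` {0..}"
  then obtain a b where ab: "x = to_ac a" "y = to_ac b" "a \<ge> 0" "b \<ge> 0" by auto
  have "x + y = to_ac (a + b)" "x * y = to_ac (a * b)" "(x - y)\<^sup>2 = to_ac ((a - b)\<^sup>2)"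
    by (simp_all add: ab)
  then show "x + y \<in> to_ac ` {0..}" "x * y \<in> to_ac ` {0..}" "(x - y)\<^sup>2 \<in> to_ac ` {0..}"
    using ab by (metis atLeast_iff image_eqI add_nonneg_nonneg mult_nonneg_nonneg zero_le_power2)+
next
  fix x :: "'a alg_closure" assume "x \<in> to_ac ` {0..}"
  then obtain a where ab: "x = to_ac a" "a \<ge> 0" by auto
  then have "inverse x = to_ac (inverse a)" "inverse a \<ge> 0" by simp_all
  then show "inverse x \<in> to_ac ` {0..}" by (metis atLeast_iff image_eqI)
next
  show "- 1 \<notin> to_ac ` {0::'a..}"
  proof
    assume "- 1 \<in> to_ac ` {0::'a..}"
    then obtain a :: 'a where "a \<ge> 0" "to_ac a = - 1" by auto
    then have "to_ac a = to_ac (- 1)" by simp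
    with \<open>a \<ge> 0\<close> show False by (simp only: to_ac_eq_iff)
  qed
qed auto

definition max_cone :: "'a::linordered_field alg_closure set" where
  "max_cone = (SOME T. field_cone T \<and> (\<forall>S. field_cone S \<and> T \<subseteq> S \<longrightarrow> S = T))"

lemma max_cone: "field_cone (max_cone :: 'a::linordered_field alg_closure set)"
  and max_cone_maximal: "\<And>S. field_cone S \<Longrightarrow> max_cone \<subseteq> S \<Longrightarrow> S = (max_cone :: 'a alg_closure set)"
proof -
  have "\<exists>M\<in>Collect field_cone. \<forall>S\<in>Collect field_cone. M \<subseteq> S \<longrightarrow> S = (M :: 'a alg_closure set)"
    using subset_Zorn_nonempty[of "Collect field_cone :: 'a alg_closure set set"]
      field_cone_base field_cone_chain by blast
  then have "\<exists>T::'a alg_closure set. field_cone T \<and> (\<forall>S. field_cone S \<and> T \<subseteq> S \<longrightarrow> S = T)"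
    by blast
  from someI_ex[OF this]
  show "field_cone (max_cone :: 'a::linordered_field alg_closure set)"
    "\<And>S. field_cone S \<Longrightarrow> max_cone \<subseteq> S \<Longrightarrow> S = (max_cone :: 'a alg_closure set)"
    unfolding max_cone_def[symmetric] by blast+
qed

context
  fixes T :: "'a::linordered_field alg_closure set"
  assumes T: "field_cone T"
begin

lemma cone_add: "x \<in> T \<Longrightarrow> y \<in> T \<Longrightarrow> x + y \<in> T"
  and cone_mult: "x \<in> T \<Longrightarrow> y \<in> T \<Longrightarrow> x * y \<in> T"
  and cone_sq: "x \<in> T \<Longrightarrow> y \<in> T \<Longrightarrow> (x - y)\<^sup>2 \<in> T"
  and cone_inverse: "x \<in> T \<Longrightarrow> inverse x \<in> T"
  and cone_minus1: "- 1 \<notin> T"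
  and cone_to_ac: "a \<ge> 0 \<Longrightarrow> to_ac a \<in> T"
  using T unfolding field_cone_def by auto

lemma cone_0: "0 \<in> T" and cone_1: "1 \<in> T"
  using cone_to_ac[of 0] cone_to_ac[of 1] by auto

text \<open>Were \<open>x\<close> nonzero, \<open>- x * inverse x = - 1\<close> would lie in the
  cone.\<close>

lemma cone_antisym: "x \<in> T \<Longrightarrow> - x \<in> T \<Longrightarrow> x = 0"
  using cone_mult[of "-x" "inverse x"] cone_inverse[of x] cone_minus1
  by (cases "x = 0") auto

end

text \<open>Put \<open>z = x - y\<close>. If \<open>- 1\<close> is not in \<open>T + z T\<close>,
  this set is a cone, and maximality puts \<open>z\<close> into \<open>T\<close>. If neither
  \<open>z\<close> nor \<open>- z\<close> can be adjoined, then \<open>z t = - (1 + s)\<close> and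
  \<open>z t' = 1 + s'\<close> with all of \<open>s, t, s', t'\<close> in \<open>T\<close>. Hence
  \<open>(1 + s) t'\<close> and \<open>(1 + s') t\<close> are negatives of each other and vanish by
  antisymmetry, so \<open>t' = 0\<close> and \<open>1 + s' = 0\<close>, that is
  \<open>- 1 \<in> T\<close>.\<close>

lemma max_cone_total:
  fixes x y :: "'a::linordered_field alg_closure"
  assumes "x \<in> max_cone" "y \<in> max_cone"
  shows "x - y \<in> max_cone \<or> y - x \<in> max_cone"
proof -
  let ?T = "max_cone :: 'a alg_closure set"
  note add = cone_add[OF max_cone] and mult = cone_mult[OF max_cone] and inv = cone_inverse[OF max_cone]
  note simps = cone_0[OF max_cone] cone_1[OF max_cone]
  \<comment> \<open>The ring \<open>T - T\<close>; the clause of \<open>field_cone\<close> on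
    \<open>(x - y)\<^sup>2\<close> says precisely that its squares lie in \<open>T\<close>.\<close>
  define E where "E = {a - b | a b. a \<in> ?T \<and> b \<in> ?T}"
  have Esq: "z\<^sup>2 \<in> ?T" if "z \<in> E" for z
    using that cone_sq[OF max_cone] by (auto simp: E_def)
  have Eadd: "u + v \<in> E" if "u \<in> E" "v \<in> E" for u v
  proof -
    obtain a b c d where "u = a - b" "v = c - d" "a \<in> ?T" "b \<in> ?T" "c \<in> ?T" "d \<in> ?T"
      using \<open>u \<in> E\<close> \<open>v \<in> E\<close> by (auto simp: E_def)
    then have "u + v = (a + c) - (b + d)" "a + c \<in> ?T" "b + d \<in> ?T" using add by auto
    then show ?thesis unfolding E_def by blast
  qed
  have Emult: "u * v \<in> E" if "u \<in> E" "v \<in> E" for u v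
  proof -
    obtain a b c d where *: "u = a - b" "v = c - d" "a \<in> ?T" "b \<in> ?T" "c \<in> ?T" "d \<in> ?T"
      using \<open>u \<in> E\<close> \<open>v \<in> E\<close> by (auto simp: E_def)
    then have "u * v = (a * c + b * d) - (a * d + b * c)" by (simp only: ring_distribs) simp
    moreover have "a * c + b * d \<in> ?T" "a * d + b * c \<in> ?T" using * add mult by auto
    ultimately show ?thesis unfolding E_def by blast
  qed
  have TE: "u \<in> E" if "u \<in> ?T" for u
    using that simps unfolding E_def by (intro CollectI exI[of _ u] exI[of _ 0]) auto
  have Eminus: "- u \<in> E" if "u \<in> E" for u
    using that unfolding E_def by force
  have ext: "z \<in> ?T" if z: "z \<in> E" and proper: "\<And>s t. s \<in> ?T \<Longrightarrow> t \<in> ?T \<Longrightarrow> s + z * t \<noteq> - 1" for z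
  proof -
    define S where "S = {s + z * t | s t. s \<in> ?T \<and> t \<in> ?T}"
    have SE: "u \<in> E" if "u \<in> S" for u
      using that z TE Eadd Emult by (auto simp: S_def)
    have TS: "?T \<subseteq> S"
      using simps unfolding S_def by force
    have "field_cone S"
      unfolding field_cone_def
    proof (intro conjI ballI)
      fix u v assume uv: "u \<in> S" "v \<in> S"
      then obtain a b c d where *: "u = a + z * b" "v = c + z * d" "a \<in> ?T" "b \<in> ?T" "c \<in> ?T" "d \<in> ?T"
        by (auto simp: S_def)
      have "u + v = (a + c) + z * (b + d)" "u * v = (a * c + z\<^sup>2 * (b * d)) + z * (a * d + b * c)"
        by (simp_all add: * algebra_simps power2_eq_square)
      moreover have "a + c \<in> ?T" "b + d \<in> ?T" "a * c + z\<^sup>2 * (b * d) \<in> ?T" "a * d + b * c \<in> ?T"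
        using * Esq[OF z] by (blast intro: add mult)+
      ultimately show "u + v \<in> S" "u * v \<in> S" unfolding S_def by blast+
      have "u - v \<in> E" using Eadd[of u "- v"] Eminus SE uv by simp
      then show "(u - v)\<^sup>2 \<in> S" using Esq TS by blast
    next
      fix u assume u: "u \<in> S"
      then obtain a b where *: "u = a + z * b" "a \<in> ?T" "b \<in> ?T"
        by (auto simp: S_def)
      \<comment> \<open>The inverse of \<open>u\<close> is \<open>u\<close> times the inverse of a
        square, and the latter lies in \<open>T\<close>.\<close>
      define i where "i = inverse (u\<^sup>2)"
      have i: "i \<in> ?T" unfolding i_def using Esq SE u inv by blast
      have "inverse u = u * i" unfolding i_def by (cases "u = 0") (auto simp: power2_eq_square)
      also have "\<dots> = a * i + z * (b * i)" by (simp add: * algebra_simps)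
      finally show "inverse u \<in> S" unfolding S_def using * i mult by blast
    next
      show "- 1 \<notin> S" using proper by (force simp: S_def)
      show "to_ac ` {0..} \<subseteq> S" using TS cone_to_ac[OF max_cone] by auto
    qed
    then have "S = ?T" using TS max_cone_maximal by blast
    moreover have "z \<in> S" unfolding S_def using simps by force
    ultimately show ?thesis by simp
  qed
  have E: "x - y \<in> E" "y - x \<in> E" using assms unfolding E_def by auto
  show ?thesis
  proof (rule ccontr)
    assume neg: "\<not> ?thesis"
    obtain s t where st: "s \<in> ?T" "t \<in> ?T" "s + (x - y) * t = - 1" using ext[OF E(1)] neg by blast
    obtain s' t' where st': "s' \<in> ?T" "t' \<in> ?T" "s' + (y - x) * t' = - 1" using ext[OF E(2)] neg by blast
    define z where "z = x - y"
    have z: "z * t = - (1 + s)" "z * t' = 1 + s'"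
      using st(3) st'(3) by (auto simp: z_def algebra_simps eq_neg_iff_add_eq_0)
    have "(1 + s) * t' = - ((1 + s') * t)"
      using z by (metis mult.commute mult.left_commute mult_minus_left minus_minus)
    moreover have "(1 + s') * t \<in> ?T" "(1 + s) * t' \<in> ?T"
      using st st' simps by (blast intro: add mult)+
    ultimately have "- ((1 + s) * t') \<in> ?T" "(1 + s) * t' \<in> ?T"
      by auto
    then have "(1 + s) * t' = 0" using cone_antisym[OF max_cone] by blast
    moreover have "1 + s \<noteq> 0" using st(1) cone_minus1[OF max_cone] by (metis add_eq_0_iff minus_equation_iff)
    moreover have "1 + s' \<noteq> 0" using st'(1) cone_minus1[OF max_cone] by (metis add_eq_0_iff minus_equation_iff)
    ultimately show False using z(2) by auto
  qed
qed

text \<open>By totality \<open>T - T\<close> is the union of \<open>T\<close> and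
  \<open>- T\<close>; in this form the sign of an element is immediate. The carrier sits inside the
  algebraic closure, which later supplies roots of irreducible polynomials.\<close>

typedef (overloaded) 'a real_closure = "{x :: 'a::linordered_field alg_closure. x \<in> max_cone \<or> - x \<in> max_cone}"
  using cone_0[OF max_cone] by blast

setup_lifting type_definition_real_closure

lemma max_cone_ring:
  fixes x y :: "'a::linordered_field alg_closure"
  assumes "x \<in> max_cone \<or> - x \<in> max_cone" "y \<in> max_cone \<or> - y \<in> max_cone"
  shows "x + y \<in> max_cone \<or> - (x + y) \<in> max_cone" "x * y \<in> max_cone \<or> - (x * y) \<in> max_cone"
    "inverse x \<in> max_cone \<or> - inverse x \<in> max_cone"
proof -
  note add = cone_add[OF max_cone] and mult = cone_mult[OF max_cone] and inv = cone_inverse[OF max_cone]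
  show "x + y \<in> max_cone \<or> - (x + y) \<in> max_cone"
    using assms add[of x y] add[of "-x" "-y"] max_cone_total[of x "-y"] max_cone_total[of "-x" y]
    by (auto simp: minus_diff_eq add.commute simp flip: minus_diff_commute)
  show "x * y \<in> max_cone \<or> - (x * y) \<in> max_cone"
    using assms mult[of x y] mult[of "-x" "-y"] mult[of "-x" y] mult[of x "-y"] by auto
  show "inverse x \<in> max_cone \<or> - inverse x \<in> max_cone"
    using assms inv[of x] inv[of "-x"] by auto
qed

instantiation real_closure :: (linordered_field) linordered_field
begin

lift_definition zero_real_closure :: "'a real_closure" is 0 using cone_0[OF max_cone] by simp
lift_definition one_real_closure :: "'a real_closure" is 1 using cone_1[OF max_cone] by blast
lift_definition plus_real_closure :: "'a real_closure \<Rightarrow> 'a real_closure \<Rightarrow> 'a real_closure" is "(+)"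
  by (rule max_cone_ring)
lift_definition minus_real_closure :: "'a real_closure \<Rightarrow> 'a real_closure \<Rightarrow> 'a real_closure" is "(-)"
  using max_cone_ring(1)[of _ "- _"] by (metis diff_conv_add_uminus minus_minus)
lift_definition times_real_closure :: "'a real_closure \<Rightarrow> 'a real_closure \<Rightarrow> 'a real_closure" is "(*)"
  by (rule max_cone_ring)
lift_definition uminus_real_closure :: "'a real_closure \<Rightarrow> 'a real_closure" is uminus by auto
lift_definition inverse_real_closure :: "'a real_closure \<Rightarrow> 'a real_closure" is inverse
  using max_cone_ring(3) by blast
lift_definition divide_real_closure :: "'a real_closure \<Rightarrow> 'a real_closure \<Rightarrow> 'a real_closure" is "(/)"
  unfolding divide_inverse using max_cone_ring by blast
lift_definition less_eq_real_closure :: "'a real_closure \<Rightarrow> 'a real_closure \<Rightarrow> bool" is "\<lambda>x y. y - x \<in> max_cone" .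
lift_definition less_real_closure :: "'a real_closure \<Rightarrow> 'a real_closure \<Rightarrow> bool" is "\<lambda>x y. y - x \<in> max_cone \<and> x \<noteq> y" .
definition abs_real_closure :: "'a real_closure \<Rightarrow> 'a real_closure" where "abs_real_closure x = (if x < 0 then - x else x)"
definition sgn_real_closure :: "'a real_closure \<Rightarrow> 'a real_closure" where
  "sgn_real_closure x = (if x = 0 then 0 else if 0 < x then 1 else - 1)"

instance
proof
  fix x y z :: "'a real_closure"
  show "x + y + z = x + (y + z)" by transfer simp
  show "x + y = y + x" by transfer simp
  show "0 + x = x" by transfer simp
  show "- x + x = 0" by transfer simp
  show "x - y = x + - y" by transfer simp
  show "a + b - a = b" for a b :: "'a real_closure" by transfer simp
  show "a - b - c = a - (b + c)" for a b c :: "'a real_closure" by transfer simp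
  show "0 * a = 0" "a * 0 = 0" for a :: "'a real_closure" by (transfer, simp)+
  show "x * y * z = x * (y * z)" by transfer simp
  show "x * y = y * x" by transfer simp
  show "1 * x = x" by transfer simp
  show "(x + y) * z = x * z + y * z" by transfer (simp add: algebra_simps)
  show "(0::'a real_closure) \<noteq> 1" by transfer simp
  show "x \<noteq> 0 \<Longrightarrow> inverse x * x = 1" by transfer simp
  show "x div y = x * inverse y" by transfer (simp add: divide_inverse)
  show "inverse (0::'a real_closure) = 0" by transfer simp
  show "x < y \<longleftrightarrow> x \<le> y \<and> \<not> y \<le> x"
  proof (transfer, intro iffI conjI; elim conjE)
    fix x y :: "'a alg_closure"
    assume *: "y - x \<in> max_cone" "x \<noteq> y"
    then show "x - y \<notin> max_cone" using cone_antisym[OF max_cone, of "y - x"] by auto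
  qed (auto)
  show "x \<le> x" by transfer (simp add: cone_0[OF max_cone])
  show "x \<le> y \<Longrightarrow> y \<le> z \<Longrightarrow> x \<le> z"
  proof transfer
    fix x y z :: "'a alg_closure"
    assume "y - x \<in> max_cone" "z - y \<in> max_cone"
    then show "z - x \<in> max_cone" using cone_add[OF max_cone, of "z - y" "y - x"] by simp
  qed
  show "x \<le> y \<Longrightarrow> y \<le> x \<Longrightarrow> x = y"
  proof transfer
    fix x y :: "'a alg_closure"
    assume "y - x \<in> max_cone" "x - y \<in> max_cone"
    then show "x = y" using cone_antisym[OF max_cone, of "x - y"] by simp
  qed
  show "x \<le> y \<Longrightarrow> z + x \<le> z + y" by transfer simp
  show "x \<le> y \<or> y \<le> x"
  proof transfer
    fix x y :: "'a alg_closure"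
    assume "x \<in> max_cone \<or> - x \<in> max_cone" "y \<in> max_cone \<or> - y \<in> max_cone"
    then show "y - x \<in> max_cone \<or> x - y \<in> max_cone"
      using max_cone_ring(1)[of y "-x"] by (auto simp: algebra_simps)
  qed
  show "x < y \<Longrightarrow> 0 < z \<Longrightarrow> z * x < z * y"
  proof transfer
    fix x y z :: "'a alg_closure"
    assume "y - x \<in> max_cone \<and> x \<noteq> y" "z - 0 \<in> max_cone \<and> 0 \<noteq> z"
    then show "z * y - z * x \<in> max_cone \<and> z * x \<noteq> z * y"
      using cone_mult[OF max_cone, of z "y - x"] by (simp add: algebra_simps)
  qed
  show "\<bar>x\<bar> = (if x < 0 then - x else x)" by (rule abs_real_closure_def)
  show "sgn x = (if x = 0 then 0 else if 0 < x then 1 else - 1)" by (rule sgn_real_closure_def)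
qed

end

section \<open>The intermediate value property of the real closure\<close>

lemma Rep_real_closure_simps:
  "Rep_real_closure (x + y) = Rep_real_closure x + Rep_real_closure y"
  "Rep_real_closure (x * y) = Rep_real_closure x * Rep_real_closure y"
  "Rep_real_closure 0 = 0" "Rep_real_closure 1 = 1"
  by (transfer; simp)+

lemma nonneg_real_closure_iff: "0 \<le> x \<longleftrightarrow> Rep_real_closure x \<in> max_cone"
  by transfer simp

text \<open>Squares carry nonnegative constant weights because square roots of constants become
  available only with the intermediate value property, which these sums serve to prove.\<close>

inductive_set weighted_squares :: "'a::linordered_field poly set" where
  zero: "0 \<in> weighted_squares"
| add: "s \<in> weighted_squares \<Longrightarrow> c \<ge> 0 \<Longrightarrow> [:c:] * q\<^sup>2 + s \<in> weighted_squares"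

lemma weighted_squares_add: "s \<in> weighted_squares \<Longrightarrow> t \<in> weighted_squares \<Longrightarrow> s + t \<in> weighted_squares"
  by (induction rule: weighted_squares.induct) (simp_all only: add.assoc add_0_left weighted_squares.add)

lemma weighted_squares_mult_square:
  "s \<in> weighted_squares \<Longrightarrow> c \<ge> 0 \<Longrightarrow> [:c:] * q\<^sup>2 * s \<in> weighted_squares"
proof (induction rule: weighted_squares.induct)
  case (add s d r)
  have "[:c:] * q\<^sup>2 * ([:d:] * r\<^sup>2 + s) = [:c * d:] * (q * r)\<^sup>2 + [:c:] * q\<^sup>2 * s"
    by (simp add: algebra_simps power2_eq_square smult_add_right)
  then show ?case using add by (simp only: weighted_squares.add mult_nonneg_nonneg)
qed (simp add: weighted_squares.zero)

lemma weighted_squares_mult: "s \<in> weighted_squares \<Longrightarrow> t \<in> weighted_squares \<Longrightarrow> s * t \<in> weighted_squares"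
proof (induction rule: weighted_squares.induct)
  case (add s c q)
  then show ?case
    using weighted_squares_add[OF weighted_squares_mult_square[of t c q]] by (simp only: ring_distribs)
qed (simp add: weighted_squares.zero)

lemma weighted_squares_square: "q\<^sup>2 \<in> weighted_squares"
  using weighted_squares.add[OF weighted_squares.zero, of 1 q] by simp

lemma weighted_squares_nonneg: "s \<in> weighted_squares \<Longrightarrow> poly s x \<ge> 0"
  by (induction rule: weighted_squares.induct) auto

text \<open>Reducing each \<open>q\<close> modulo \<open>p\<close> changes the sum by a multiple of
  \<open>p\<close>. The degree bound leaves to \<open>1 + t = p * h\<close> a cofactor
  \<open>h\<close> of smaller degree than \<open>p\<close>, which drives the induction in
  \<open>real_closure_ivt\<close>.\<close>

lemma weighted_squares_mod:
  assumes "degree p > 0" "s \<in> weighted_squares"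
  shows "\<exists>t\<in>weighted_squares. p dvd s - t \<and> degree t \<le> 2 * (degree p - 1)"
  using assms(2)
proof (induction rule: weighted_squares.induct)
  case zero
  then show ?case by (intro bexI[of _ 0]) (auto intro: weighted_squares.zero)
next
  case (add s c q)
  then obtain t where t: "t \<in> weighted_squares" "p dvd s - t" "degree t \<le> 2 * (degree p - 1)" by blast
  define r where "r = q mod p"
  have "degree r < degree p"
    using degree_mod_less[of p q] assms(1) by (cases "p = 0") (auto simp: r_def)
  then have dr: "degree (r\<^sup>2) \<le> 2 * (degree p - 1)"
    using degree_mult_le[of r r] by (simp add: power2_eq_square)
  have "p dvd q - r" unfolding r_def by (rule dvd_minus_mod)
  then have "p dvd [:c:] * ((q + r) * (q - r)) + (s - t)"
    using t(2) by (intro dvd_add dvd_mult)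
  also have "[:c:] * ((q + r) * (q - r)) + (s - t) = ([:c:] * q\<^sup>2 + s) - ([:c:] * r\<^sup>2 + t)"
    by (simp only: algebra_simps power2_eq_square)
  finally show ?case
    using t(1,3) dr add.hyps
    by (intro bexI[of _ "[:c:] * r\<^sup>2 + t"] conjI degree_add_le weighted_squares.add)
      (auto intro: order.trans[OF degree_smult_le])
qed

text \<open>A nonzero element of least degree in the ideal of \<open>p\<close> and \<open>q\<close>
  divides both; as it divides the irreducible \<open>p\<close> without being an associate of it, it
  is a unit.\<close>

lemma irreducible_poly_bezout:
  fixes p q :: "'a::field poly"
  assumes irr: "irreducible p" and nd: "\<not> p dvd q"
  shows "\<exists>u v. u * p + v * q = 1"
proof -
  define I where "I = {d. d \<noteq> 0 \<and> (\<exists>u v. d = u * p + v * q)}"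
  have "p \<noteq> 0" using irr by auto
  then have "p \<in> I" unfolding I_def
    by (intro CollectI conjI exI[of _ 1] exI[of _ 0]) auto
  then obtain d where d: "d \<in> I" and dmin: "\<And>e. e \<in> I \<Longrightarrow> degree d \<le> degree e"
    using exists_least_lemma[of "\<lambda>n. \<exists>d\<in>I. degree d = n"]
      arg_min_nat_lemma[of "\<lambda>d. d \<in> I" p degree] by blast
  then obtain u v where uv: "d = u * p + v * q" and "d \<noteq> 0" by (auto simp: I_def)
  have dvd: "d dvd e" if "e = u' * p + v' * q" for e u' v'
  proof -
    have "e mod d = e - (e div d) * d" by (simp add: minus_div_mult_eq_mod)
    also have "\<dots> = (u' - (e div d) * u) * p + (v' - (e div d) * v) * q"
      by (simp add: uv that algebra_simps)
    finally have "e mod d = 0 \<or> e mod d \<in> I" by (auto simp: I_def)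
    moreover have "e mod d = 0 \<or> degree (e mod d) < degree d"
      using degree_mod_less[OF \<open>d \<noteq> 0\<close>] .
    ultimately show ?thesis using dmin by (metis dvd_eq_mod_eq_0 not_le)
  qed
  have "d dvd p" "d dvd q" using dvd[of p 1 0] dvd[of q 0 1] by auto
  then obtain e where e: "p = d * e" by blast
  have "\<not> e dvd 1"
  proof
    assume "e dvd 1"
    then have "p dvd d" by (metis e dvd_mult_unit_iff mult.commute dvd_refl mult_unit_dvd_iff)
    then show False using \<open>d dvd q\<close> nd dvd_trans by blast
  qed
  then have "d dvd 1" using irr e unfolding irreducible_def by blast
  then obtain w where "1 = d * w" by blast
  then have "(w * u) * p + (w * v) * q = 1" by (simp add: uv algebra_simps)
  then show ?thesis by blast
qed

text \<open>A root \<alpha> exists in the algebraic closure. Evaluation at \<alpha> maps the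
  weighted squares onto a cone: the last hypothesis excludes \<open>- 1\<close>, and inverses exist
  because \<open>p\<close> is irreducible. This cone contains \<open>max_cone\<close>, so equals it
  by maximality, and \<alpha> is a difference of two of its elements.\<close>

lemma real_closure_root_of_irreducible:
  fixes p :: "'a::linordered_field real_closure poly"
  assumes irr: "irreducible p" and deg: "degree p > 0"
    and no: "\<And>s. s \<in> weighted_squares \<Longrightarrow> \<not> p dvd 1 + s"
  shows "\<exists>x. poly p x = 0"
proof -
  let ?R = "Rep_real_closure :: 'a real_closure \<Rightarrow> 'a alg_closure"
  have "degree (map_poly ?R p) = degree p"
    by (rule degree_map_poly) (metis Rep_real_closure_inject Rep_real_closure_simps(3))
  then obtain \<alpha> where \<alpha>: "poly (map_poly ?R p) \<alpha> = 0"
    using alg_closed_imp_poly_has_root deg by metis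
  define ev where "ev q = poly (map_poly ?R q) \<alpha>" for q
  have hom: "ev (q + r) = ev q + ev r" "ev (q * r) = ev q * ev r" "ev 1 = 1" "ev 0 = 0"
    "ev (q - r) = ev q - ev r" "ev [:c:] = ?R c" for q r c
  proof -
    show add: "ev (q + r) = ev q + ev r" for q r
    proof -
      have "map_poly ?R (q + r) = map_poly ?R q + map_poly ?R r"
        by (rule poly_eqI) (simp add: coeff_map_poly Rep_real_closure_simps)
      then show ?thesis by (simp add: ev_def)
    qed
    show [simp]: "ev [:c:] = ?R c" for c
      by (cases "c = 0") (simp_all add: ev_def map_poly_pCons Rep_real_closure_simps)
    show "ev 1 = 1" "ev 0 = 0" by (simp_all add: ev_def map_poly_1' Rep_real_closure_simps)
    have pc: "ev (pCons c q) = ?R c + \<alpha> * ev q" for c q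
      by (cases "pCons c q = 0") (auto simp add: ev_def map_poly_pCons Rep_real_closure_simps)
    have sm: "ev (smult c q) = ?R c * ev q" for c q
      by (induction q) (auto simp: pc Rep_real_closure_simps \<open>ev 0 = 0\<close> algebra_simps)
    show "ev (q * r) = ev q * ev r"
      by (induction q) (auto simp: pc sm add Rep_real_closure_simps \<open>ev 0 = 0\<close> algebra_simps)
    show "ev (q - r) = ev q - ev r"
      using add[of "q - r" r] by simp
  qed
  have evp: "ev p = 0" by (simp add: ev_def \<alpha>)
  have inv: "\<exists>u. ev u * ev q = 1" if "ev q \<noteq> 0" for q
  proof -
    have "\<not> p dvd q" using that evp hom by (metis dvd_def mult_zero_left)
    then obtain u v where "u * p + v * q = 1" using irreducible_poly_bezout[OF irr] by blast
    then have "ev (u * p + v * q) = 1" by (simp only: hom)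
    then show ?thesis using evp by (auto simp: hom)
  qed
  have kernel: "p dvd q" if "ev q = 0" for q
  proof (rule ccontr)
    assume "\<not> p dvd q"
    then obtain u v where "u * p + v * q = 1" using irreducible_poly_bezout[OF irr] by blast
    then have "ev (u * p + v * q) = 1" by (simp only: hom)
    then show False using evp that by (simp add: hom)
  qed
  define S where "S = ev ` weighted_squares"
  have "field_cone S"
    unfolding field_cone_def
  proof (intro conjI ballI)
    fix x y assume "x \<in> S" "y \<in> S"
    then obtain s t where *: "x = ev s" "y = ev t" "s \<in> weighted_squares" "t \<in> weighted_squares"
      by (auto simp: S_def)
    then have "x + y = ev (s + t)" "x * y = ev (s * t)" "(x - y)\<^sup>2 = ev ((s - t)\<^sup>2)"
      by (simp_all add: hom power2_eq_square)
    then show "x + y \<in> S" "x * y \<in> S" "(x - y)\<^sup>2 \<in> S"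
      using * weighted_squares_add weighted_squares_mult weighted_squares_square
      unfolding S_def by (metis imageI)+
  next
    fix x assume "x \<in> S"
    then obtain s where *: "x = ev s" "s \<in> weighted_squares" by (auto simp: S_def)
    show "inverse x \<in> S"
    proof (cases "x = 0")
      case True
      then show ?thesis using hom(4) weighted_squares.zero by (auto simp: S_def intro!: image_eqI[of _ _ 0])
    next
      case False
      then obtain u where u: "ev u * x = 1" using inv * by blast
      then have "inverse x = ev u" by (metis inverse_unique mult.commute)
      \<comment> \<open>From \<open>ev u * x = 1\<close> follows
        \<open>ev u = ev u * ev u * x\<close>, which exhibits the inverse as the value of a weighted
        square.\<close>
      also have "\<dots> = ev (u\<^sup>2 * s)" using u * by (simp add: hom power2_eq_square)
      finally show ?thesis
        using * weighted_squares_mult weighted_squares_square by (auto simp: S_def)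
    qed
  next
    show "- 1 \<notin> S"
    proof
      assume "- 1 \<in> S"
      then obtain s where s: "s \<in> weighted_squares" "ev s = - 1" by (auto simp: S_def)
      then have "ev (1 + s) = 0" by (simp add: hom)
      then show False using kernel no s(1) by blast
    qed
    show "to_ac ` {0..} \<subseteq> S"
    proof
      fix x :: "'a alg_closure" assume "x \<in> to_ac ` {0..}"
      then have x: "x \<in> max_cone" using cone_to_ac[OF max_cone] by auto
      then obtain c where c: "?R c = x" using Rep_real_closure_cases by blast
      then have "c \<ge> 0" using x by (simp add: nonneg_real_closure_iff)
      then have "[:c:] * 1\<^sup>2 + 0 \<in> weighted_squares" by (intro weighted_squares.intros)
      moreover have "x = ev ([:c:] * 1\<^sup>2 + 0)" by (simp add: hom c)
      ultimately show "x \<in> S" unfolding S_def by blast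
    qed
  qed
  moreover have "max_cone \<subseteq> S"
  proof
    fix x :: "'a alg_closure" assume x: "x \<in> max_cone"
    then obtain c where c: "?R c = x" using Rep_real_closure_cases by blast
    then have "c \<ge> 0" using x by (simp add: nonneg_real_closure_iff)
    then have "[:c:] * 1\<^sup>2 + 0 \<in> weighted_squares" by (intro weighted_squares.intros)
    moreover have "x = ev ([:c:] * 1\<^sup>2 + 0)" by (simp add: hom c)
    ultimately show "x \<in> S" unfolding S_def by blast
  qed
  ultimately have S: "S = max_cone" by (rule max_cone_maximal)
  define ZZ where "ZZ = ([:0, 1:] :: 'a real_closure poly)"
  have evZZ: "ev ZZ = \<alpha>"
    by (simp add: ev_def ZZ_def map_poly_pCons Rep_real_closure_simps)
  \<comment> \<open>The identity \<open>(z + 1/4)^2 - (z - 1/4)^2 = z\<close> writes \<alpha> as a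
    difference of two elements of the cone.\<close>
  have "ev ((ZZ + [:1/4:])\<^sup>2) \<in> max_cone" "ev ((ZZ - [:1/4:])\<^sup>2) \<in> max_cone"
    using S weighted_squares_square by (auto simp: S_def)
  then obtain a b where ab: "?R a = ev ((ZZ + [:1/4:])\<^sup>2)" "?R b = ev ((ZZ - [:1/4:])\<^sup>2)"
    by (metis (mono_tags, lifting) Rep_real_closure_cases mem_Collect_eq)
  have "?R (a - b) = ev ((ZZ + [:1/4:])\<^sup>2 - (ZZ - [:1/4:])\<^sup>2)"
    using ab hom(5) by (simp add: minus_real_closure.rep_eq)
  also have "(ZZ + [:1/4:])\<^sup>2 - (ZZ - [:1/4:])\<^sup>2 = ZZ"
    by (simp add: ZZ_def power2_eq_square)
  finally have "?R (a - b) = \<alpha>" by (simp add: evZZ)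
  moreover have "poly (map_poly ?R q) (?R x) = ?R (poly q x)" for q x
    by (induction q) (auto simp: map_poly_pCons Rep_real_closure_simps)
  ultimately have "?R (poly p (a - b)) = ?R 0" using \<alpha> by (metis Rep_real_closure_simps(3))
  then show ?thesis by (metis Rep_real_closure_inject)
qed

text \<open>Induction on the degree. Of two proper factors, one changes sign. An irreducible
  \<open>p\<close> without a root divides some \<open>1 + t\<close> with \<open>t\<close> a weighted
  square of low degree; since \<open>1 + t = p * h\<close> is positive everywhere, \<open>h\<close>
  changes sign too, and its root, given by induction, contradicts positivity. If \<open>p\<close>
  has a root outside the interval, the linear factor has the same sign at both ends and is divided
  out.\<close>

lemma real_closure_ivt:
  fixes p :: "'a::linordered_field real_closure poly"
  assumes "a < b" "poly p a * poly p b < 0"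
  shows "\<exists>x. a < x \<and> x < b \<and> poly p x = 0"
  using assms(2)
proof (induction "degree p" arbitrary: p rule: less_induct)
  case less
  have p0: "p \<noteq> 0" using less.prems by auto
  have deg: "degree p > 0"
  proof (rule ccontr)
    assume "\<not> degree p > 0"
    then obtain c where "p = [:c:]" by (metis degree_eq_zeroE gr0I)
    with less.prems show False using zero_le_square[of c] by (auto simp: not_le[symmetric])
  qed
  have fact: ?case if p: "p = q * r" and dq: "degree q < degree p" and dr: "degree r < degree p" for q r
  proof -
    have "(poly q a * poly q b) * (poly r a * poly r b) < 0"
      using less.prems by (simp add: p mult_ac)
    then have "poly q a * poly q b < 0 \<or> poly r a * poly r b < 0"
      by (metis mult_nonneg_nonneg not_le)
    then show ?thesis
      using less.hyps[OF dq] less.hyps[OF dr] p by (metis mult_zero_left mult_zero_right poly_mult)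
  qed
  show ?case
  proof (cases "irreducible p")
    case False
    moreover have "\<not> p dvd 1" using deg by (simp add: is_unit_iff_degree p0)
    ultimately obtain q r where qr: "p = q * r" "\<not> q dvd 1" "\<not> r dvd 1"
      using p0 unfolding irreducible_def by blast
    then have "degree q > 0" "degree r > 0"
      using p0 is_unit_iff_degree by (metis mult_zero_left mult_zero_right gr0I)+
    then show ?thesis using fact[OF qr(1)] p0 qr(1) by (simp add: degree_mult_eq)
  next
    case True
    have "\<not> p dvd 1 + s" if "s \<in> weighted_squares" for s
    proof
      assume dvd: "p dvd 1 + s"
      obtain t where t: "t \<in> weighted_squares" "p dvd s - t" "degree t \<le> 2 * (degree p - 1)"
        using weighted_squares_mod[OF deg \<open>s \<in> weighted_squares\<close>] by blast
      have "p dvd 1 + t" using dvd t(2) dvd_diff[OF dvd t(2)] by simp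
      then obtain h where h: "1 + t = p * h" by blast
      have pos: "poly (1 + t) x > 0" for x
        using weighted_squares_nonneg[OF t(1), of x] by (simp add: add_pos_nonneg)
      have "h \<noteq> 0" using pos[of 0] h by auto
      then have "degree p + degree h = degree (1 + t)" using p0 h by (simp add: degree_mult_eq)
      also have "\<dots> \<le> 2 * (degree p - 1)" using t(3) by (intro degree_add_le) auto
      finally have dh: "degree h < degree p" using deg by linarith
      have "0 < (poly p a * poly h a) * (poly p b * poly h b)"
        using pos[of a] pos[of b] by (simp add: h)
      then have "(poly p a * poly p b) * (poly h a * poly h b) > 0" by (simp add: mult_ac)
      then have "poly h a * poly h b < 0"
        using less.prems by (metis mult_neg_pos not_less_iff_gr_or_eq mult_zero_right)
      then obtain x where "poly h x = 0" using less.hyps[OF dh] by blast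
      then show False using pos[of x] by (simp add: h)
    qed
    then obtain x where x: "poly p x = 0"
      using real_closure_root_of_irreducible[OF True deg] by blast
    then obtain r where r: "p = [:- x, 1:] * r" by (metis dvd_def poly_eq_0_iff_dvd)
    show ?thesis
    proof (cases "a < x \<and> x < b")
      case False
      have "x \<noteq> a" "x \<noteq> b" using x less.prems by auto
      then have "(a - x) * (b - x) > 0"
        using False \<open>a < b\<close> by (auto simp: zero_less_mult_iff)
      moreover have "((a - x) * (b - x)) * (poly r a * poly r b) < 0"
        using less.prems by (simp add: r algebra_simps)
      ultimately have "poly r a * poly r b < 0"
        by (metis mult_less_0_iff not_less_iff_gr_or_eq)
      moreover have "r \<noteq> 0" using r p0 by auto
      then have "degree r < degree p" unfolding r by (subst degree_mult_eq) auto
      ultimately obtain y where "a < y" "y < b" "poly r y = 0" using less.hyps by blast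
      then show ?thesis using r by auto
    qed (use x in blast)
  qed
qed

text \<open>The polynomial is written as a sum because a class axiom cannot apply \<open>poly\<close> to the class
  under definition.\<close>

class real_closed_field = linordered_field +
  assumes ivt_sum: "a < b \<Longrightarrow> (\<Sum>k\<le>n. c k * a ^ k) * (\<Sum>k\<le>n. c k * b ^ k) < 0 \<Longrightarrow>
    \<exists>x. a < x \<and> x < b \<and> (\<Sum>k\<le>(n::nat). c k * x ^ k) = 0"

lemma poly_sum_monom: "poly (\<Sum>k\<le>n. monom (c k) k) (x :: 'a::comm_semiring_1) = (\<Sum>k\<le>n. c k * x ^ k)"
  by (simp add: poly_sum Polynomial.poly_monom)

instance real_closure :: (linordered_field) real_closed_field
proof
  fix a b :: "'a real_closure" and n and c :: "nat \<Rightarrow> 'a real_closure"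
  assume "a < b" "(\<Sum>k\<le>n. c k * a ^ k) * (\<Sum>k\<le>n. c k * b ^ k) < 0"
  then show "\<exists>x. a < x \<and> x < b \<and> (\<Sum>k\<le>n. c k * x ^ k) = 0"
    using real_closure_ivt[of a b "\<Sum>k\<le>n. monom (c k) k"] unfolding poly_sum_monom by blast
qed

instance real :: real_closed_field
proof
  fix a b :: real and n and c :: "nat \<Rightarrow> real"
  assume "a < b" "(\<Sum>k\<le>n. c k * a ^ k) * (\<Sum>k\<le>n. c k * b ^ k) < 0"
  then show "\<exists>x. a < x \<and> x < b \<and> (\<Sum>k\<le>n. c k * x ^ k) = 0"
    using poly_IVT[of a b "\<Sum>k\<le>n. monom (c k) k"] unfolding poly_sum_monom by blast
qed

section \<open>Rolle's theorem and signs of polynomials over a real closed field\<close>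

lemma poly_ivt:
  fixes p :: "'a::real_closed_field poly"
  assumes "a < b" "poly p a * poly p b < 0"
  shows "\<exists>x. a < x \<and> x < b \<and> poly p x = 0"
  using ivt_sum[of a b "coeff p" "degree p"] assms by (simp add: poly_altdef)

text \<open>Values are in \<open>int\<close>, whatever the argument type, so that signs in two
  different fields can be compared.\<close>

definition sg :: "'a::linordered_idom \<Rightarrow> int" where
  "sg x = (if 0 < x then 1 else if x < 0 then - 1 else 0)"

lemma sg_mult: "sg (x * y) = sg x * sg y"
  by (auto simp: sg_def zero_less_mult_iff mult_less_0_iff)

lemma sg_eq_0_iff [simp]: "sg x = 0 \<longleftrightarrow> x = 0"
  by (auto simp: sg_def)

lemma sg_0 [simp]: "sg 0 = 0"
  by (simp add: sg_def)

lemma sg_pos [simp]: "0 < x \<Longrightarrow> sg x = 1"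
  by (simp add: sg_def)

lemma sg_minus [simp]: "sg (- x) = - sg x"
  by (auto simp: sg_def)

lemma mult_neg_if_sg: "sg x \<noteq> sg y \<Longrightarrow> x \<noteq> 0 \<Longrightarrow> y \<noteq> 0 \<Longrightarrow> x * y < 0"
  by (auto simp: sg_def mult_less_0_iff split: if_splits)

lemma sg_poly_eq:
  fixes p :: "'a::real_closed_field poly"
  assumes "a \<le> b" "\<And>x. a \<le> x \<Longrightarrow> x \<le> b \<Longrightarrow> poly p x \<noteq> 0"
  shows "sg (poly p a) = sg (poly p b)"
proof (rule ccontr)
  assume neq: "sg (poly p a) \<noteq> sg (poly p b)"
  then have "a < b" using assms(1) by (cases "a = b") auto
  then show False
    using poly_ivt[OF _ mult_neg_if_sg[OF neq]] assms by (metis less_imp_le order_refl)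
qed

text \<open>With \<open>b'\<close> the next root after \<open>a\<close>, write
  \<open>p = (X - a)^m (X - b')^n r\<close>, where \<open>r\<close> has constant sign on
  \<open>[a, b']\<close>. Then \<open>pderiv p = (X - a)^(m-1) (X - b')^(n-1) h\<close>, and
  \<open>h\<close> takes the values \<open>m (a - b') r(a)\<close> at \<open>a\<close> and
  \<open>n (b' - a) r(b')\<close> at \<open>b'\<close>. These have opposite signs, so
  \<open>h\<close> vanishes in between.\<close>

lemma poly_rolle:
  fixes p :: "'a::real_closed_field poly"
  assumes "a < b" "poly p a = 0" "poly p b = 0"
  shows "\<exists>x. a < x \<and> x < b \<and> poly (pderiv p) x = 0"
proof (cases "p = 0")
  case True
  then show ?thesis using dense[OF assms(1)] by auto
next
  case False
  define S where "S = {x. poly p x = 0 \<and> a < x \<and> x \<le> b}"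
  have fin: "finite S" using poly_roots_finite[OF False] by (auto simp: S_def intro: finite_subset[rotated])
  have "b \<in> S" using assms by (auto simp: S_def)
  define b' where "b' = Min S"
  have b': "b' \<in> S" "\<And>x. x \<in> S \<Longrightarrow> b' \<le> x" unfolding b'_def using fin \<open>b \<in> S\<close> by (auto intro: Min_in)
  obtain q where q: "p = [:- a, 1:] ^ order a p * q" "\<not> [:- a, 1:] dvd q" using order_decomp[OF False] by blast
  then have "q \<noteq> 0" by auto
  obtain r where r: "q = [:- b', 1:] ^ order b' q * r" "\<not> [:- b', 1:] dvd r" using order_decomp[OF \<open>q \<noteq> 0\<close>] by blast
  define m where "m = order a p"
  define n where "n = order b' q"
  have pr: "p = [:- a, 1:] ^ m * ([:- b', 1:] ^ n * r)" using q r by (simp add: m_def n_def)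
  have "m \<noteq> 0" using False assms(2) by (simp add: m_def order_root)
  then obtain m' where m': "m = Suc m'" using not0_implies_Suc by blast
  have "a < b'" using b' by (auto simp: S_def)
  have "n \<noteq> 0"
  proof -
    have "p = [:- a, 1:] ^ m * q" using q(1) by (simp only: m_def)
    then have "poly p b' = (b' - a) ^ m * poly q b'" by simp
    then have "poly q b' = 0" using b'(1) \<open>a < b'\<close> by (auto simp: S_def)
    then show ?thesis using \<open>q \<noteq> 0\<close> by (simp add: n_def order_root)
  qed
  then obtain n' where n': "n = Suc n'" using not0_implies_Suc by blast
  have ra: "poly r a \<noteq> 0" using q(2) r(1) by (metis dvd_mult poly_eq_0_iff_dvd)
  have rb: "poly r b' \<noteq> 0" using r(2) by (metis poly_eq_0_iff_dvd)
  have rx: "poly r x \<noteq> 0" if "a \<le> x" "x \<le> b'" for x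
  proof
    assume "poly r x = 0"
    then have "x \<noteq> a" "x \<noteq> b'" "poly p x = 0" using ra rb pr by auto
    then have "x \<in> S" using that b'(1) by (auto simp: S_def)
    then show False using b'(2) that \<open>x \<noteq> b'\<close> by force
  qed
  then have sgr: "sg (poly r a) = sg (poly r b')" using \<open>a < b'\<close> by (intro sg_poly_eq) auto
  define h where "h = (smult (of_nat m) [:- b', 1:] + smult (of_nat n) [:- a, 1:]) * r + [:- a, 1:] * [:- b', 1:] * pderiv r"
  have pd: "pderiv p = [:- a, 1:] ^ m' * [:- b', 1:] ^ n' * h"
  proof -
    define u where "u = [:- a, 1:]"
    define w where "w = [:- b', 1:]"
    define cm where "cm = [:of_nat m :: 'a:]"
    define cn where "cn = [:of_nat n :: 'a:]"
    have du: "pderiv (u ^ m) = cm * u ^ m'" "pderiv (w ^ n) = cn * w ^ n'"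
      unfolding m' n' pderiv_power_Suc cm_def cn_def by (simp_all add: pderiv_pCons u_def w_def del: of_nat_Suc)
    have "h = (cm * w + cn * u) * r + u * w * pderiv r"
      by (simp add: h_def cm_def cn_def u_def w_def mult.commute)
    moreover have "p = u ^ m * (w ^ n * r)" using pr by (simp add: u_def w_def)
    ultimately have "pderiv p = u ^ m' * w ^ n' * h"
      by (simp add: pderiv_mult du) (simp add: m' n' algebra_simps)
    then show ?thesis by (simp only: u_def w_def)
  qed
  have "poly h a = of_nat m * (a - b') * poly r a" "poly h b' = of_nat n * (b' - a) * poly r b'"
    by (simp_all add: h_def algebra_simps)
  then have "sg (poly h a) = - sg (poly r a)" "sg (poly h b') = sg (poly r b')"
    using \<open>a < b'\<close> m' n' sg_minus[of "b' - a"] by (simp_all add: sg_mult del: of_nat_Suc sg_minus)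
  moreover have "sg (poly r a) \<noteq> 0" "sg (poly r b') \<noteq> 0" using ra rb by simp_all
  ultimately have "sg (poly h a) \<noteq> sg (poly h b')" "sg (poly h a) \<noteq> 0" "sg (poly h b') \<noteq> 0"
    using sgr by linarith+
  then have "sg (poly h a) \<noteq> sg (poly h b')" "poly h a \<noteq> 0" "poly h b' \<noteq> 0" by simp_all
  then obtain x where "a < x" "x < b'" "poly h x = 0"
    using poly_ivt[OF \<open>a < b'\<close> mult_neg_if_sg] by blast
  then show ?thesis using pd b'(1) by (intro exI[of _ x]) (auto simp: S_def)
qed

lemma poly_mvt:
  fixes p :: "'a::real_closed_field poly"
  assumes "a < b"
  shows "\<exists>x. a < x \<and> x < b \<and> poly p b - poly p a = (b - a) * poly (pderiv p) x"
proof -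
  define s where "s = (poly p b - poly p a) / (b - a)"
  define q where "q = p - [:poly p a - s * a, s:]"
  have s: "s * (b - a) = poly p b - poly p a" using assms by (simp add: s_def)
  have "poly q a = 0" "poly q b = 0" using s by (simp_all add: q_def algebra_simps)
  then obtain x where "a < x" "x < b" "poly (pderiv q) x = 0" using poly_rolle[OF assms] by blast
  then show ?thesis using s by (intro exI[of _ x]) (auto simp: q_def pderiv_diff pderiv_pCons mult.commute)
qed

lemma sg_poly_right_of_root:
  fixes p :: "'a::real_closed_field poly"
  assumes "a < b" "poly p a = 0" "\<And>x. a < x \<Longrightarrow> x \<le> b \<Longrightarrow> sg (poly (pderiv p) x) = e"
  shows "sg (poly p b) = e"
proof -
  obtain x where x: "a < x" "x < b" "poly p b - poly p a = (b - a) * poly (pderiv p) x"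
    using poly_mvt[OF assms(1)] by blast
  then have "sg (poly p b) = sg (poly (pderiv p) x)" using assms by (simp add: sg_mult)
  then show ?thesis using assms(3) x by auto
qed

text \<open>The induction needs the uniform bound \<open>c\<close>, not just positivity:
  \<open>x * poly p x\<close> must outgrow the constant coefficient \<open>a\<close>, and from
  \<open>x \<ge> (1 - a) / c\<close> on the value is at least 1.\<close>

lemma poly_at_top_pos:
  fixes p :: "'a::linordered_field poly"
  assumes "lead_coeff p > 0"
  shows "\<exists>B c. c > 0 \<and> (\<forall>x\<ge>B. poly p x \<ge> c)"
  using assms
proof (induction p)
  case (pCons a p)
  show ?case
  proof (cases "p = 0")
    case True
    then show ?thesis using pCons.prems by (intro exI[of _ 0] exI[of _ a]) simp
  next
    case False
    then obtain B c where Bc: "c > 0" "\<And>x. x \<ge> B \<Longrightarrow> poly p x \<ge> c" using pCons by auto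
    have "poly (pCons a p) x \<ge> 1" if "x \<ge> max (max B 0) ((1 - a) / c)" for x
    proof -
      have "x * c \<le> x * poly p x" using that Bc by (intro mult_left_mono) auto
      moreover have "1 - a \<le> x * c" using that Bc by (simp add: pos_divide_le_eq)
      ultimately show ?thesis by simp
    qed
    then show ?thesis by (intro exI[of _ "max (max B 0) ((1 - a) / c)"] exI[of _ 1]) auto
  qed
qed simp

lemma sg_poly_at_top:
  fixes p :: "'a::linordered_field poly"
  shows "\<exists>B. \<forall>x\<ge>B. sg (poly p x) = sg (lead_coeff p)"
proof -
  consider "p = 0" | "lead_coeff p > 0" | "lead_coeff (- p) > 0"
    using linorder_less_linear[of "lead_coeff p" 0] by auto
  then show ?thesis
  proof cases
    case 2
    then show ?thesis using poly_at_top_pos[OF 2] by (metis sg_pos less_le_trans)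
  next
    case 3
    then obtain B c where "c > 0" "\<forall>x\<ge>B. poly (- p) x \<ge> c" using poly_at_top_pos by blast
    then have "sg (poly p x) = sg (lead_coeff p)" if "x \<ge> B" for x
      using that 3 by (force simp: sg_def)
    then show ?thesis by blast
  qed auto
qed

lemma sg_poly_at_bot:
  fixes p :: "'a::linordered_field poly"
  shows "\<exists>B. \<forall>x\<le>B. sg (poly p x) = sg (lead_coeff p) * (- 1) ^ degree p"
proof -
  obtain B where B: "\<And>x. x \<ge> B \<Longrightarrow> sg (poly (pcompose p [:0, - 1:]) x) = sg (lead_coeff (pcompose p [:0, - 1:]))"
    using sg_poly_at_top by blast
  have pow: "sg ((- 1 :: 'a) ^ n) = (- 1) ^ n" for n by (induction n) auto
  have "sg (poly p x) = sg (lead_coeff p) * (- 1) ^ degree p" if "x \<le> - B" for x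
    using B[of "- x"] that by (simp add: poly_pcompose lead_coeff_comp sg_mult pow)
  then show ?thesis by blast
qed

lemma ex_between_finite:
  fixes S T :: "'a::linordered_field set"
  assumes "finite S" "finite T" "\<And>s t. s \<in> S \<Longrightarrow> t \<in> T \<Longrightarrow> s < t"
  shows "\<exists>y. (\<forall>s\<in>S. s < y) \<and> (\<forall>t\<in>T. y < t)"
proof -
  consider "S = {}" "T = {}" | "S = {}" "T \<noteq> {}" | "S \<noteq> {}" "T = {}" | "S \<noteq> {}" "T \<noteq> {}" by blast
  then show ?thesis
  proof cases
    case 2
    obtain y where "y < Min T" using lt_ex by blast
    with 2 assms show ?thesis by (intro exI[of _ y]) auto
  next
    case 3
    obtain y where "y > Max S" using gt_ex by blast
    with 3 assms show ?thesis by (intro exI[of _ y]) auto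
  next
    case 4
    then have "Max S < Min T" using assms by (simp add: Max_in Min_in)
    then obtain y where "Max S < y" "y < Min T" using dense by blast
    with 4 assms show ?thesis by (intro exI[of _ y]) auto
  qed auto
qed

section \<open>Sign tables\<close>

text \<open>The graph of an order isomorphism between two finite sets: the roots in one field and
  the corresponding roots in the other.\<close>

definition order_matching :: "('a::linorder \<times> 'b::linorder) set \<Rightarrow> bool" where
  "order_matching Z \<longleftrightarrow> finite Z \<and> (\<forall>(a, b)\<in>Z. \<forall>(a', b')\<in>Z. a < a' \<longleftrightarrow> b < b')"

text \<open>The points \<open>x\<close> and \<open>y\<close> lie at corresponding nodes or in
  corresponding gaps.\<close>

definition matched :: "('a::linorder \<times> 'b::linorder) set \<Rightarrow> 'a \<Rightarrow> 'b \<Rightarrow> bool" where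
  "matched Z x y \<longleftrightarrow> (\<forall>(a, b)\<in>Z. (a < x \<longleftrightarrow> b < y) \<and> (x < a \<longleftrightarrow> y < b))"

lemma order_matching_converse: "order_matching Z \<Longrightarrow> order_matching (Z\<inverse>)"
  unfolding order_matching_def by fastforce

lemma matched_converse: "matched (Z\<inverse>) y x \<longleftrightarrow> matched Z x y"
  unfolding matched_def by fastforce

lemma matched_mem: "order_matching Z \<Longrightarrow> (a, b) \<in> Z \<Longrightarrow> matched Z a b"
  unfolding order_matching_def matched_def by blast

lemma matched_mem_eq: "matched Z x y \<Longrightarrow> (x, b) \<in> Z \<Longrightarrow> y = b"
  unfolding matched_def by (metis (mono_tags, lifting) case_prodD linorder_less_linear order_less_irrefl)

lemma ex_matched:
  fixes Z :: "('a::linordered_field \<times> 'b::linordered_field) set"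
  assumes Z: "order_matching Z"
  shows "\<exists>y. matched Z x y"
proof (cases "x \<in> Domain Z")
  case True
  then show ?thesis using matched_mem[OF Z] by auto
next
  case False
  have mono: "a < a' \<longleftrightarrow> b < b'" if "(a, b) \<in> Z" "(a', b') \<in> Z" for a b a' b'
    using Z that unfolding order_matching_def by blast
  have fin: "finite Z" using Z by (simp add: order_matching_def)
  define S where "S = snd ` {z \<in> Z. fst z < x}"
  define T where "T = snd ` {z \<in> Z. x < fst z}"
  have "\<exists>y. (\<forall>s\<in>S. s < y) \<and> (\<forall>t\<in>T. y < t)"
  proof (rule ex_between_finite)
    show "finite S" "finite T" using fin by (simp_all add: S_def T_def)
    fix s t assume "s \<in> S" "t \<in> T"
    then obtain a a' where "(a, s) \<in> Z" "a < x" "(a', t) \<in> Z" "x < a'"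
      unfolding S_def T_def by force
    then show "s < t" using mono less_trans by blast
  qed
  then obtain y where "\<forall>s\<in>S. s < y" "\<forall>t\<in>T. y < t" by blast
  then have y: "\<And>s. s \<in> S \<Longrightarrow> s < y" "\<And>t. t \<in> T \<Longrightarrow> y < t" by blast+
  have "(a < x \<longleftrightarrow> b < y) \<and> (x < a \<longleftrightarrow> y < b)" if "(a, b) \<in> Z" for a b
  proof -
    have "a \<noteq> x" using that False by blast
    then consider "a < x" | "x < a" by fastforce
    then show ?thesis
    proof cases
      case 1
      then have "b \<in> S" using that unfolding S_def by force
      then show ?thesis using y(1) 1 by force
    next
      case 2
      then have "b \<in> T" using that unfolding T_def by force
      then show ?thesis using y(2) 2 by force
    qed
  qed
  then show ?thesis unfolding matched_def by blast
qed

lemma matched_shift: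
  assumes "matched Z x y" "\<And>a. a \<in> Domain Z \<Longrightarrow> (a < x \<longleftrightarrow> a < x') \<and> (x < a \<longleftrightarrow> x' < a)"
  shows "matched Z x' y"
  using assms unfolding matched_def by fastforce

definition signs_agree :: "('a::linordered_idom poly \<times> 'b::linordered_idom poly) set \<Rightarrow> 'a \<Rightarrow> 'b \<Rightarrow> bool" where
  "signs_agree \<Phi> x y \<longleftrightarrow> (\<forall>(p, q)\<in>\<Phi>. sg (poly p x) = sg (poly q y))"

text \<open>The multiplier \<open>c\<close> is positive so that \<open>p\<close> and
  \<open>r\<close> have the same sign at every root of \<open>q\<close>.\<close>

definition pseudo_rem :: "'a::linordered_idom poly \<Rightarrow> 'a poly \<Rightarrow> 'a poly \<Rightarrow> bool" where
  "pseudo_rem p q r \<longleftrightarrow> (\<exists>c s. c > 0 \<and> r = smult c p - s * q)"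

text \<open>The input of Hoermander's elimination. Only coefficient signs are compared; closure
  under derivatives and remainders then determines the arrangement of all roots and the signs
  between them.\<close>

definition linked :: "('a::linordered_idom poly \<times> 'b::linordered_idom poly) set \<Rightarrow> bool" where
  "linked \<Phi> \<longleftrightarrow> finite \<Phi> \<and> (\<forall>(p, q)\<in>\<Phi>. \<forall>i. sg (coeff p i) = sg (coeff q i)) \<and>
    (\<forall>(p, q)\<in>\<Phi>. degree p > 0 \<longrightarrow> (pderiv p, pderiv q) \<in> \<Phi>) \<and>
    (\<forall>(p, q)\<in>\<Phi>. \<forall>(p', q')\<in>\<Phi>. degree p' > 0 \<longrightarrow>
      (\<exists>(r, s)\<in>\<Phi>. degree r < degree p' \<and> pseudo_rem p p' r \<and> pseudo_rem q q' s))"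

text \<open>That each node is a root of a nonconstant member makes the sign of a further polynomial
  at the node computable from a remainder.\<close>

definition sign_table :: "('a::linordered_idom poly \<times> 'b::linordered_idom poly) set \<Rightarrow> ('a \<times> 'b) set \<Rightarrow> bool" where
  "sign_table \<Phi> Z \<longleftrightarrow> order_matching Z \<and> (\<forall>(a, b)\<in>Z. \<exists>(p, q)\<in>\<Phi>. degree p > 0 \<and> poly p a = 0) \<and>
    (\<forall>x y. matched Z x y \<longrightarrow> signs_agree \<Phi> x y)"

lemma sg_coeff_degree:
  assumes "\<And>i. sg (coeff p i) = sg (coeff q i)"
  shows "degree p = degree q" "p = 0 \<longleftrightarrow> q = 0"
proof -
  have z: "coeff p i = 0 \<longleftrightarrow> coeff q i = 0" for i using assms[of i] by (metis sg_eq_0_iff)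
  show "degree p = degree q"
    by (rule antisym; rule degree_le) (use z coeff_eq_0 in blast)+
  show "p = 0 \<longleftrightarrow> q = 0" using z by (auto simp: poly_eq_iff)
qed

lemma linkedI:
  assumes "finite \<Phi>" "\<And>p q i. (p, q) \<in> \<Phi> \<Longrightarrow> sg (coeff p i) = sg (coeff q i)"
    and "\<And>p q. (p, q) \<in> \<Phi> \<Longrightarrow> degree p > 0 \<Longrightarrow> (pderiv p, pderiv q) \<in> \<Phi>"
    and "\<And>p q p' q'. (p, q) \<in> \<Phi> \<Longrightarrow> (p', q') \<in> \<Phi> \<Longrightarrow> degree p' > 0 \<Longrightarrow>
      \<exists>(r, s)\<in>\<Phi>. degree r < degree p' \<and> pseudo_rem p p' r \<and> pseudo_rem q q' s"
  shows "linked \<Phi>"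
  unfolding linked_def using assms by blast

lemma linked_coeff: "linked \<Phi> \<Longrightarrow> (p, q) \<in> \<Phi> \<Longrightarrow> sg (coeff p i) = sg (coeff q i)"
  unfolding linked_def by blast

lemma linked_degree: "linked \<Phi> \<Longrightarrow> (p, q) \<in> \<Phi> \<Longrightarrow> degree p = degree q"
  by (rule sg_coeff_degree) (rule linked_coeff)

lemma linked_eq_0: "linked \<Phi> \<Longrightarrow> (p, q) \<in> \<Phi> \<Longrightarrow> p = 0 \<longleftrightarrow> q = 0"
  by (rule sg_coeff_degree) (rule linked_coeff)

lemma linked_pderiv: "linked \<Phi> \<Longrightarrow> (p, q) \<in> \<Phi> \<Longrightarrow> degree p > 0 \<Longrightarrow> (pderiv p, pderiv q) \<in> \<Phi>"
  unfolding linked_def by blast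

lemma linked_rem:
  assumes "linked \<Phi>" "(p, q) \<in> \<Phi>" "(p', q') \<in> \<Phi>" "degree p' > 0"
  obtains r s where "(r, s) \<in> \<Phi>" "degree r < degree p'" "pseudo_rem p p' r" "pseudo_rem q q' s"
  using assms unfolding linked_def by fast

lemma linked_converse:
  assumes "linked \<Phi>"
  shows "linked (\<Phi>\<inverse>)"
proof (rule linkedI)
  show "finite (\<Phi>\<inverse>)" using assms by (simp add: linked_def)
next
  fix p q i assume "(p, q) \<in> \<Phi>\<inverse>"
  then show "sg (coeff p i) = sg (coeff q i)" using linked_coeff[OF assms] by (metis converseD)
next
  fix p q assume "(p, q) \<in> \<Phi>\<inverse>" "degree p > 0"
  then show "(pderiv p, pderiv q) \<in> \<Phi>\<inverse>"
    using linked_degree[OF assms] linked_pderiv[OF assms] by (metis converse_iff)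
next
  fix q p q' p' assume *: "(q, p) \<in> \<Phi>\<inverse>" "(q', p') \<in> \<Phi>\<inverse>" "0 < degree q'"
  then have d: "degree p' = degree q'" using linked_degree[OF assms] by auto
  with * obtain r s where "(r, s) \<in> \<Phi>" "degree r < degree p'" "pseudo_rem p p' r" "pseudo_rem q q' s"
    using linked_rem[OF assms, of p q p' q'] by auto
  then show "\<exists>(r, s)\<in>\<Phi>\<inverse>. degree r < degree q' \<and> pseudo_rem q q' r \<and> pseudo_rem p p' s"
    using d linked_degree[OF assms] by (intro bexI[of _ "(s, r)"]) auto
qed

text \<open>Derivatives and remainders have degree strictly below that of some member, so a pair of
  maximal degree is never one of them.\<close>

lemma linked_remove_max:
  assumes "linked \<Phi>" "(p, q) \<in> \<Phi>" "\<And>p' q'. (p', q') \<in> \<Phi> \<Longrightarrow> degree p' \<le> degree p"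
  shows "linked (\<Phi> - {(p, q)})"
proof (rule linkedI)
  show "finite (\<Phi> - {(p, q)})" using assms by (simp add: linked_def)
next
  fix p' q' i assume "(p', q') \<in> \<Phi> - {(p, q)}"
  then show "sg (coeff p' i) = sg (coeff q' i)" using linked_coeff[OF assms(1)] by blast
next
  fix p' q' assume *: "(p', q') \<in> \<Phi> - {(p, q)}" "degree p' > 0"
  then have "(pderiv p', pderiv q') \<in> \<Phi>" "degree p' \<le> degree p"
    using linked_pderiv[OF assms(1)] assms(3) by auto
  moreover have "degree (pderiv p') < degree p'" using * by (simp add: degree_pderiv)
  ultimately show "(pderiv p', pderiv q') \<in> \<Phi> - {(p, q)}" by auto
next
  fix p1 q1 p' q' assume *: "(p1, q1) \<in> \<Phi> - {(p, q)}" "(p', q') \<in> \<Phi> - {(p, q)}" "0 < degree p'"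
  then obtain r s where rs: "(r, s) \<in> \<Phi>" "degree r < degree p'" "pseudo_rem p1 p' r" "pseudo_rem q1 q' s"
    using linked_rem[OF assms(1), of p1 q1 p' q'] by auto
  moreover have "degree p' \<le> degree p" using * assms(3) by auto
  ultimately show "\<exists>(r, s)\<in>\<Phi> - {(p, q)}. degree r < degree p' \<and> pseudo_rem p1 p' r \<and> pseudo_rem q1 q' s"
    by (intro bexI[of _ "(r, s)"]) auto
qed

lemma sign_table_agree: "sign_table \<Phi> Z \<Longrightarrow> matched Z x y \<Longrightarrow> (p, q) \<in> \<Phi> \<Longrightarrow> sg (poly p x) = sg (poly q y)"
  unfolding sign_table_def signs_agree_def by blast

lemma sign_table_converse:
  assumes "linked \<Phi>" "sign_table \<Phi> Z"
  shows "sign_table (\<Phi>\<inverse>) (Z\<inverse>)"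
  unfolding sign_table_def
proof (intro conjI allI impI ballI)
  show "order_matching (Z\<inverse>)" using assms(2) by (auto simp: sign_table_def intro: order_matching_converse)
next
  fix z assume "z \<in> Z\<inverse>"
  then obtain a b where z: "z = (b, a)" and ab: "(a, b) \<in> Z" by blast
  then obtain p q where pq: "(p, q) \<in> \<Phi>" "degree p > 0" "poly p a = 0"
    using assms(2) unfolding sign_table_def by blast
  have "matched Z a b" using ab assms(2) matched_mem unfolding sign_table_def by blast
  then have "poly q b = 0" using sign_table_agree[OF assms(2) _ pq(1)] pq(3) by force
  then show "case z of (b, a) \<Rightarrow> \<exists>(p, q)\<in>\<Phi>\<inverse>. degree p > 0 \<and> poly p b = 0"
    unfolding z prod.case using pq linked_degree[OF assms(1) pq(1)] by (intro bexI[of _ "(q, p)"]) auto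
next
  fix x y assume "matched (Z\<inverse>) x y"
  then have "signs_agree \<Phi> y x" using assms(2) by (simp add: matched_converse sign_table_def)
  then show "signs_agree (\<Phi>\<inverse>) x y" unfolding signs_agree_def by fastforce
qed

text \<open>A nonzero polynomial of the table has no roots off the matching: its sign is constant on a
  gap, so one root there would give infinitely many.\<close>

lemma sign_table_roots:
  fixes \<Phi> :: "('a::linordered_field poly \<times> 'b::linordered_field poly) set"
  assumes "sign_table \<Phi> Z" "(p, q) \<in> \<Phi>" "p \<noteq> 0" "poly p x = 0"
  shows "x \<in> Domain Z"
proof (rule ccontr)
  assume x: "x \<notin> Domain Z"
  have Z: "order_matching Z" using assms(1) by (simp add: sign_table_def)
  then obtain y where y: "matched Z x y" using ex_matched by blast
  have "finite (Domain Z)" using Z by (simp add: order_matching_def finite_Domain)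
  then have "\<exists>w. (\<forall>s\<in>{x}. s < w) \<and> (\<forall>a\<in>{a \<in> Domain Z. x < a}. w < a)"
    by (intro ex_between_finite) auto
  then obtain w where "\<forall>s\<in>{x}. s < w" "\<forall>a\<in>{a \<in> Domain Z. x < a}. w < a" by blast
  then have w: "x < w" "\<And>a. a \<in> Domain Z \<Longrightarrow> x < a \<Longrightarrow> w < a" by auto
  have "poly p x' = 0" if "x < x'" "x' < w" for x'
  proof -
    have "matched Z x' y"
      by (rule matched_shift[OF y]) (use that w x in \<open>metis less_trans not_less_iff_gr_or_eq\<close>)
    then have "sg (poly p x') = sg (poly p x)"
      using sign_table_agree[OF assms(1) _ assms(2)] y by metis
    then show ?thesis using assms(4) by simp
  qed
  then have "{x<..<w} \<subseteq> {x. poly p x = 0}" by auto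
  moreover have "infinite {x<..<w}" using w by (simp add: infinite_Ioo)
  ultimately show False using poly_roots_finite[OF assms(3)] finite_subset by blast
qed

section \<open>Extending a table by a pair of maximal degree\<close>

lemma pseudo_rem_root: "pseudo_rem p q r \<Longrightarrow> poly q x = 0 \<Longrightarrow> sg (poly r x) = sg (poly p x)"
  by (auto simp: pseudo_rem_def sg_mult)

locale table_step =
  fixes \<Phi> :: "('a::real_closed_field poly \<times> 'b::real_closed_field poly) set"
    and p :: "'a poly" and q :: "'b poly" and Z :: "('a \<times> 'b) set"
  assumes linked: "linked \<Phi>" and pq: "(p, q) \<in> \<Phi>"
    and max_degree: "\<And>p' q'. (p', q') \<in> \<Phi> \<Longrightarrow> degree p' \<le> degree p"
    and deg: "degree p > 0"
    and table: "sign_table (\<Phi> - {(p, q)}) Z"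
begin

lemma p0: "p \<noteq> 0" and q0: "q \<noteq> 0"
  using deg linked_eq_0[OF linked pq] by auto

lemma linked': "linked (\<Phi> - {(p, q)})"
  using linked_remove_max[OF linked pq max_degree] .

lemma om: "order_matching Z"
  using table by (simp add: sign_table_def)

lemma agree: "matched Z x y \<Longrightarrow> (p', q') \<in> \<Phi> - {(p, q)} \<Longrightarrow> sg (poly p' x) = sg (poly q' y)"
  using sign_table_agree[OF table] .

lemma pderiv_mem: "(pderiv p, pderiv q) \<in> \<Phi> - {(p, q)}"
proof -
  have "degree (pderiv p) < degree p" using deg by (simp add: degree_pderiv)
  then have "pderiv p \<noteq> p" by auto
  then show ?thesis using linked_pderiv[OF linked pq deg] by blast
qed

lemma agree_pderiv: "matched Z x y \<Longrightarrow> sg (poly (pderiv p) x) = sg (poly (pderiv q) y)"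
  using agree pderiv_mem by blast

text \<open>Some member \<open>p'\<close> vanishes at the node. The remainder of \<open>p\<close> by
  \<open>p'\<close> has the sign of \<open>p\<close> there, and its smaller degree puts it among the
  members already tabulated.\<close>

lemma agree_at_node:
  assumes "(a, b) \<in> Z"
  shows "sg (poly p a) = sg (poly q b)"
proof -
  have m: "matched Z a b" using matched_mem[OF om assms] .
  obtain p' q' where pq': "(p', q') \<in> \<Phi> - {(p, q)}" "degree p' > 0" "poly p' a = 0"
    using table assms unfolding sign_table_def by blast
  then have q': "poly q' b = 0" using agree[OF m pq'(1)] by simp
  obtain r s where rs: "(r, s) \<in> \<Phi>" "degree r < degree p'" "pseudo_rem p p' r" "pseudo_rem q q' s"
    using linked_rem[OF linked pq, of p' q'] pq' by blast
  have "degree p' \<le> degree p" using max_degree pq' by blast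
  then have "(r, s) \<in> \<Phi> - {(p, q)}" using rs by auto
  then show ?thesis
    using agree[OF m] pseudo_rem_root[OF rs(3) pq'(3)] pseudo_rem_root[OF rs(4) q'] by metis
qed

lemma pderiv_roots:
  assumes "poly (pderiv p) x = 0"
  shows "x \<in> Domain Z"
proof -
  have "pderiv p \<noteq> 0" using deg by (metis degree_0 degree_pderiv pderiv_eq_0_iff not_less_zero)
  then show ?thesis using sign_table_roots[OF table pderiv_mem] assms by blast
qed

text \<open>The situation is symmetric in the two fields, so each one-sided statement below yields
  its converse.\<close>

lemma flip: "table_step (\<Phi>\<inverse>) q p (Z\<inverse>)"
proof
  show "linked (\<Phi>\<inverse>)" using linked_converse[OF linked] .
  show "(q, p) \<in> \<Phi>\<inverse>" using pq by simp
  have d: "degree p' = degree q'" if "(p', q') \<in> \<Phi>" for p' q'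
    using linked_degree[OF linked that] .
  show "degree p' \<le> degree q" if "(p', q') \<in> \<Phi>\<inverse>" for p' q'
    using that d max_degree pq by (metis converseD)
  show "degree q > 0" using d[OF pq] deg by simp
  have "(\<Phi> - {(p, q)})\<inverse> = \<Phi>\<inverse> - {(q, p)}" by auto
  then show "sign_table (\<Phi>\<inverse> - {(q, p)}) (Z\<inverse>)"
    using sign_table_converse[OF linked' table] by simp
qed

text \<open>All roots of \<open>pderiv p\<close> are nodes, so \<open>p\<close> is strictly monotone
  on the gap around its root \<open>r\<close> and has the sign of \<open>pderiv p\<close> at
  \<open>r\<close> when it reaches the upper end. That sign passes to \<open>q\<close> at the
  corresponding end.\<close>

lemma upper_end:
  assumes r: "poly p r = 0" "r \<notin> Domain Z" and y: "matched Z r y"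
  shows "\<exists>v>y. (\<forall>b\<in>Range Z. b \<le> y \<or> v \<le> b) \<and> sg (poly q v) = sg (poly (pderiv p) r)"
proof -
  have mono: "a < a' \<longleftrightarrow> b < b'" if "(a, b) \<in> Z" "(a', b') \<in> Z" for a b a' b'
    using om that unfolding order_matching_def by blast
  have sgn: "sg (poly (pderiv p) x) = sg (poly (pderiv p) r)" if "r \<le> x" "\<And>a. a \<in> Domain Z \<Longrightarrow> r < a \<Longrightarrow> x < a" for x
    using pderiv_roots r(2) that
    by (intro sg_poly_eq[symmetric]) (metis linorder_not_le order_le_less order_less_irrefl)+
  have sgp: "sg (poly p x) = sg (poly (pderiv p) r)" if "r < x" "\<And>a. a \<in> Domain Z \<Longrightarrow> r < a \<Longrightarrow> x \<le> a" for x
  proof -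
    obtain c where c: "r < c" "c < x" "poly p x - poly p r = (x - r) * poly (pderiv p) c"
      using poly_mvt[OF \<open>r < x\<close>] by blast
    then have "sg (poly p x) = sg (poly (pderiv p) c)" using r by (simp add: sg_mult)
    also have "\<dots> = sg (poly (pderiv p) r)"
      by (rule sgn) (use c that(2) in force)+
    finally show ?thesis .
  qed
  have finZ: "finite Z" using om by (simp add: order_matching_def)
  define S where "S = {a \<in> Domain Z. r < a}"
  have fin: "finite S" using finZ by (simp add: S_def finite_Domain)
  show ?thesis
  proof (cases "S = {}")
    case False
    define u where "u = Min S"
    have u: "u \<in> S" "\<And>a. a \<in> S \<Longrightarrow> u \<le> a" using False fin by (auto simp: u_def)
    then obtain v where uv: "(u, v) \<in> Z" "r < u" by (auto simp: S_def)
    have "y < v" using y uv unfolding matched_def by blast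
    moreover have "b \<le> y \<or> v \<le> b" if bZ: "b \<in> Range Z" for b
    proof (rule ccontr)
      assume *: "\<not> (b \<le> y \<or> v \<le> b)"
      obtain a where ab: "(a, b) \<in> Z" using bZ by blast
      then have "r < a" using y * unfolding matched_def by fastforce
      moreover have "a < u" using mono[OF ab uv(1)] * by auto
      ultimately show False using u(2)[of a] ab by (auto simp: S_def)
    qed
    moreover have "sg (poly q v) = sg (poly (pderiv p) r)"
      using agree_at_node[OF uv(1)] sgp[OF uv(2)] u(2) by (auto simp: S_def)
    ultimately show ?thesis by blast
  next
    case True
    obtain B where B: "\<And>x. x \<ge> B \<Longrightarrow> sg (poly p x) = sg (lead_coeff p)" using sg_poly_at_top by blast
    obtain C where C: "\<And>x. x \<ge> C \<Longrightarrow> sg (poly q x) = sg (lead_coeff q)" using sg_poly_at_top by blast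
    \<comment> \<open>With no node above \<open>r\<close>, the end of the gap is replaced by a point
      beyond \<open>y\<close> where \<open>q\<close> already has the sign of its leading
      coefficient.\<close>
    define v where "v = max (y + 1) C"
    have "y < v" by (simp add: v_def less_max_iff_disj)
    moreover have "b \<le> y \<or> v \<le> b" if bZ: "b \<in> Range Z" for b
    proof -
      obtain a where ab: "(a, b) \<in> Z" using bZ by blast
      then have "\<not> r < a" using True by (auto simp: S_def)
      then show ?thesis using y ab unfolding matched_def by (auto simp: not_less)
    qed
    moreover have "sg (poly q v) = sg (poly (pderiv p) r)"
    proof -
      have "sg (poly q v) = sg (lead_coeff q)" using C by (simp add: v_def)
      also have "\<dots> = sg (lead_coeff p)"
        using linked_degree[OF linked pq] linked_coeff[OF linked pq] by metis
      also have "\<dots> = sg (poly p (max (r + 1) B))" using B by simp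
      also have "\<dots> = sg (poly (pderiv p) r)"
        by (rule sgp) (use True in \<open>auto simp: S_def less_max_iff_disj\<close>)
      finally show ?thesis .
    qed
    ultimately show ?thesis by blast
  qed
qed

lemma lower_end:
  assumes r: "poly p r = 0" "r \<notin> Domain Z" and y: "matched Z r y"
  shows "\<exists>v<y. (\<forall>b\<in>Range Z. y \<le> b \<or> b \<le> v) \<and> sg (poly q v) = - sg (poly (pderiv p) r)"
proof -
  have mono: "a < a' \<longleftrightarrow> b < b'" if "(a, b) \<in> Z" "(a', b') \<in> Z" for a b a' b'
    using om that unfolding order_matching_def by blast
  have sgn: "sg (poly (pderiv p) x) = sg (poly (pderiv p) r)" if "x \<le> r" "\<And>a. a \<in> Domain Z \<Longrightarrow> a < r \<Longrightarrow> a < x" for x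
    using pderiv_roots r(2) that
    by (intro sg_poly_eq) (metis linorder_not_le order_le_less order_less_irrefl)+
  have sgp: "sg (poly p x) = - sg (poly (pderiv p) r)" if "x < r" "\<And>a. a \<in> Domain Z \<Longrightarrow> a < r \<Longrightarrow> a \<le> x" for x
  proof -
    obtain c where c: "x < c" "c < r" "poly p r - poly p x = (r - x) * poly (pderiv p) c"
      using poly_mvt[OF \<open>x < r\<close>] by blast
    then have "- poly p x = (r - x) * poly (pderiv p) c" using r by simp
    then have "sg (- poly p x) = sg (poly (pderiv p) c)" using c by (simp add: sg_mult)
    also have "\<dots> = sg (poly (pderiv p) r)"
      by (rule sgn) (use c that(2) in force)+
    finally show ?thesis by simp
  qed
  have finZ: "finite Z" using om by (simp add: order_matching_def)
  define S where "S = {a \<in> Domain Z. a < r}"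
  have fin: "finite S" using finZ by (simp add: S_def finite_Domain)
  show ?thesis
  proof (cases "S = {}")
    case False
    define u where "u = Max S"
    have u: "u \<in> S" "\<And>a. a \<in> S \<Longrightarrow> a \<le> u" using False fin by (auto simp: u_def)
    then obtain v where uv: "(u, v) \<in> Z" "u < r" by (auto simp: S_def)
    have "v < y" using y uv unfolding matched_def by blast
    moreover have "y \<le> b \<or> b \<le> v" if bZ: "b \<in> Range Z" for b
    proof (rule ccontr)
      assume *: "\<not> (y \<le> b \<or> b \<le> v)"
      obtain a where ab: "(a, b) \<in> Z" using bZ by blast
      then have "a < r" using y * unfolding matched_def by fastforce
      moreover have "u < a" using mono[OF uv(1) ab] * by auto
      ultimately show False using u(2)[of a] ab by (auto simp: S_def)
    qed
    moreover have "sg (poly q v) = - sg (poly (pderiv p) r)"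
      using agree_at_node[OF uv(1)] sgp[OF uv(2)] u(2) by (auto simp: S_def)
    ultimately show ?thesis by blast
  next
    case True
    obtain B where B: "\<And>x. x \<le> B \<Longrightarrow> sg (poly p x) = sg (lead_coeff p) * (- 1) ^ degree p" using sg_poly_at_bot by blast
    obtain C where C: "\<And>x. x \<le> C \<Longrightarrow> sg (poly q x) = sg (lead_coeff q) * (- 1) ^ degree q" using sg_poly_at_bot by blast
    define v where "v = min (y - 1) C"
    have "v < y" by (simp add: v_def min_less_iff_disj)
    moreover have "y \<le> b \<or> b \<le> v" if bZ: "b \<in> Range Z" for b
    proof -
      obtain a where ab: "(a, b) \<in> Z" using bZ by blast
      then have "\<not> a < r" using True by (auto simp: S_def)
      then show ?thesis using y ab unfolding matched_def by (auto simp: not_less)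
    qed
    moreover have "sg (poly q v) = - sg (poly (pderiv p) r)"
    proof -
      have "sg (poly q v) = sg (lead_coeff q) * (- 1) ^ degree q" using C by (simp add: v_def)
      also have "\<dots> = sg (lead_coeff p) * (- 1) ^ degree p"
        using linked_degree[OF linked pq] linked_coeff[OF linked pq] by metis
      also have "\<dots> = sg (poly p (min (r - 1) B))" using B by simp
      also have "\<dots> = - sg (poly (pderiv p) r)"
        by (rule sgp) (use True in \<open>auto simp: S_def min_less_iff_disj\<close>)
      finally show ?thesis .
    qed
    ultimately show ?thesis by blast
  qed
qed

text \<open>A root of \<open>p\<close> off the nodes is simple, because roots of
  \<open>pderiv p\<close> are nodes. So \<open>q\<close> has opposite nonzero signs at the two ends
  of the corresponding gap and vanishes inside it.\<close>

lemma ex_matched_root: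
  assumes r: "poly p r = 0"
  shows "\<exists>s. poly q s = 0 \<and> matched Z r s"
proof (cases "r \<in> Domain Z")
  case True
  then obtain b where "(r, b) \<in> Z" by blast
  then show ?thesis using agree_at_node[of r b] matched_mem[OF om] r by fastforce
next
  case False
  obtain y where y: "matched Z r y" using ex_matched[OF om] by blast
  obtain v where v: "y < v" "\<And>b. b \<in> Range Z \<Longrightarrow> b \<le> y \<or> v \<le> b" "sg (poly q v) = sg (poly (pderiv p) r)"
    using upper_end[OF r False y] by blast
  obtain w where w: "w < y" "\<And>b. b \<in> Range Z \<Longrightarrow> y \<le> b \<or> b \<le> w" "sg (poly q w) = - sg (poly (pderiv p) r)"
    using lower_end[OF r False y] by blast
  have "poly (pderiv p) r \<noteq> 0" using pderiv_roots False by blast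
  then have "sg (poly q v) \<noteq> 0" "sg (poly q w) \<noteq> 0" "sg (poly q w) \<noteq> sg (poly q v)"
    using v w by (simp_all only: v(3) w(3) neg_equal_0_iff_equal sg_eq_0_iff) (auto simp: sg_def)
  then obtain s where s: "w < s" "s < v" "poly q s = 0"
    using poly_ivt[of w v q] mult_neg_if_sg v(1) w(1) less_trans sg_eq_0_iff by metis
  have yZ: "y \<notin> Range Z"
  proof
    assume "y \<in> Range Z"
    then obtain a where a: "(a, y) \<in> Z" by blast
    then have "a = r" using matched_mem_eq[of "Z\<inverse>" y r a] y by (simp add: matched_converse)
    then show False using a False by blast
  qed
  have "matched (Z\<inverse>) s r"
  proof (rule matched_shift)
    show "matched (Z\<inverse>) y r" using y by (simp add: matched_converse)
    fix b assume "b \<in> Domain (Z\<inverse>)"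
    then have b: "b \<in> Range Z" by auto
    then have "b \<noteq> y" using yZ by blast
    then consider "b \<le> w" | "v \<le> b" using v(2)[OF b] w(2)[OF b] by fastforce
    then show "(b < y \<longleftrightarrow> b < s) \<and> (y < b \<longleftrightarrow> s < b)"
      using s v(1) w(1) by cases auto
  qed
  then show ?thesis using s by (auto simp: matched_converse)
qed

definition Z' :: "('a \<times> 'b) set" where
  "Z' = Z \<union> {(r, s). poly p r = 0 \<and> poly q s = 0 \<and> matched Z r s}"

lemma Z'_matched: "(r, s) \<in> Z' \<Longrightarrow> matched Z r s"
  using matched_mem[OF om] by (auto simp: Z'_def)

text \<open>If an old node lies between \<open>r\<close> and \<open>r'\<close>, the comparison
  passes through it. Otherwise both are roots of \<open>p\<close> in one gap, and Rolle's theorem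
  produces a root of \<open>pderiv p\<close> there, which would be a node.\<close>

lemma less_if_less:
  assumes "(r, s) \<in> Z'" "(r', s') \<in> Z'" "r < r'"
  shows "s < s'"
proof (cases "\<exists>a\<in>Domain Z. r \<le> a \<and> a \<le> r'")
  case True
  then obtain a b where ab: "(a, b) \<in> Z" "r \<le> a" "a \<le> r'" by blast
  then have "s \<le> b" "b \<le> s'" "r < a \<longrightarrow> s < b" "a < r' \<longrightarrow> b < s'"
    using Z'_matched[OF assms(1)] Z'_matched[OF assms(2)] unfolding matched_def by fastforce+
  then show ?thesis using ab \<open>r < r'\<close> by (cases "r < a") auto
next
  case False
  then have "r \<notin> Domain Z" "r' \<notin> Domain Z" using assms(3) by (meson less_imp_le order_refl)+
  then have "poly p r = 0" "poly p r' = 0" using assms by (auto simp: Z'_def)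
  then obtain x where "r < x" "x < r'" "poly (pderiv p) x = 0" using poly_rolle[OF assms(3)] by blast
  then show ?thesis using pderiv_roots[of x] False by (metis less_imp_le)
qed

end

lemma (in table_step) flip_Z': "table_step.Z' q p (Z\<inverse>) = Z'\<inverse>"
  unfolding table_step.Z'_def[OF flip] Z'_def by (auto simp: matched_converse)

context table_step begin

lemma order_matching_Z': "order_matching Z'"
proof -
  have "finite {(r, s). poly p r = 0 \<and> poly q s = 0 \<and> matched Z r s}"
    by (rule finite_subset[of _ "{x. poly p x = 0} \<times> {x. poly q x = 0}"])
      (auto simp: poly_roots_finite p0 q0)
  then have "finite Z'" using om by (simp add: Z'_def order_matching_def)
  moreover have "r < r' \<longleftrightarrow> s < s'" if "(r, s) \<in> Z'" "(r', s') \<in> Z'" for r s r' s'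
    using less_if_less[OF that] table_step.less_if_less[OF flip, of s r s' r'] that by (auto simp: flip_Z')
  ultimately show ?thesis unfolding order_matching_def by blast
qed

lemma matched_Z'_mono: "matched Z' x y \<Longrightarrow> matched Z x y"
  by (auto simp: matched_def Z'_def)

lemma root_in_Domain: "poly p r = 0 \<Longrightarrow> r \<in> Domain Z'"
  using ex_matched_root[of r] by (auto simp: Z'_def)

lemma root_in_Range: "poly q s = 0 \<Longrightarrow> s \<in> Range Z'"
  using table_step.root_in_Domain[OF flip, of s] by (simp add: flip_Z')

lemma agree_at_Z': "(a, b) \<in> Z' \<Longrightarrow> sg (poly p a) = sg (poly q b)"
  using agree_at_node by (auto simp: Z'_def)

text \<open>Let \<open>a\<close> be the nearest node below \<open>x\<close>. If \<open>p\<close>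
  does not vanish at \<open>a\<close>, its sign persists up to \<open>x\<close>; if it does, the
  sign to the right of \<open>a\<close> is that of \<open>pderiv p\<close>, known from the old
  table. With no node below, leading coefficient and parity of the degree decide.\<close>

lemma agree_new:
  assumes m: "matched Z' x y"
  shows "sg (poly p x) = sg (poly q y)"
proof (cases "x \<in> Domain Z'")
  case True
  then obtain b where "(x, b) \<in> Z'" by blast
  then show ?thesis using agree_at_Z' matched_mem_eq[OF m] by metis
next
  case xZ: False
  have yZ: "y \<notin> Range Z'"
  proof
    assume "y \<in> Range Z'"
    then obtain a where a: "(a, y) \<in> Z'" by blast
    then have "a = x" using matched_mem_eq[of "Z'\<inverse>" y x a] m by (simp add: matched_converse)
    then show False using a xZ by blast
  qed
  have mono: "a < a' \<longleftrightarrow> b < b'" if "(a, b) \<in> Z'" "(a', b') \<in> Z'" for a b a' b'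
    using order_matching_Z' that unfolding order_matching_def by blast
  define S where "S = {a \<in> Domain Z'. a < x}"
  have "finite S" using order_matching_Z' by (simp add: S_def order_matching_def finite_Domain)
  show ?thesis
  proof (cases "S = {}")
    case False
    define a where "a = Max S"
    have a: "a \<in> S" "\<And>c. c \<in> S \<Longrightarrow> c \<le> a" using False \<open>finite S\<close> by (auto simp: a_def)
    then obtain b where ab: "(a, b) \<in> Z'" "a < x" by (auto simp: S_def)
    have bly: "b < y" using m ab unfolding matched_def by blast
    have noD: "c \<notin> Domain Z'" if "a < c" "c \<le> x" for c
      using that a(2)[of c] xZ by (force simp: S_def)
    have noR: "d \<notin> Range Z'" if "b < d" "d \<le> y" for d
    proof
      assume "d \<in> Range Z'"
      then obtain c where cd: "(c, d) \<in> Z'" by blast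
      then have "a < c" "d < y" "c < x" using mono[OF ab(1) cd] m that yZ unfolding matched_def
        by (force simp: order_le_less)+
      then show False using noD cd by force
    qed
    show ?thesis
    proof (cases "poly p a = 0")
      case False
      then have "sg (poly p a) = sg (poly p x)"
        using ab noD root_in_Domain by (intro sg_poly_eq) (auto simp: order_le_less)
      moreover have "poly q b \<noteq> 0" using False agree_at_Z'[OF ab(1)] by (metis sg_eq_0_iff)
      then have "sg (poly q b) = sg (poly q y)"
        using bly noR root_in_Range by (intro sg_poly_eq) (metis order_le_less)+
      ultimately show ?thesis using agree_at_Z'[OF ab(1)] by simp
    next
      case True
      then have qb: "poly q b = 0" using agree_at_Z'[OF ab(1)] by simp
      have "sg (poly p x) = sg (poly (pderiv p) x)"
      proof (rule sg_poly_right_of_root[OF ab(2) True])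
        fix c assume c: "a < c" "c \<le> x"
        have "poly (pderiv p) d \<noteq> 0" if "c \<le> d" "d \<le> x" for d
          using noD[of d] pderiv_roots[of d] that c by (auto simp: Z'_def)
        then show "sg (poly (pderiv p) c) = sg (poly (pderiv p) x)"
          by (intro sg_poly_eq c)
      qed
      moreover have "sg (poly q y) = sg (poly (pderiv q) y)"
      proof (rule sg_poly_right_of_root[OF bly qb])
        fix c assume c: "b < c" "c \<le> y"
        have "poly (pderiv q) d \<noteq> 0" if "c \<le> d" "d \<le> y" for d
          using noR[of d] table_step.pderiv_roots[OF flip, of d] that c by (auto simp: Z'_def)
        then show "sg (poly (pderiv q) c) = sg (poly (pderiv q) y)"
          by (intro sg_poly_eq c)
      qed
      ultimately show ?thesis using agree_pderiv[OF matched_Z'_mono[OF m]] by simp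
    qed
  next
    case True
    then have noD: "c \<notin> Domain Z'" if "c \<le> x" for c
      using that xZ by (auto simp: S_def order_le_less)
    have noR: "d \<notin> Range Z'" if "d \<le> y" for d
    proof
      assume "d \<in> Range Z'"
      then obtain c where cd: "(c, d) \<in> Z'" by blast
      then have "d < y" "c < x" using m that yZ unfolding matched_def
        by (force simp: order_le_less)+
      then show False using noD[of c] cd by force
    qed
    obtain B where B: "\<And>x. x \<le> B \<Longrightarrow> sg (poly p x) = sg (lead_coeff p) * (- 1) ^ degree p" using sg_poly_at_bot by blast
    obtain C where C: "\<And>x. x \<le> C \<Longrightarrow> sg (poly q x) = sg (lead_coeff q) * (- 1) ^ degree q" using sg_poly_at_bot by blast
    have "sg (poly p (min x B)) = sg (poly p x)"
      using noD root_in_Domain by (intro sg_poly_eq) (simp, blast)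
    moreover have "sg (poly q (min y C)) = sg (poly q y)"
      using noR root_in_Range by (intro sg_poly_eq) (simp, blast)
    moreover have "sg (lead_coeff q) * (- 1) ^ degree q = sg (lead_coeff p) * (- 1) ^ degree p"
      using linked_degree[OF linked pq] linked_coeff[OF linked pq] by metis
    ultimately show ?thesis using B[of "min x B"] C[of "min y C"] by simp
  qed
qed

lemma sign_table_Z': "sign_table \<Phi> Z'"
  unfolding sign_table_def
proof (intro conjI allI impI ballI)
  show "order_matching Z'" by (rule order_matching_Z')
  show "signs_agree \<Phi> x y" if "matched Z' x y" for x y
    using agree_new[OF that] agree[OF matched_Z'_mono[OF that]] unfolding signs_agree_def by blast
  fix z assume "z \<in> Z'"
  then show "case z of (a, b) \<Rightarrow> \<exists>(p, q)\<in>\<Phi>. degree p > 0 \<and> poly p a = 0"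
    using table pq deg unfolding sign_table_def Z'_def by blast
qed

end

lemma ex_sign_table:
  fixes \<Phi> :: "('a::real_closed_field poly \<times> 'b::real_closed_field poly) set"
  assumes "linked \<Phi>"
  shows "\<exists>Z. sign_table \<Phi> Z"
  using assms
proof (induction "card \<Phi>" arbitrary: \<Phi>)
  case 0
  then have "\<Phi> = {}" by (simp add: linked_def)
  then have "sign_table \<Phi> {}"
    by (simp add: sign_table_def order_matching_def signs_agree_def)
  then show ?case by blast
next
  case (Suc n)
  then have "\<Phi> \<noteq> {}" and fin: "finite \<Phi>" by (auto simp: linked_def)
  then obtain z where z: "z \<in> \<Phi>" "\<And>w. w \<in> \<Phi> \<Longrightarrow> degree (fst w) \<le> degree (fst z)"
    using Max_in[of "(\<lambda>w. degree (fst w)) ` \<Phi>"] Max_ge[of "(\<lambda>w. degree (fst w)) ` \<Phi>"] by (metis (no_types, lifting) finite_imageI image_iff image_is_empty)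
  obtain p q where pq: "z = (p, q)" by fastforce
  have mem: "(p, q) \<in> \<Phi>" and max: "\<And>p' q'. (p', q') \<in> \<Phi> \<Longrightarrow> degree p' \<le> degree p"
    using z pq by force+
  have lk: "linked (\<Phi> - {(p, q)})" using linked_remove_max[OF Suc.prems mem max] .
  moreover have "n = card (\<Phi> - {(p, q)})" using Suc.hyps(2) mem fin by simp
  ultimately obtain Z where Z: "sign_table (\<Phi> - {(p, q)}) Z" using Suc.hyps(1) by blast
  show ?case
  proof (cases "degree p > 0")
    case True
    then have "table_step \<Phi> p q Z" using Suc.prems mem max Z by unfold_locales auto
    then show ?thesis using table_step.sign_table_Z' by blast
  next
    case False
    then have "degree p = 0" "degree q = 0" using linked_degree[OF Suc.prems mem] by auto
    then have "sg (poly p x) = sg (poly q y)" for x y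
      using linked_coeff[OF Suc.prems mem, of 0] by (simp add: poly_altdef)
    then have "sign_table \<Phi> Z" using Z mem unfolding sign_table_def signs_agree_def by blast
    then show ?thesis by blast
  qed
qed

lemma linked_transfer:
  fixes \<Phi> :: "('a::real_closed_field poly \<times> 'b::real_closed_field poly) set"
  assumes "linked \<Phi>"
  shows "\<exists>y. signs_agree \<Phi> x y"
  using ex_sign_table[OF assms] ex_matched unfolding sign_table_def by blast

section \<open>Transfer of sign conditions to the reals\<close>

text \<open>Syntax rather than functions: the same expression must be evaluated both in a real
  closed extension and in the reals, and elimination computes with coefficients that are themselves
  expressions.\<close>

datatype (pvars: 'v) pexp = Const real | Var 'v | Add "'v pexp" "'v pexp" | Mul "'v pexp" "'v pexp"

primrec peval :: "(real \<Rightarrow> 'a::comm_ring_1) \<Rightarrow> ('v \<Rightarrow> 'a) \<Rightarrow> 'v pexp \<Rightarrow> 'a" where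
  "peval h v (Const c) = h c"
| "peval h v (Var x) = v x"
| "peval h v (Add a b) = peval h v a + peval h v b"
| "peval h v (Mul a b) = peval h v a * peval h v b"

definition real_hom :: "(real \<Rightarrow> 'a::comm_ring_1) \<Rightarrow> bool" where
  "real_hom h \<longleftrightarrow> h 1 = 1 \<and> (\<forall>a b. h (a + b) = h a + h b \<and> h (a * b) = h a * h b)"

lemma real_hom_id: "real_hom (\<lambda>x. x)"
  by (simp add: real_hom_def)

lemma real_homD:
  assumes "real_hom h"
  shows "h 1 = 1" "h (a + b) = h a + h b" "h (a * b) = h a * h b" "h 0 = 0" "h (- a) = - h a"
proof -
  show 1: "h 1 = 1" "h (a + b) = h a + h b" "h (a * b) = h a * h b" for a b
    using assms by (auto simp: real_hom_def)
  show 0: "h 0 = 0" using 1(2)[of 0 0] by simp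
  show "h (- a) = - h a" using 1(2)[of a "- a"] 0 by (simp add: add_eq_0_iff2 minus_unique)
qed

lemma peval_cong: "(\<And>x. x \<in> pvars e \<Longrightarrow> v x = w x) \<Longrightarrow> peval h v e = peval h w e"
  by (induction e) auto

lemma peval_closed: "real_hom h \<Longrightarrow> pvars e = {} \<Longrightarrow> peval h v e = h (peval (\<lambda>x. x) w e)"
  by (induction e) (auto simp: real_homD)

text \<open>Univariate polynomials with coefficients in \<open>'v pexp\<close> are coefficient lists, lowest degree first.\<close>

definition lpoly :: "(real \<Rightarrow> 'a::comm_ring_1) \<Rightarrow> ('v \<Rightarrow> 'a) \<Rightarrow> 'v pexp list \<Rightarrow> 'a poly" where
  "lpoly h v cs = Poly (map (peval h v) cs)"

section \<open>Arithmetic and pseudo-division of coefficient lists\<close>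

fun ladd :: "'v pexp list \<Rightarrow> 'v pexp list \<Rightarrow> 'v pexp list" where
  "ladd [] bs = bs"
| "ladd as [] = as"
| "ladd (a # as) (b # bs) = Add a b # ladd as bs"

primrec lmul :: "'v pexp list \<Rightarrow> 'v pexp list \<Rightarrow> 'v pexp list" where
  "lmul [] bs = []"
| "lmul (a # as) bs = ladd (map (Mul a) bs) (Const 0 # lmul as bs)"

primrec lderiv :: "'v pexp list \<Rightarrow> 'v pexp list" where
  "lderiv [] = []"
| "lderiv (a # as) = (if as = [] then [] else ladd as (Const 0 # lderiv as))"

text \<open>The combination \<open>lc(g)^2 f - lc(f) lc(g) X^k g\<close>, where \<open>lc\<close> is
  the last list entry. The square makes the multiplier of \<open>f\<close> positive wherever
  \<open>lc(g)\<close> is nonzero; \<open>butlast\<close> drops the top entry, which evaluates to 0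
  without being syntactically 0.\<close>

definition lstep :: "'v pexp list \<Rightarrow> 'v pexp list \<Rightarrow> 'v pexp list" where
  "lstep f g = butlast (ladd (map (Mul (Mul (last g) (last g))) f)
    (map (Mul (Mul (Const (- 1)) (Mul (last f) (last g)))) (replicate (length f - length g) (Const 0) @ g)))"

lemma length_ladd: "length (ladd as bs) = max (length as) (length bs)"
  by (induction as bs rule: ladd.induct) auto

lemma length_lderiv: "length (lderiv as) = length as - 1"
  by (induction as) (auto simp: length_ladd Suc_le_eq)

lemma length_lstep: "length g \<le> length f \<Longrightarrow> length (lstep f g) = length f - 1"
  by (simp add: lstep_def length_ladd)

text \<open>Purely formal division: it never tests whether a leading coefficient vanishes, so the
  result is a pseudo-remainder at points where the last entry of \<open>g\<close> is
  nonzero.\<close>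

function lprem :: "'v pexp list \<Rightarrow> 'v pexp list \<Rightarrow> 'v pexp list" where
  "lprem f g = (if length f < length g \<or> g = [] then f else lprem (lstep f g) g)"
  by auto
termination
proof (relation "Wellfounded.measure (length \<circ> fst)")
  fix f g :: "'v pexp list"
  assume "\<not> (length f < length g \<or> g = [])"
  then have "length g \<le> length f" "length f > 0" by (auto simp: not_less)
  then show "((lstep f g, g), f, g) \<in> Wellfounded.measure (length \<circ> fst)"
    by (simp add: length_lstep)
qed auto

declare lprem.simps [simp del]

lemma length_lprem: "g \<noteq> [] \<Longrightarrow> length (lprem f g) < length g"
  by (induction f g rule: lprem.induct) (subst lprem.simps, auto)

primrec collect :: "'v \<Rightarrow> 'v pexp \<Rightarrow> 'v pexp list" where
  "collect x (Const c) = [Const c]"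
| "collect x (Var y) = (if y = x then [Const 0, Const 1] else [Var y])"
| "collect x (Add a b) = ladd (collect x a) (collect x b)"
| "collect x (Mul a b) = lmul (collect x a) (collect x b)"

definition lvars :: "'v pexp list \<Rightarrow> 'v set" where
  "lvars cs = (\<Union>c\<in>set cs. pvars c)"

lemma lvars_simps [simp]: "lvars [] = {}" "lvars (c # cs) = pvars c \<union> lvars cs" "lvars (cs @ ds) = lvars cs \<union> lvars ds"
  by (auto simp: lvars_def)

lemma lvars_map_Mul: "lvars (map (Mul a) bs) \<subseteq> pvars a \<union> lvars bs"
  by (auto simp: lvars_def)

lemma lvars_ladd: "lvars (ladd as bs) \<subseteq> lvars as \<union> lvars bs"
  by (induction as bs rule: ladd.induct) auto

lemma lvars_lmul: "lvars (lmul as bs) \<subseteq> lvars as \<union> lvars bs"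
proof (induction as)
  case (Cons a as)
  have "lvars (lmul (a # as) bs) \<subseteq> lvars (map (Mul a) bs) \<union> lvars (Const 0 # lmul as bs)"
    unfolding lmul.simps by (rule lvars_ladd)
  also have "\<dots> \<subseteq> lvars (a # as) \<union> lvars bs"
    using Cons lvars_map_Mul[of a bs] by auto
  finally show ?case .
qed simp

lemma lvars_lderiv: "lvars (lderiv as) \<subseteq> lvars as"
proof (induction as)
  case (Cons a as)
  then show ?case using lvars_ladd[of as "Const 0 # lderiv as"] by auto
qed simp

lemma lvars_butlast: "lvars (butlast as) \<subseteq> lvars as"
  by (auto simp: lvars_def dest: in_set_butlastD)

lemma lvars_last: "as \<noteq> [] \<Longrightarrow> pvars (last as) \<subseteq> lvars as"
  unfolding lvars_def by (meson UN_upper last_in_set)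

lemma lvars_lstep:
  assumes "g \<noteq> []" "f \<noteq> []"
  shows "lvars (lstep f g) \<subseteq> lvars f \<union> lvars g"
proof -
  have r: "lvars (replicate n (Const 0)) = {}" for n by (auto simp: lvars_def)
  show ?thesis unfolding lstep_def
    using lvars_last[OF assms(1)] lvars_last[OF assms(2)]
    by (intro order.trans[OF lvars_butlast] order.trans[OF lvars_ladd] Un_least order.trans[OF lvars_map_Mul])
      (auto simp: r)
qed

lemma lvars_lprem: "g \<noteq> [] \<Longrightarrow> lvars (lprem f g) \<subseteq> lvars f \<union> lvars g"
proof (induction f g rule: lprem.induct)
  case (1 f g)
  show ?case
  proof (cases "length f < length g")
    case False
    then have "f \<noteq> []" using 1 by auto
    then show ?thesis using False 1 lvars_lstep[of g f] by (subst lprem.simps) auto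
  qed (simp add: lprem.simps)
qed

lemma lvars_collect: "lvars (collect x e) \<subseteq> pvars e - {x}"
proof (induction e)
  case (Add a b)
  then show ?case using lvars_ladd[of "collect x a" "collect x b"] by auto
next
  case (Mul a b)
  then show ?case using lvars_lmul[of "collect x a" "collect x b"] by auto
qed auto

section \<open>Evaluation of coefficient lists\<close>

lemma lpoly_cong: "(\<And>x. x \<in> lvars f \<Longrightarrow> v x = w x) \<Longrightarrow> lpoly h v f = lpoly h w f"
  unfolding lpoly_def lvars_def by (intro arg_cong[of _ _ Poly] map_cong peval_cong) auto

lemma lpoly_simps [simp]: "lpoly h v [] = 0" "lpoly h v (c # cs) = pCons (peval h v c) (lpoly h v cs)"
  by (simp_all add: lpoly_def)

lemma lpoly_ladd: "lpoly h v (ladd as bs) = lpoly h v as + lpoly h v bs"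
  by (induction as bs rule: ladd.induct) auto

lemma lpoly_map_Mul: "lpoly h v (map (Mul a) bs) = smult (peval h v a) (lpoly h v bs)"
  by (induction bs) auto

lemma lpoly_lmul: "real_hom h \<Longrightarrow> lpoly h v (lmul as bs) = lpoly h v as * lpoly h v bs"
  by (induction as) (auto simp: lpoly_ladd lpoly_map_Mul real_homD)

lemma lpoly_lderiv: "real_hom h \<Longrightarrow> lpoly h v (lderiv as) = pderiv (lpoly h v as)"
  for h :: "real \<Rightarrow> 'a::{comm_ring_1,semiring_no_zero_divisors}"
  by (induction as) (auto simp: lpoly_ladd real_homD pderiv_pCons)

lemma poly_lpoly_collect: "real_hom h \<Longrightarrow> poly (lpoly h v (collect x e)) (v x) = peval h v e"
  by (induction e) (auto simp: lpoly_ladd lpoly_lmul real_homD)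

lemma lpoly_append: "lpoly h v (as @ bs) = lpoly h v as + Polynomial.monom 1 (length as) * lpoly h v bs"
  by (simp add: lpoly_def Poly_append)

lemma lpoly_butlast: "as \<noteq> [] \<Longrightarrow> peval h v (last as) = 0 \<Longrightarrow> lpoly h v (butlast as) = lpoly h v as"
  using lpoly_append[of h v "butlast as" "[last as]"] by simp

lemma last_ladd: "length as = length bs \<Longrightarrow> as \<noteq> [] \<Longrightarrow> last (ladd as bs) = Add (last as) (last bs)"
proof (induction as bs rule: ladd.induct)
  case (3 a as b bs)
  have "ladd as bs \<noteq> []" if "as \<noteq> []" using that length_ladd[of as bs] by auto
  then show ?case using 3 by (cases "as = []") auto
qed auto

lemma lpoly_lstep:
  assumes h: "real_hom h" and g: "g \<noteq> []" and len: "length g \<le> length f"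
  shows "lpoly h v (lstep f g) = smult ((peval h v (last g))\<^sup>2) (lpoly h v f)
    - smult (peval h v (last f) * peval h v (last g)) (Polynomial.monom 1 (length f - length g)) * lpoly h v g"
proof -
  define a where "a = map (Mul (Mul (last g) (last g))) f"
  define g' where "g' = replicate (length f - length g) (Const 0) @ g"
  define b where "b = map (Mul (Mul (Const (- 1)) (Mul (last f) (last g)))) g'"
  have f: "f \<noteq> []" and l: "length a = length b" "a \<noteq> []" "length g' = length f" "last g' = last g" "g' \<noteq> []"
    using g len by (auto simp: a_def b_def g'_def)
  have "last a = Mul (Mul (last g) (last g)) (last f)"
       "last b = Mul (Mul (Const (- 1)) (Mul (last f) (last g))) (last g)"
    using f l by (simp_all add: a_def b_def last_map)
  then have "peval h v (last (ladd a b)) = 0"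
    using last_ladd[OF l(1,2)] by (simp add: real_homD[OF h] algebra_simps)
  moreover have "ladd a b \<noteq> []" using l length_ladd[of a b] by (metis length_0_conv max.idem)
  moreover have "lpoly h v (replicate n (Const 0)) = 0" for n
    by (induction n) (auto simp: real_homD[OF h])
  then have "lpoly h v g' = Polynomial.monom 1 (length f - length g) * lpoly h v g"
    by (simp add: g'_def lpoly_append)
  ultimately show ?thesis
    unfolding lstep_def a_def[symmetric] g'_def[symmetric] b_def[symmetric]
    by (simp add: lpoly_butlast lpoly_ladd a_def b_def lpoly_map_Mul real_homD[OF h] power2_eq_square)
qed

lemma pseudo_rem_trans:
  assumes "pseudo_rem p q r" "pseudo_rem r q s"
  shows "pseudo_rem p q s"
proof -
  obtain c u d w where "c > 0" "d > 0" "r = smult c p - u * q" "s = smult d r - w * q"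
    using assms unfolding pseudo_rem_def by blast
  then have "d * c > 0" "s = smult (d * c) p - (smult d u + w) * q"
    by (simp_all add: smult_diff_right distrib_right diff_diff_eq)
  then show ?thesis unfolding pseudo_rem_def by blast
qed

lemma pseudo_rem_lprem:
  fixes h :: "real \<Rightarrow> 'a::linordered_field"
  assumes "real_hom h" "g \<noteq> []" "peval h v (last g) \<noteq> 0"
  shows "pseudo_rem (lpoly h v f) (lpoly h v g) (lpoly h v (lprem f g))"
  using assms
proof (induction f g rule: lprem.induct)
  case (1 f g)
  show ?case
  proof (cases "length f < length g")
    case True
    have "pseudo_rem p q p" for p q :: "'a poly"
      unfolding pseudo_rem_def by (intro exI[of _ 1] exI[of _ 0]) simp
    then show ?thesis using True by (simp add: lprem.simps)
  next
    case False
    then have "pseudo_rem (lpoly h v f) (lpoly h v g) (lpoly h v (lstep f g))"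
      unfolding pseudo_rem_def using lpoly_lstep[of h g f v] "1.prems"
      by (intro exI[of _ "(peval h v (last g))\<^sup>2"] exI[of _ "smult (peval h v (last f) * peval h v (last g))
        (Polynomial.monom 1 (length f - length g))"]) (simp add: not_less)
    then show ?thesis
      using 1 False pseudo_rem_trans by (subst lprem.simps) auto
  qed
qed

text \<open>Closure under \<open>butlast\<close> handles points where formal leading coefficients
  vanish: there a list can be replaced by a truncation with the same value.\<close>

definition lclosed :: "'v pexp list set \<Rightarrow> bool" where
  "lclosed F \<longleftrightarrow> finite F \<and> (\<forall>f\<in>F. butlast f \<in> F \<and> lderiv f \<in> F \<and> (\<forall>g\<in>F. g \<noteq> [] \<longrightarrow> lprem f g \<in> F))"

text \<open>All operations of \<open>lclosed\<close> lower the length, so the closure can be built from the longest lists downwards.\<close>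

lemma ex_lclosed:
  assumes "finite F0" "\<And>f. f \<in> F0 \<Longrightarrow> lvars f \<subseteq> V"
  shows "\<exists>F. F0 \<subseteq> F \<and> lclosed F \<and> (\<forall>f\<in>F. lvars f \<subseteq> V)"
proof -
  \<comment> \<open>Closure is demanded only where the list being truncated, differentiated or
    divided by has length at least \<open>k\<close>.\<close>
  define cl where "cl k F \<longleftrightarrow> finite F \<and> F0 \<subseteq> F \<and> (\<forall>f\<in>F. lvars f \<subseteq> V) \<and>
    (\<forall>f\<in>F. (length f \<ge> k \<longrightarrow> butlast f \<in> F \<and> lderiv f \<in> F) \<and>
       (\<forall>g\<in>F. g \<noteq> [] \<longrightarrow> length g \<ge> k \<longrightarrow> lprem f g \<in> F))" for k F
  obtain N where N: "\<And>f. f \<in> F0 \<Longrightarrow> length f < N"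
    using finite_imageI[OF assms(1), of length] by (metis finite_nat_set_iff_bounded imageI)
  have "cl N F0" unfolding cl_def using assms N by (auto simp: not_le[symmetric])
  moreover have step: "\<exists>F. cl (Suc k) F" if "cl (Suc (Suc k)) F" for k F
  proof -
    \<comment> \<open>The new members come from lists of length exactly \<open>Suc k\<close> and are
      strictly shorter, so they impose no demand at this level. Dividing one of them by a list of
      length at least \<open>Suc k\<close> returns it unchanged.\<close>
    define D where "D = butlast ` {f\<in>F. length f = Suc k} \<union> lderiv ` {f\<in>F. length f = Suc k}
      \<union> (\<lambda>(f, g). lprem f g) ` (F \<times> {g\<in>F. length g = Suc k})"
    have F: "finite F" "F0 \<subseteq> F" "\<And>f. f \<in> F \<Longrightarrow> lvars f \<subseteq> V"
      "\<And>f. f \<in> F \<Longrightarrow> length f \<ge> Suc (Suc k) \<Longrightarrow> butlast f \<in> F \<and> lderiv f \<in> F"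
      "\<And>f g. f \<in> F \<Longrightarrow> g \<in> F \<Longrightarrow> length g \<ge> Suc (Suc k) \<Longrightarrow> lprem f g \<in> F"
      using that unfolding cl_def by fastforce+
    have len: "length d < Suc k" if "d \<in> D" for d
    proof -
      have "length (lprem f g) < Suc k" if "length g = Suc k" for f g :: "'a pexp list"
        using length_lprem[of g f] that by (cases g) auto
      then show ?thesis using \<open>d \<in> D\<close> by (auto simp: D_def length_lderiv)
    qed
    have var: "lvars d \<subseteq> V" if "d \<in> D" for d
    proof -
      have "lvars (lprem f g) \<subseteq> V" if "f \<in> F" "g \<in> F" "length g = Suc k" for f g
        using lvars_lprem[of g f] that F(3)[of f] F(3)[of g] by fastforce
      then show ?thesis using \<open>d \<in> D\<close> F(3) lvars_lderiv lvars_butlast by (fastforce simp: D_def)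
    qed
    have "cl (Suc k) (F \<union> D)"
      unfolding cl_def
    proof (intro conjI ballI impI)
      show "finite (F \<union> D)" using F(1) by (simp add: D_def)
      show "F0 \<subseteq> F \<union> D" using F(2) by blast
      show "lvars f \<subseteq> V" if "f \<in> F \<union> D" for f using that F(3) var by blast
      fix f assume f: "f \<in> F \<union> D"
      show "butlast f \<in> F \<union> D" "lderiv f \<in> F \<union> D" if "Suc k \<le> length f"
      proof -
        have "f \<in> F" using f len that by fastforce
        then show "butlast f \<in> F \<union> D" "lderiv f \<in> F \<union> D"
          using F(4)[of f] that by (cases "length f = Suc k"; force simp: D_def)+
      qed
      fix g assume g: "g \<in> F \<union> D" "g \<noteq> []" "Suc k \<le> length g"
      then have gF: "g \<in> F" using len by fastforce
      show "lprem f g \<in> F \<union> D"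
      proof (cases "f \<in> F")
        case True
        then show ?thesis using F(5)[OF True gF] g gF by (cases "length g = Suc k") (force simp: D_def)+
      next
        case False
        then have "length f < length g" using f g len by fastforce
        then show ?thesis using f by (simp add: lprem.simps)
      qed
    qed
    then show ?thesis by blast
  qed
  have "\<exists>F. cl (Suc 0) F" if "cl k F" for k F
    using that
  proof (induction k arbitrary: F)
    case 0
    then have "cl (Suc 0) F" by (auto simp: cl_def)
    then show ?case by blast
  next
    case (Suc k)
    then show ?case using step by (cases k) blast+
  qed
  ultimately obtain F where F: "cl (Suc 0) F" by blast
  have "lclosed F"
    unfolding lclosed_def
  proof (intro conjI ballI impI)
    show "finite F" using F by (simp add: cl_def)
    fix f assume f: "f \<in> F"
    show "butlast f \<in> F" "lderiv f \<in> F"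
      using F f unfolding cl_def by (cases "f = []"; fastforce simp: Suc_le_eq)+
    fix g assume "g \<in> F" "g \<noteq> []"
    then show "lprem f g \<in> F" using F f unfolding cl_def by (simp add: Suc_le_eq)
  qed
  then show ?thesis using F unfolding cl_def by blast
qed

lemma coeff_lpoly: "coeff (lpoly h v f) i = (if i < length f then peval h v (f ! i) else 0)"
  by (simp add: lpoly_def nth_default_def)

lemma linked_lclosed:
  fixes h1 :: "real \<Rightarrow> 'a::linordered_field" and h2 :: "real \<Rightarrow> 'b::linordered_field"
  assumes h: "real_hom h1" "real_hom h2" and F: "lclosed F"
    and agree: "\<And>f c. f \<in> F \<Longrightarrow> c \<in> set f \<Longrightarrow> sg (peval h1 v1 c) = sg (peval h2 v2 c)"
  shows "linked ((\<lambda>f. (lpoly h1 v1 f, lpoly h2 v2 f)) ` F)"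
proof (rule linkedI)
  show "finite ((\<lambda>f. (lpoly h1 v1 f, lpoly h2 v2 f)) ` F)" using F by (simp add: lclosed_def)
next
  fix p q i assume "(p, q) \<in> (\<lambda>f. (lpoly h1 v1 f, lpoly h2 v2 f)) ` F"
  then show "sg (coeff p i) = sg (coeff q i)" using agree by (auto simp: coeff_lpoly)
next
  fix p q assume "(p, q) \<in> (\<lambda>f. (lpoly h1 v1 f, lpoly h2 v2 f)) ` F"
  then obtain f where f: "f \<in> F" "p = lpoly h1 v1 f" "q = lpoly h2 v2 f" by auto
  then have "pderiv p = lpoly h1 v1 (lderiv f)" "pderiv q = lpoly h2 v2 (lderiv f)"
    by (simp_all add: lpoly_lderiv h)
  moreover have "lderiv f \<in> F" using F f by (simp add: lclosed_def)
  ultimately show "(pderiv p, pderiv q) \<in> (\<lambda>f. (lpoly h1 v1 f, lpoly h2 v2 f)) ` F" by blast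
next
  fix p q p' q' assume *: "(p, q) \<in> (\<lambda>f. (lpoly h1 v1 f, lpoly h2 v2 f)) ` F"
    "(p', q') \<in> (\<lambda>f. (lpoly h1 v1 f, lpoly h2 v2 f)) ` F" "degree p' > 0"
  then obtain f g where f: "f \<in> F" "p = lpoly h1 v1 f" "q = lpoly h2 v2 f"
    and g: "g \<in> F" "p' = lpoly h1 v1 g" "q' = lpoly h2 v2 g" by auto
  \<comment> \<open>Dropping vanishing leading entries of \<open>g\<close> leaves both polynomials
    unchanged, since by sign agreement an entry vanishes in one field exactly when it does in the
    other. Afterwards list length and degree correspond.\<close>
  have "\<exists>g'\<in>F. lpoly h1 v1 g' = lpoly h1 v1 g \<and> lpoly h2 v2 g' = lpoly h2 v2 g \<and>
      (g' \<noteq> [] \<longrightarrow> peval h1 v1 (last g') \<noteq> 0)" if "g \<in> F" for g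
    using that
  proof (induction "length g" arbitrary: g rule: less_induct)
    case less
    show ?case
    proof (cases "g \<noteq> [] \<and> peval h1 v1 (last g) = 0")
      case True
      then have "peval h2 v2 (last g) = 0" using agree[OF less.prems, of "last g"] by simp
      moreover have "butlast g \<in> F" using F less.prems by (simp add: lclosed_def)
      moreover have "length (butlast g) < length g" using True by simp
      ultimately show ?thesis using less.hyps[of "butlast g"] True lpoly_butlast by metis
    qed (use less.prems in blast)
  qed
  then obtain g' where g': "g' \<in> F" "lpoly h1 v1 g' = p'" "lpoly h2 v2 g' = q'"
    "g' \<noteq> [] \<Longrightarrow> peval h1 v1 (last g') \<noteq> 0" using g by blast
  have ne: "g' \<noteq> []" using g' * by auto
  then have l1: "peval h1 v1 (last g') \<noteq> 0" using g' by blast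
  then have l2: "peval h2 v2 (last g') \<noteq> 0" using agree[OF g'(1), of "last g'"] ne by (metis last_in_set sg_eq_0_iff)
  have "degree p' = length g' - 1"
  proof (rule antisym)
    have "coeff p' (length g' - 1) \<noteq> 0"
      using l1 ne unfolding g'(2)[symmetric] by (simp add: coeff_lpoly last_conv_nth)
    then show "length g' - 1 \<le> degree p'" by (rule le_degree)
    show "degree p' \<le> length g' - 1"
      unfolding g'(2)[symmetric] by (rule degree_le) (auto simp: coeff_lpoly)
  qed
  moreover have "degree (lpoly h1 v1 (lprem f g')) \<le> length (lprem f g') - 1"
    by (rule degree_le) (auto simp: coeff_lpoly)
  ultimately have "degree (lpoly h1 v1 (lprem f g')) < degree p'"
    using length_lprem[OF ne, of f] *(3) by linarith
  moreover have "lprem f g' \<in> F" using F f g' ne by (simp add: lclosed_def)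
  moreover have "pseudo_rem p p' (lpoly h1 v1 (lprem f g'))" "pseudo_rem q q' (lpoly h2 v2 (lprem f g'))"
    using pseudo_rem_lprem[OF h(1) ne l1] pseudo_rem_lprem[OF h(2) ne l2] f g' by auto
  ultimately show "\<exists>(r, s)\<in>(\<lambda>f. (lpoly h1 v1 f, lpoly h2 v2 f)) ` F.
      degree r < degree p' \<and> pseudo_rem p p' r \<and> pseudo_rem q q' s"
    by (intro bexI[of _ "(lpoly h1 v1 (lprem f g'), lpoly h2 v2 (lprem f g'))"]) auto
qed

text \<open>Induction on the number of variables. The expressions become polynomials in
  \<open>x\<close>; the coefficients of a closed family containing them involve only the other
  variables, so the induction hypothesis gives reals with the same coefficient signs. The sign table
  then supplies a real number for \<open>x\<close>.\<close>

lemma sign_transfer: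
  fixes h :: "real \<Rightarrow> 'a::real_closed_field"
  assumes h: "real_hom h" "\<And>c. sg (h c) = sg c" and "finite V" "finite F" "\<And>e. e \<in> F \<Longrightarrow> pvars e \<subseteq> V"
  shows "\<exists>w. \<forall>e\<in>F. sg (peval h v e) = sg (peval (\<lambda>x. x) w e)"
  using assms(3-5)
proof (induction V arbitrary: F rule: finite_induct)
  case empty
  then have "sg (peval h v e) = sg (peval (\<lambda>x. x) (\<lambda>_. 0) e)" if "e \<in> F" for e
    using peval_closed[OF h(1), of e v "\<lambda>_. 0"] that h(2) by simp
  then show ?case by blast
next
  case (insert x V)
  have "lvars f \<subseteq> V" if "f \<in> collect x ` F" for f
    using that insert.prems(2) lvars_collect[of x] by fastforce
  then have "\<exists>L. collect x ` F \<subseteq> L \<and> lclosed L \<and> (\<forall>f\<in>L. lvars f \<subseteq> V)"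
    by (intro ex_lclosed finite_imageI insert.prems(1))
  then obtain L where L: "collect x ` F \<subseteq> L" "lclosed L" "\<And>f. f \<in> L \<Longrightarrow> lvars f \<subseteq> V"
    by blast
  have "finite (\<Union>(set ` L))" using L(2) by (simp add: lclosed_def)
  moreover have "pvars c \<subseteq> V" if "c \<in> \<Union>(set ` L)" for c
    using that L(3) unfolding lvars_def by blast
  ultimately have "\<exists>w. \<forall>c\<in>\<Union>(set ` L). sg (peval h v c) = sg (peval (\<lambda>x. x) w c)"
    by (rule insert.IH)
  then obtain w where w: "\<And>c. c \<in> \<Union>(set ` L) \<Longrightarrow> sg (peval h v c) = sg (peval (\<lambda>x. x) w c)"
    by blast
  then have "linked ((\<lambda>f. (lpoly h v f, lpoly (\<lambda>x. x) w f)) ` L)"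
    using linked_lclosed[OF h(1) real_hom_id L(2), of v w] by blast
  then obtain y where y: "signs_agree ((\<lambda>f. (lpoly h v f, lpoly (\<lambda>x. x) w f)) ` L) (v x) y"
    using linked_transfer by blast
  have "sg (peval h v e) = sg (peval (\<lambda>x. x) (w(x := y)) e)" if "e \<in> F" for e
  proof -
    have c: "collect x e \<in> L" using L(1) that by blast
    then have "x \<notin> lvars (collect x e)" using L(3) insert.hyps by blast
    then have "lpoly (\<lambda>x. x) (w(x := y)) (collect x e) = lpoly (\<lambda>x. x) w (collect x e)"
      by (intro lpoly_cong) auto
    then have "peval (\<lambda>x. x) (w(x := y)) e = poly (lpoly (\<lambda>x. x) w (collect x e)) y"
      using poly_lpoly_collect[OF real_hom_id, of "w(x := y)" x e] by simp
    moreover have "peval h v e = poly (lpoly h v (collect x e)) (v x)"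
      using poly_lpoly_collect[OF h(1)] by metis
    ultimately show ?thesis using y c unfolding signs_agree_def by auto
  qed
  then show ?case by blast
qed

abbreviation ev :: "('v \<Rightarrow> real) \<Rightarrow> 'v pexp \<Rightarrow> real" where
  "ev \<equiv> peval (\<lambda>x. x)"

abbreviation Neg :: "'v pexp \<Rightarrow> 'v pexp" where
  "Neg a \<equiv> Mul (Const (- 1)) a"

section \<open>Prime cones of polynomials\<close>

text \<open>The first conjunct makes \<open>T\<close> a set of polynomial functions rather than of expressions.\<close>

definition precone :: "'v pexp set \<Rightarrow> bool" where
  "precone T \<longleftrightarrow> (\<forall>a\<in>T. \<forall>b. (\<forall>w. ev w a = ev w b) \<longrightarrow> b \<in> T) \<and>
    (\<forall>a\<in>T. \<forall>b\<in>T. Add a b \<in> T \<and> Mul a b \<in> T) \<and> (\<forall>a. Mul a a \<in> T) \<and> Const (- 1) \<notin> T"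

text \<open>The points of the real spectrum of the polynomial ring: total cones whose support, the
  elements lying in \<open>P\<close> together with their negatives, is a prime ideal.\<close>

definition prime_cone :: "'v pexp set \<Rightarrow> bool" where
  "prime_cone P \<longleftrightarrow> precone P \<and> (\<forall>a. a \<in> P \<or> Neg a \<in> P) \<and>
    (\<forall>a b. Mul a b \<in> P \<and> Neg (Mul a b) \<in> P \<longrightarrow> (a \<in> P \<and> Neg a \<in> P) \<or> (b \<in> P \<and> Neg b \<in> P))"

context
  fixes T :: "'v pexp set"
  assumes T: "precone T"
begin

lemma precone_ext: "a \<in> T \<Longrightarrow> (\<And>w. ev w a = ev w b) \<Longrightarrow> b \<in> T"
  and precone_add: "a \<in> T \<Longrightarrow> b \<in> T \<Longrightarrow> Add a b \<in> T"
  and precone_mult: "a \<in> T \<Longrightarrow> b \<in> T \<Longrightarrow> Mul a b \<in> T"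
  and precone_square: "Mul a a \<in> T"
  and precone_minus1: "Const (- 1) \<notin> T"
  using T unfolding precone_def by blast+

lemma precone_Const: "c \<ge> 0 \<Longrightarrow> Const c \<in> T"
  using precone_ext[OF precone_square[of "Const (sqrt c)"], of "Const c"] by simp

end

lemma precone_chain:
  assumes "C \<noteq> {}" "subset.chain (Collect precone) C"
  shows "precone (\<Union>C)"
proof -
  have pc: "precone T" if "T \<in> C" for T
    using assms that by (auto simp: subset.chain_def)
  have tot: "S \<subseteq> T \<or> T \<subseteq> S" if "S \<in> C" "T \<in> C" for S T
    using assms(2) that unfolding subset.chain_def by blast
  have pair: "\<exists>T\<in>C. x \<in> T \<and> y \<in> T" if "x \<in> \<Union>C" "y \<in> \<Union>C" for x y
    using that tot by blast
  show ?thesis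
    unfolding precone_def
  proof (intro conjI ballI allI impI)
    fix a b assume "a \<in> \<Union>C" "\<forall>w. ev w a = ev w b"
    then show "b \<in> \<Union>C" using pc precone_ext by blast
  next
    fix a b assume "a \<in> \<Union>C" "b \<in> \<Union>C"
    then show "Add a b \<in> \<Union>C" "Mul a b \<in> \<Union>C"
      using pair[of a b] pc precone_add precone_mult by blast+
  next
    show "Mul a a \<in> \<Union>C" for a using assms(1) pc precone_square by blast
    show "Const (- 1) \<notin> \<Union>C" using pc precone_minus1 by blast
  qed
qed

text \<open>Otherwise \<open>T + a T\<close> would be a strictly larger cone.\<close>

lemma precone_adjoin:
  assumes T: "precone T" and max: "\<And>S. precone S \<Longrightarrow> T \<subseteq> S \<Longrightarrow> S = T" and a: "a \<notin> T"
  shows "\<exists>s\<in>T. \<exists>t\<in>T. \<forall>w. ev w s + ev w a * ev w t = - 1"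
proof (rule ccontr)
  assume neg: "\<not> ?thesis"
  define S where "S = {e. \<exists>s\<in>T. \<exists>t\<in>T. \<forall>w. ev w e = ev w s + ev w a * ev w t}"
  have 0: "Const 0 \<in> T" and 1: "Const 1 \<in> T" using precone_Const[OF T] by auto
  have "precone S"
    unfolding precone_def
  proof (intro conjI ballI allI impI)
    fix x y assume "x \<in> S" "\<forall>w. ev w x = ev w y"
    then show "y \<in> S" unfolding S_def by auto
  next
    fix x y assume "x \<in> S" "y \<in> S"
    then obtain s t s' t' where *: "s \<in> T" "t \<in> T" "s' \<in> T" "t' \<in> T"
      "\<And>w. ev w x = ev w s + ev w a * ev w t" "\<And>w. ev w y = ev w s' + ev w a * ev w t'"
      unfolding S_def by blast
    show "Add x y \<in> S" unfolding S_def
      by (intro CollectI bexI[of _ "Add s s'"] bexI[of _ "Add t t'"] allI)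
        (simp_all add: * precone_add[OF T] algebra_simps)
    show "Mul x y \<in> S" unfolding S_def
      by (intro CollectI bexI[of _ "Add (Mul s s') (Mul (Mul a a) (Mul t t'))"] bexI[of _ "Add (Mul s t') (Mul t s')"] allI)
        (simp_all add: * precone_add[OF T] precone_mult[OF T] precone_square[OF T] algebra_simps)
  next
    fix x show "Mul x x \<in> S" unfolding S_def
      by (intro CollectI bexI[of _ "Mul x x"] bexI[of _ "Const 0"] allI) (simp_all add: 0 precone_square[OF T])
  next
    show "Const (- 1) \<notin> S"
    proof
      assume "Const (- 1) \<in> S"
      then obtain s t where "s \<in> T" "t \<in> T" "\<And>w. ev w (Const (- 1)) = ev w s + ev w a * ev w t"
        unfolding S_def by blast
      then show False using neg by (metis peval.simps(1))
    qed
  qed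
  moreover have "T \<subseteq> S"
  proof
    fix x assume "x \<in> T"
    then show "x \<in> S" unfolding S_def
      by (intro CollectI bexI[of _ x] bexI[of _ "Const 0"] allI) (simp_all add: 0)
  qed
  ultimately have "S = T" by (rule max)
  moreover have "a \<in> S" unfolding S_def
    by (intro CollectI bexI[of _ "Const 0"] bexI[of _ "Const 1"] allI) (simp_all add: 0 1)
  ultimately show False using a by simp
qed

lemma precone_ideal:
  assumes T: "precone T" and tot: "a \<in> T \<or> Neg a \<in> T" and s: "s \<in> T" "Neg s \<in> T"
  shows "Mul a s \<in> T" "Neg (Mul a s) \<in> T"
proof -
  have "Mul a s \<in> T \<and> Neg (Mul a s) \<in> T"
    using tot
  proof
    assume "a \<in> T"
    then show ?thesis
      using precone_mult[OF T _ s(1)] precone_ext[OF T precone_mult[OF T _ s(2)], of a "Neg (Mul a s)"] by auto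
  next
    assume "Neg a \<in> T"
    then show ?thesis
      using precone_ext[OF T precone_mult[OF T _ s(1)], of "Neg a" "Neg (Mul a s)"]
        precone_ext[OF T precone_mult[OF T _ s(2)], of "Neg a" "Mul a s"] by auto
  qed
  then show "Mul a s \<in> T" "Neg (Mul a s) \<in> T" by auto
qed

text \<open>If neither \<open>a\<close> nor \<open>Neg a\<close> lies in \<open>T\<close>, then
  \<open>s + a t = - 1\<close> and \<open>s' - a t' = - 1\<close>, and multiplying gives
  \<open>s + s' + s s' + a^2 t t' = - 1\<close> in \<open>T\<close>. For primality, let
  \<open>x\<close> and \<open>y\<close> be \<open>a\<close> and \<open>b\<close> up to sign, both
  outside \<open>T\<close>; then \<open>s + x t = - 1\<close> and \<open>s' + y t' = - 1\<close>
  give \<open>- 1 = s + s' + s s' - x y t t'\<close>, whose last term lies in \<open>T\<close>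
  because \<open>a b\<close> is in the support.\<close>

lemma prime_cone_if_maximal:
  assumes T: "precone T" and max: "\<And>S. precone S \<Longrightarrow> T \<subseteq> S \<Longrightarrow> S = T"
  shows "prime_cone T"
proof -
  note add = precone_add[OF T] and mult = precone_mult[OF T] and ext = precone_ext[OF T]
  have tot: "a \<in> T \<or> Neg a \<in> T" for a
  proof (rule ccontr)
    assume "\<not> ?thesis"
    then obtain s t s' t' where *: "s \<in> T" "t \<in> T" "s' \<in> T" "t' \<in> T"
      "\<And>w. ev w s + ev w a * ev w t = - 1" "\<And>w. ev w s' + ev w (Neg a) * ev w t' = - 1"
      using precone_adjoin[OF T max] by meson
    have "Add (Add s s') (Add (Mul s s') (Mul (Mul a a) (Mul t t'))) \<in> T"
      using * by (intro add mult precone_square[OF T])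
    moreover have "ev w (Add (Add s s') (Add (Mul s s') (Mul (Mul a a) (Mul t t')))) = - 1" for w
    proof -
      have "ev w a * ev w t = - 1 - ev w s" "ev w a * ev w t' = 1 + ev w s'"
        using *(5)[of w] *(6)[of w] by (simp_all add: algebra_simps)
      then have "(ev w a * ev w t) * (ev w a * ev w t') = (- 1 - ev w s) * (1 + ev w s')" by simp
      then show ?thesis by (simp add: algebra_simps)
    qed
    ultimately show False using ext[of _ "Const (- 1)"] precone_minus1[OF T] by fastforce
  qed
  moreover have "(a \<in> T \<and> Neg a \<in> T) \<or> (b \<in> T \<and> Neg b \<in> T)"
    if ab: "Mul a b \<in> T" "Neg (Mul a b) \<in> T" for a b
  proof (rule ccontr)
    assume "\<not> ?thesis"
    then obtain x y where x: "x = a \<or> x = Neg a" "x \<notin> T" and y: "y = b \<or> y = Neg b" "y \<notin> T" by blast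
    obtain s t s' t' where *: "s \<in> T" "t \<in> T" "s' \<in> T" "t' \<in> T"
      "\<And>w. ev w s + ev w x * ev w t = - 1" "\<And>w. ev w s' + ev w y * ev w t' = - 1"
      using precone_adjoin[OF T max x(2)] precone_adjoin[OF T max y(2)] by meson
    define z where "z = Mul (Mul t t') (Mul a b)"
    have "z \<in> T" "Neg z \<in> T" unfolding z_def using precone_ideal[OF T tot ab] by auto
    moreover have "(\<forall>w. ev w (Mul (Mul x t) (Mul y t')) = ev w z) \<or> (\<forall>w. ev w (Mul (Mul x t) (Mul y t')) = ev w (Neg z))"
      using x y by (auto simp: z_def algebra_simps)
    ultimately have n: "Neg (Mul (Mul x t) (Mul y t')) \<in> T"
    proof (elim disjE)
      assume "z \<in> T" "Neg z \<in> T" "\<forall>w. ev w (Mul (Mul x t) (Mul y t')) = ev w z"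
      then show ?thesis using ext[of "Neg z"] by simp
    next
      assume "z \<in> T" "Neg z \<in> T" "\<forall>w. ev w (Mul (Mul x t) (Mul y t')) = ev w (Neg z)"
      then show ?thesis using ext[of z] by simp
    qed
    have "Add (Neg (Mul (Mul x t) (Mul y t'))) (Add (Add s s') (Mul s s')) \<in> T"
      by (intro add[OF n] add mult *)
    moreover have "ev w (Add (Neg (Mul (Mul x t) (Mul y t'))) (Add (Add s s') (Mul s s'))) = - 1" for w
    proof -
      have "ev w x * ev w t = - 1 - ev w s" "ev w y * ev w t' = - 1 - ev w s'"
        using *(5)[of w] *(6)[of w] by (simp_all add: algebra_simps)
      then have "(ev w x * ev w t) * (ev w y * ev w t') = (- 1 - ev w s) * (- 1 - ev w s')" by simp
      then show ?thesis by (simp add: algebra_simps)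
    qed
    ultimately show False using ext[of _ "Const (- 1)"] precone_minus1[OF T] by fastforce
  qed
  ultimately show ?thesis unfolding prime_cone_def using T by blast
qed

lemma ex_prime_cone:
  assumes "precone T"
  shows "\<exists>P. prime_cone P \<and> T \<subseteq> P"
proof -
  have "\<exists>M\<in>{S. precone S \<and> T \<subseteq> S}. \<forall>S\<in>{S. precone S \<and> T \<subseteq> S}. M \<subseteq> S \<longrightarrow> S = M"
  proof (rule subset_Zorn_nonempty)
    show "{S. precone S \<and> T \<subseteq> S} \<noteq> {}" using assms by blast
    fix C assume C: "C \<noteq> {}" "subset.chain {S. precone S \<and> T \<subseteq> S} C"
    then have "subset.chain (Collect precone) C" by (auto simp: subset.chain_def)
    then have "precone (\<Union>C)" using precone_chain C by blast
    moreover obtain S where "S \<in> C" using C(1) by blast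
    then have "T \<subseteq> \<Union>C" using C(2) by (auto simp: subset.chain_def)
    ultimately show "\<Union>C \<in> {S. precone S \<and> T \<subseteq> S}" by blast
  qed
  then obtain M where M: "precone M" "T \<subseteq> M"
    and max: "\<forall>S\<in>{S. precone S \<and> T \<subseteq> S}. M \<subseteq> S \<longrightarrow> S = M"
    by (elim bexE CollectE conjE) (rule that)
  have "S = M" if "precone S" "M \<subseteq> S" for S
    using max that order.trans[OF M(2) that(2)] by simp
  then have "prime_cone M" using prime_cone_if_maximal[OF M(1)] by simp
  then show ?thesis using M(2) by (intro exI conjI)
qed

text \<open>Types cannot depend on a prime cone, so the quotient type below is formed for one fixed cone,
  chosen to be a counterexample to \<open>prime_cone_realizable\<close> if there is one.\<close>

definition realizable :: "'v pexp set \<Rightarrow> bool" where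
  "realizable P \<longleftrightarrow> (\<forall>F. finite F \<and> F \<subseteq> P \<longrightarrow> (\<exists>w. \<forall>e\<in>F. ev w e \<ge> 0))"

definition cone0 :: "'v pexp set" where
  "cone0 = (SOME P. prime_cone P \<and> ((\<exists>P :: 'v pexp set. prime_cone P \<and> \<not> realizable P) \<longrightarrow> \<not> realizable P))"

text \<open>Shows that prime cones exist, so the choice of \<open>cone0\<close> has a witness in
  either case.\<close>

lemma prime_cone_eval: "prime_cone {e. ev w e \<ge> 0}"
  unfolding prime_cone_def precone_def by auto

lemma cone0:
  "prime_cone (cone0 :: 'v pexp set)" "prime_cone (P :: 'v pexp set) \<Longrightarrow> \<not> realizable P \<Longrightarrow> \<not> realizable (cone0 :: 'v pexp set)"
proof -
  have "\<exists>P :: 'v pexp set. prime_cone P \<and> ((\<exists>P :: 'v pexp set. prime_cone P \<and> \<not> realizable P) \<longrightarrow> \<not> realizable P)"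
    using prime_cone_eval by blast
  from someI_ex[OF this] show "prime_cone (cone0 :: 'v pexp set)"
    "prime_cone P \<Longrightarrow> \<not> realizable P \<Longrightarrow> \<not> realizable (cone0 :: 'v pexp set)"
    unfolding cone0_def by blast+
qed

lemma precone0: "precone (cone0 :: 'v pexp set)"
  and cone0_total: "a \<in> cone0 \<or> Neg a \<in> (cone0 :: 'v pexp set)"
  using cone0(1)[where 'v = 'v] unfolding prime_cone_def by blast+

lemma cone0_ext: "a \<in> cone0 \<Longrightarrow> (\<And>w. ev w a = ev w b) \<Longrightarrow> b \<in> cone0"
  using precone_ext[OF precone0] .

section \<open>The coordinate ring: expressions modulo the support of \<open>cone0\<close>\<close>

definition null :: "'v pexp \<Rightarrow> bool" where
  "null a \<longleftrightarrow> a \<in> cone0 \<and> Neg a \<in> cone0"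

lemma null_ext: "null a \<Longrightarrow> (\<And>w. ev w a = ev w b) \<Longrightarrow> null b"
  unfolding null_def using cone0_ext by (metis peval.simps(4))

lemma null_add: "null a \<Longrightarrow> null b \<Longrightarrow> null (Add a b)"
  unfolding null_def using precone_add[OF precone0] cone0_ext[of "Add (Neg a) (Neg b)" "Neg (Add a b)"] by auto

lemma null_mult: "null a \<Longrightarrow> null (Mul b a)"
  unfolding null_def using precone_ideal[OF precone0 cone0_total] by blast

lemma null_prime: "null (Mul a b) \<Longrightarrow> null a \<or> null b"
  unfolding null_def using cone0(1) unfolding prime_cone_def by blast

lemma null_0: "(\<And>w. ev w a = 0) \<Longrightarrow> null a"
  using precone_Const[OF precone0, of 0] unfolding null_def by (auto intro: cone0_ext)

lemma not_null_1: "\<not> null (Const 1)"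
  using cone0_ext[of "Neg (Const 1)" "Const (- 1)"] precone_minus1[OF precone0] by (auto simp: null_def)

lemma cone0_shift: "a \<in> cone0 \<Longrightarrow> null b \<Longrightarrow> Add a b \<in> cone0"
  unfolding null_def using precone_add[OF precone0] by blast

definition same_class :: "'v pexp \<Rightarrow> 'v pexp \<Rightarrow> bool" where
  "same_class a b \<longleftrightarrow> null (Add a (Neg b))"

lemma equivp_same_class: "equivp (same_class :: 'v pexp \<Rightarrow> 'v pexp \<Rightarrow> bool)"
proof (rule equivpI)
  show "reflp (same_class :: 'v pexp \<Rightarrow> 'v pexp \<Rightarrow> bool)"
    by (rule reflpI) (auto simp: same_class_def intro: null_0)
  show "symp (same_class :: 'v pexp \<Rightarrow> 'v pexp \<Rightarrow> bool)"
  proof (rule sympI, unfold same_class_def)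
    fix a b :: "'v pexp" assume "null (Add a (Neg b))"
    from null_mult[OF this, of "Const (- 1)"] show "null (Add b (Neg a))" by (rule null_ext) simp
  qed
  show "transp (same_class :: 'v pexp \<Rightarrow> 'v pexp \<Rightarrow> bool)"
  proof (rule transpI, unfold same_class_def)
    fix a b c :: "'v pexp" assume "null (Add a (Neg b))" "null (Add b (Neg c))"
    from null_add[OF this] show "null (Add a (Neg c))" by (rule null_ext) simp
  qed
qed

quotient_type 'v coord_ring = "'v pexp" / same_class
  by (rule equivp_same_class)

instantiation coord_ring :: (type) idom
begin

lift_definition zero_coord_ring :: "'a coord_ring" is "Const 0" .
lift_definition one_coord_ring :: "'a coord_ring" is "Const 1" .
lift_definition plus_coord_ring :: "'a coord_ring \<Rightarrow> 'a coord_ring \<Rightarrow> 'a coord_ring" is Add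
proof (unfold same_class_def)
  fix a b c d :: "'a pexp"
  assume "null (Add a (Neg b))" "null (Add c (Neg d))"
  from null_add[OF this] show "null (Add (Add a c) (Neg (Add b d)))" by (rule null_ext) simp
qed
lift_definition uminus_coord_ring :: "'a coord_ring \<Rightarrow> 'a coord_ring" is Neg
proof (unfold same_class_def)
  fix a b :: "'a pexp"
  assume "null (Add a (Neg b))"
  from null_mult[OF this, of "Const (- 1)"] show "null (Add (Neg a) (Neg (Neg b)))" by (rule null_ext) simp
qed
lift_definition minus_coord_ring :: "'a coord_ring \<Rightarrow> 'a coord_ring \<Rightarrow> 'a coord_ring" is "\<lambda>a b. Add a (Neg b)"
proof (unfold same_class_def)
  fix a b c d :: "'a pexp"
  assume "null (Add a (Neg b))" "null (Add c (Neg d))"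
  from null_add[OF this(1) null_mult[OF this(2), of "Const (- 1)"]]
  show "null (Add (Add a (Neg c)) (Neg (Add b (Neg d))))" by (rule null_ext) simp
qed
lift_definition times_coord_ring :: "'a coord_ring \<Rightarrow> 'a coord_ring \<Rightarrow> 'a coord_ring" is Mul
proof (unfold same_class_def)
  fix a b c d :: "'a pexp"
  assume "null (Add a (Neg b))" "null (Add c (Neg d))"
  from null_add[OF null_mult[OF this(1), of c] null_mult[OF this(2), of b]]
  show "null (Add (Mul a c) (Neg (Mul b d)))" by (rule null_ext) (simp add: algebra_simps)
qed
lemma coord_ring_no_zero_divisors: "x * y = 0 \<Longrightarrow> x = 0 \<or> y = 0" for x y :: "'a coord_ring"
proof (transfer, unfold same_class_def)
  fix x y :: "'a pexp" assume "null (Add (Mul x y) (Neg (Const 0)))"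
  then have "null (Mul x y)" by (rule null_ext) simp
  then show "null (Add x (Neg (Const 0))) \<or> null (Add y (Neg (Const 0)))"
    using null_prime null_ext[of x "Add x (Neg (Const 0))"] null_ext[of y "Add y (Neg (Const 0))"] by auto
qed

instance
proof
  fix x y z :: "'a coord_ring"
  show "x + y + z = x + (y + z)" by transfer (auto simp: same_class_def intro!: null_0)
  show "x + y = y + x" by transfer (auto simp: same_class_def intro!: null_0)
  show "0 + x = x" by transfer (auto simp: same_class_def intro!: null_0)
  show "- x + x = 0" by transfer (auto simp: same_class_def intro!: null_0)
  show "x - y = x + - y" by transfer (auto simp: same_class_def intro!: null_0)
  show "x * y * z = x * (y * z)" by transfer (auto simp: same_class_def intro!: null_0)
  show "x * y = y * x" by transfer (auto simp: same_class_def intro!: null_0)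
  show "1 * x = x" by transfer (auto simp: same_class_def intro!: null_0)
  show "(x + y) * z = x * z + y * z" "x * (y + z) = x * y + x * z"
    by (transfer, auto simp: same_class_def algebra_simps intro!: null_0)+
  show "0 * x = 0" "x * 0 = 0" by (transfer, auto simp: same_class_def intro!: null_0)+
  show "(0::'a coord_ring) \<noteq> 1"
  proof (transfer, unfold same_class_def)
    show "\<not> null (Add (Const 0) (Neg (Const 1 :: 'a pexp)))"
      using null_ext[OF null_mult[of "Add (Const 0) (Neg (Const 1 :: 'a pexp))" "Const (- 1)"], of "Const 1"] not_null_1 by auto
  qed
  show "x \<noteq> 0 \<Longrightarrow> y \<noteq> 0 \<Longrightarrow> x * y \<noteq> 0" using coord_ring_no_zero_divisors by blast
qed

end

instantiation coord_ring :: (type) linordered_idom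
begin

lift_definition less_eq_coord_ring :: "'a coord_ring \<Rightarrow> 'a coord_ring \<Rightarrow> bool" is "\<lambda>a b. Add b (Neg a) \<in> cone0"
proof (unfold same_class_def)
  fix a b c d :: "'a pexp"
  assume n: "null (Add a (Neg b))" "null (Add c (Neg d))"
  show "Add c (Neg a) \<in> cone0 \<longleftrightarrow> Add d (Neg b) \<in> cone0"
  proof
    assume "Add c (Neg a) \<in> cone0"
    from cone0_shift[OF this null_add[OF n(1) null_mult[OF n(2), of "Const (- 1)"]]]
    show "Add d (Neg b) \<in> cone0" by (rule cone0_ext) (simp add: algebra_simps)
  next
    assume "Add d (Neg b) \<in> cone0"
    from cone0_shift[OF this null_add[OF n(2) null_mult[OF n(1), of "Const (- 1)"]]]
    show "Add c (Neg a) \<in> cone0" by (rule cone0_ext) (simp add: algebra_simps)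
  qed
qed
definition less_coord_ring :: "'a coord_ring \<Rightarrow> 'a coord_ring \<Rightarrow> bool" where
  "less_coord_ring x y \<longleftrightarrow> x \<le> y \<and> x \<noteq> y"
definition coord_ring_abs: "\<bar>x :: 'a coord_ring\<bar> = (if x < 0 then - x else x)"
definition coord_ring_sgn: "sgn (x :: 'a coord_ring) = (if x = 0 then 0 else if 0 < x then 1 else - 1)"

lemma coord_ring_antisym: "x \<le> y \<Longrightarrow> y \<le> x \<Longrightarrow> x = y" for x y :: "'a coord_ring"
proof (transfer, unfold same_class_def null_def, intro conjI)
  fix x y :: "'a pexp" assume "Add y (Neg x) \<in> cone0" "Add x (Neg y) \<in> cone0"
  then show "Add x (Neg y) \<in> cone0" "Neg (Add x (Neg y)) \<in> cone0"
    using cone0_ext[of "Add y (Neg x)" "Neg (Add x (Neg y))"] by auto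
qed

lemma coord_ring_mult_nonneg: "0 \<le> x \<Longrightarrow> 0 \<le> y \<Longrightarrow> 0 \<le> x * y" for x y :: "'a coord_ring"
proof transfer
  fix x y :: "'a pexp" assume "Add x (Neg (Const 0)) \<in> cone0" "Add y (Neg (Const 0)) \<in> cone0"
  from precone_mult[OF precone0 this]
  show "Add (Mul x y) (Neg (Const 0)) \<in> cone0" by (rule cone0_ext) simp
qed

instance
proof
  fix x y z :: "'a coord_ring"
  show refl: "x \<le> x" for x :: "'a coord_ring"
    by transfer (auto intro: cone0_ext[OF precone_Const[OF precone0, of 0]])
  show "x < y \<longleftrightarrow> x \<le> y \<and> \<not> y \<le> x"
    unfolding less_coord_ring_def using coord_ring_antisym refl by metis
  show "x \<le> y \<Longrightarrow> y \<le> z \<Longrightarrow> x \<le> z"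
  proof transfer
    fix x y z :: "'a pexp"
    assume "Add y (Neg x) \<in> cone0" "Add z (Neg y) \<in> cone0"
    from precone_add[OF precone0 this] show "Add z (Neg x) \<in> cone0" by (rule cone0_ext) simp
  qed
  show "x \<le> y \<Longrightarrow> y \<le> x \<Longrightarrow> x = y" by (rule coord_ring_antisym)
  show add_mono: "x \<le> y \<Longrightarrow> z + x \<le> z + y" for x y z :: "'a coord_ring"
    by transfer (erule cone0_ext, simp)
  show "x \<le> y \<or> y \<le> x"
  proof transfer
    fix x y :: "'a pexp"
    show "Add y (Neg x) \<in> cone0 \<or> Add x (Neg y) \<in> cone0"
      using cone0_total[of "Add y (Neg x)"] cone0_ext[of "Neg (Add y (Neg x))" "Add x (Neg y)"] by auto
  qed
  show "\<bar>x\<bar> = (if x < 0 then - x else x)" by (rule coord_ring_abs)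
  show "sgn x = (if x = 0 then 0 else if 0 < x then 1 else - 1)" by (rule coord_ring_sgn)
  show "z * x < z * y" if "x < y" "0 < z"
  proof -
    have "0 \<le> y - x" "0 \<le> z" "z \<noteq> 0" "y - x \<noteq> 0"
      using that add_mono[of x y "- x"] by (auto simp: less_coord_ring_def)
    then have "0 \<le> z * (y - x)" "z * (y - x) \<noteq> 0"
      using coord_ring_mult_nonneg by auto
    then show ?thesis
      using add_mono[of 0 "z * (y - x)" "z * x"] by (auto simp: less_coord_ring_def algebra_simps)
  qed
qed

end

section \<open>From a prime cone to a real point\<close>

lift_definition to_rc :: "'a::linordered_field \<Rightarrow> 'a real_closure" is to_ac
  using cone_to_ac[OF max_cone] by (metis neg_0_le_iff_le linear to_ac_minus)

lemma to_rc_simps: "to_rc (x + y) = to_rc x + to_rc y" "to_rc (x * y) = to_rc x * to_rc y" "to_rc 0 = 0" "to_rc 1 = 1"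
  by (transfer; simp)+

lemma to_rc_nonneg: "0 \<le> x \<Longrightarrow> 0 \<le> to_rc x"
  unfolding nonneg_real_closure_iff to_rc.rep_eq by (rule cone_to_ac[OF max_cone])

lemma sg_nonneg_iff: "0 \<le> sg x \<longleftrightarrow> 0 \<le> x"
  by (auto simp: sg_def)

text \<open>The classes of the variables form a tautological point over the real closure of the
  fraction field of \<open>coord_ring\<close>; every member of \<open>cone0\<close> is nonnegative
  there. Positive reals stay positive because they are invertible, so \<open>sign_transfer\<close>
  moves the signs of finitely many members to a real point.\<close>

lemma realizable_cone0: "realizable (cone0 :: 'v pexp set)"
  unfolding realizable_def
proof (intro allI impI)
  fix F :: "'v pexp set" assume F: "finite F \<and> F \<subseteq> cone0"
  define val where "val e = to_rc (Fract (abs_coord_ring e) 1)" for e :: "'v pexp"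
  define h where "h c = val (Const c)" for c
  have val_simps: "val (Add a b) = val a + val b" "val (Mul a b) = val a * val b" for a b
    by (simp_all add: val_def plus_coord_ring.abs_eq[symmetric] times_coord_ring.abs_eq[symmetric] to_rc_simps[symmetric])
  have val_eqI: "val a = val b" if "\<And>w. ev w a = ev w b" for a b
  proof -
    have "abs_coord_ring a = abs_coord_ring b"
      unfolding coord_ring.abs_eq_iff same_class_def using that by (intro null_0) simp
    then show ?thesis by (simp add: val_def)
  qed
  have val_nonneg: "0 \<le> val e" if "e \<in> cone0" for e
  proof -
    have "Add e (Neg (Const 0)) \<in> cone0" using that by (rule cone0_ext) simp
    then have "0 \<le> abs_coord_ring e" by (simp add: zero_coord_ring.abs_eq less_eq_coord_ring.abs_eq)
    then show ?thesis unfolding val_def by (intro to_rc_nonneg) (simp add: zero_le_Fract_iff)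
  qed
  have h1: "h 1 = 1"
    by (simp add: h_def val_def one_coord_ring.abs_eq[symmetric] One_fract_def[symmetric] to_rc_simps)
  have hom: "real_hom h"
    unfolding real_hom_def using h1 by (auto simp: h_def val_simps[symmetric] intro!: val_eqI)
  have pos: "0 < h c" if "0 < c" for c
  proof -
    have "0 \<le> h c" using precone_Const[OF precone0, of c] that by (auto simp: h_def intro: val_nonneg)
    moreover have "h c * h (1 / c) = 1"
      using that h1 real_homD(3)[OF hom, of c "1 / c"] by simp
    ultimately show ?thesis by (metis mult_zero_left order_le_less zero_neq_one)
  qed
  have sgh: "sg (h c) = sg c" for c
  proof (cases c "0 :: real" rule: linorder_cases)
    case less
    then show ?thesis using pos[of "- c"] by (simp add: real_homD[OF hom] sg_def)
  next
    case equal
    then show ?thesis by (simp add: real_homD[OF hom])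
  next
    case greater
    then show ?thesis using pos by simp
  qed
  define v where "v x = val (Var x)" for x
  have val: "peval h v e = val e" for e
    by (induction e) (simp_all add: h_def v_def val_simps)
  have fin: "finite (pvars e)" for e :: "'v pexp" by (induction e) auto
  obtain w where w: "\<forall>e\<in>F. sg (peval h v e) = sg (ev w e)"
    using sign_transfer[OF hom sgh, of "\<Union>(pvars ` F)" F v] F fin by blast
  have "0 \<le> ev w e" if "e \<in> F" for e
  proof -
    have "0 \<le> sg (peval h v e)" using val_nonneg F that unfolding sg_nonneg_iff val by blast
    then show ?thesis using w that sg_nonneg_iff[of "ev w e"] by simp
  qed
  then show "\<exists>w. \<forall>e\<in>F. 0 \<le> ev w e" by blast
qed

lemma prime_cone_realizable: "prime_cone P \<Longrightarrow> realizable P"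
  using cone0(2) realizable_cone0 by blast

lemma precone_realizable: "precone T \<Longrightarrow> realizable T"
  using ex_prime_cone prime_cone_realizable unfolding realizable_def by (metis order.trans)

section \<open>Sums of squares\<close>

lemma sos_0: "sos (\<lambda>x. 0)"
  unfolding sos_def by (intro exI[of _ 0] exI[of _ "\<lambda>_ _. 0"]) auto

lemma sos_add:
  assumes "sos p" "sos q"
  shows "sos (\<lambda>x. p x + q x)"
proof -
  obtain k a where a: "\<forall>i<(k::nat). real_polynomial_function (a i)" "p = (\<lambda>x. \<Sum>i<k. (a i x)\<^sup>2)"
    using assms(1) unfolding sos_def by blast
  obtain l b where b: "\<forall>i<(l::nat). real_polynomial_function (b i)" "q = (\<lambda>x. \<Sum>i<l. (b i x)\<^sup>2)"
    using assms(2) unfolding sos_def by blast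
  define c where "c i = (if i < k then a i else b (i - k))" for i
  have "(\<Sum>i<k + l. (c i x)\<^sup>2) = p x + q x" for x
  proof -
    have "(\<Sum>i<k + l. (c i x)\<^sup>2) = (\<Sum>i<k. (c i x)\<^sup>2) + (\<Sum>i<l. (c (i + k) x)\<^sup>2)"
      by (induction l) (simp_all add: add.commute)
    then show ?thesis by (simp add: a b c_def)
  qed
  moreover have "real_polynomial_function (c i)" if "i < k + l" for i
    using that a b by (auto simp: c_def)
  ultimately show ?thesis unfolding sos_def by (intro exI[of _ "k + l"] exI[of _ c]) auto
qed

lemma sos_square: "real_polynomial_function p \<Longrightarrow> sos (\<lambda>x. (p x)\<^sup>2)"
  unfolding sos_def by (intro exI[of _ 1] exI[of _ "\<lambda>_. p"]) auto

lemma sos_const: "0 \<le> c \<Longrightarrow> sos (\<lambda>x. c)"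
  using sos_square[of "\<lambda>x. sqrt c"] by (simp add: real_polynomial_function.intros)

lemma sos_sum: "finite S \<Longrightarrow> (\<And>s. s \<in> S \<Longrightarrow> sos (p s)) \<Longrightarrow> sos (\<lambda>x. \<Sum>s\<in>S. p s x)"
  by (induction S rule: finite_induct) (auto intro: sos_0 sos_add)

lemma sos_mult:
  assumes "sos p" "sos q"
  shows "sos (\<lambda>x. p x * q x)"
proof -
  obtain k a where a: "\<forall>i<(k::nat). real_polynomial_function (a i)" "p = (\<lambda>x. \<Sum>i<k. (a i x)\<^sup>2)"
    using assms(1) unfolding sos_def by blast
  obtain l b where b: "\<forall>i<(l::nat). real_polynomial_function (b i)" "q = (\<lambda>x. \<Sum>i<l. (b i x)\<^sup>2)"
    using assms(2) unfolding sos_def by blast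
  have "sos (\<lambda>x. \<Sum>i\<in>{..<k}. \<Sum>j\<in>{..<l}. (a i x * b j x)\<^sup>2)"
    using a b by (intro sos_sum sos_square real_polynomial_function.intros(4)) auto
  then show ?thesis by (simp add: a b sum_product power_mult_distrib)
qed

lemma sos_polynomial: "sos p \<Longrightarrow> real_polynomial_function p"
  unfolding sos_def by (auto intro!: real_polynomial_function_sum real_polynomial_function_power)

lemma sos_nonneg: "sos p \<Longrightarrow> 0 \<le> p x"
  unfolding sos_def by (auto intro!: sum_nonneg)

section \<open>Polynomial functions as expressions, and the Positivstellensatz for an empty
  set\<close>

lemma ex_pexp:
  fixes p :: "real ^ 'n \<Rightarrow> real"
  assumes "real_polynomial_function p"
  shows "\<exists>e. \<forall>x. p x = ev (($) x) e"
  using assms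
proof (induction rule: real_polynomial_function.induct)
  case (linear f)
  have "\<exists>e. \<forall>w. ev w e = (\<Sum>i\<in>S. w i * f (axis i 1))" if "finite S" for S :: "'n set"
    using that
  proof (induction S rule: finite_induct)
    case empty
    show ?case by (intro exI[of _ "Const 0"]) simp
  next
    case (insert j S)
    then obtain e where "\<forall>w. ev w e = (\<Sum>i\<in>S. w i * f (axis i 1))" by blast
    then show ?case using insert by (intro exI[of _ "Add (Mul (Var j) (Const (f (axis j 1)))) e"]) auto
  qed
  then obtain e where e: "\<And>w. ev w e = (\<Sum>i\<in>UNIV. w i * f (axis i 1))" by auto
  have fx: "f x = (\<Sum>i\<in>UNIV. x $ i * f (axis i 1))" for x
  proof -
    have "f x = f (\<Sum>i\<in>UNIV. x $ i *\<^sub>R axis i 1)"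
      by (subst basis_expansion[symmetric]) (simp add: scalar_mult_eq_scaleR)
    also have "\<dots> = (\<Sum>i\<in>UNIV. x $ i * f (axis i 1))"
      using linear by (simp add: bounded_linear.linear linear_sum linear_cmul)
    finally show ?thesis .
  qed
  show ?case by (intro exI[of _ e] allI) (simp only: e fx[symmetric])
next
  case (const c)
  show ?case by (intro exI[of _ "Const c"]) simp
next
  case (add f g)
  then obtain a b where "\<forall>x. f x = ev (($) x) a" "\<forall>x. g x = ev (($) x) b" by blast
  then show ?case by (intro exI[of _ "Add a b"]) simp
next
  case (mult f g)
  then obtain a b where "\<forall>x. f x = ev (($) x) a" "\<forall>x. g x = ev (($) x) b" by blast
  then show ?case by (intro exI[of _ "Mul a b"]) simp
qed

lemma real_polynomial_function_component: "real_polynomial_function (\<lambda>x :: real ^ 'n. x $ i)"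
  by (intro real_polynomial_function.intros(1) bounded_linear_vec_nth)

lemma real_polynomial_function_ev: "real_polynomial_function (\<lambda>x :: real ^ 'n. ev (($) x) e)"
  by (induction e) (auto intro: real_polynomial_function.intros real_polynomial_function_component)

text \<open>The elements \<open>t0 + t1 g + t2 h + t3 g h\<close> satisfy all cone axioms except
  possibly the exclusion of \<open>- 1\<close>. If \<open>- 1\<close> were not among them, the cone
  would be realizable, and a point realizing \<open>g\<close> and \<open>h\<close> would lie in the
  empty set.\<close>

lemma positivstellensatz_empty:
  fixes g h :: "real ^ 'n \<Rightarrow> real"
  assumes g: "real_polynomial_function g" and h: "real_polynomial_function h"
    and empty: "\<And>x. g x \<ge> 0 \<Longrightarrow> h x \<ge> 0 \<Longrightarrow> False"
  shows "\<exists>t0 t1 t2 t3. sos t0 \<and> sos t1 \<and> sos t2 \<and> sos t3 \<and>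
    (\<forall>x. t0 x + t1 x * g x + t2 x * h x + t3 x * (g x * h x) = - 1)"
proof (rule ccontr)
  assume neg: "\<not> ?thesis"
  obtain eg where eg: "\<And>x. g x = ev (($) x) eg" using ex_pexp[OF g] by blast
  obtain eh where eh: "\<And>x. h x = ev (($) x) eh" using ex_pexp[OF h] by blast
  define C where "C p \<longleftrightarrow> (\<exists>t0 t1 t2 t3. sos t0 \<and> sos t1 \<and> sos t2 \<and> sos t3 \<and>
    (\<forall>x. p x = t0 x + t1 x * g x + t2 x * h x + t3 x * (g x * h x)))" for p :: "real ^ 'n \<Rightarrow> real"
  have CI: "C p" if "sos t0" "sos t1" "sos t2" "sos t3"
    "\<And>x. p x = t0 x + t1 x * g x + t2 x * h x + t3 x * (g x * h x)" for p t0 t1 t2 t3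
    using that unfolding C_def by blast
  define T where "T = {e. C (\<lambda>x. ev (($) x) e)}"
  have "precone T"
    unfolding precone_def
  proof (intro conjI ballI allI impI)
    fix a b assume "a \<in> T" "\<forall>w. ev w a = ev w b"
    then show "b \<in> T" by (simp add: T_def)
  next
    fix a b assume "a \<in> T" "b \<in> T"
    then have Cab: "C (\<lambda>x. ev (($) x) a)" "C (\<lambda>x. ev (($) x) b)" by (simp_all add: T_def)
    obtain s0 s1 s2 s3 where s: "sos s0" "sos s1" "sos s2" "sos s3"
      and a: "\<And>x. ev (($) x) a = s0 x + s1 x * g x + s2 x * h x + s3 x * (g x * h x)"
      using Cab(1) unfolding C_def by blast
    obtain t0 t1 t2 t3 where t: "sos t0" "sos t1" "sos t2" "sos t3"
      and b: "\<And>x. ev (($) x) b = t0 x + t1 x * g x + t2 x * h x + t3 x * (g x * h x)"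
      using Cab(2) unfolding C_def by blast
    note ab = a b
    have "C (\<lambda>x. ev (($) x) a + ev (($) x) b)"
      by (rule CI[OF sos_add[OF s(1) t(1)] sos_add[OF s(2) t(2)] sos_add[OF s(3) t(3)] sos_add[OF s(4) t(4)]])
        (simp add: ab algebra_simps)
    then show "Add a b \<in> T" by (simp add: T_def)
    \<comment> \<open>The product of two such sums, sorted by the parity of the exponents of
      \<open>g\<close> and \<open>h\<close>; even powers are absorbed into the SOS
      coefficients.\<close>
    define r0 where "r0 x = s0 x * t0 x + s1 x * t1 x * (g x)\<^sup>2 + s2 x * t2 x * (h x)\<^sup>2 + s3 x * t3 x * (g x * h x)\<^sup>2" for x
    define r1 where "r1 x = s0 x * t1 x + s1 x * t0 x + s2 x * t3 x * (h x)\<^sup>2 + s3 x * t2 x * (h x)\<^sup>2" for x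
    define r2 where "r2 x = s0 x * t2 x + s2 x * t0 x + s1 x * t3 x * (g x)\<^sup>2 + s3 x * t1 x * (g x)\<^sup>2" for x
    define r3 where "r3 x = s0 x * t3 x + s3 x * t0 x + s1 x * t2 x + s2 x * t1 x" for x
    have sq: "sos (\<lambda>x. (g x)\<^sup>2)" "sos (\<lambda>x. (h x)\<^sup>2)" "sos (\<lambda>x. (g x * h x)\<^sup>2)"
      using g h by (auto intro: sos_square real_polynomial_function.intros)
    have "C (\<lambda>x. ev (($) x) a * ev (($) x) b)"
    proof (rule CI)
      show "sos r0" "sos r1" "sos r2" "sos r3"
        unfolding r0_def r1_def r2_def r3_def by (intro sos_add sos_mult s t sq)+
      show "ev (($) x) a * ev (($) x) b = r0 x + r1 x * g x + r2 x * h x + r3 x * (g x * h x)" for x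
        unfolding ab r0_def r1_def r2_def r3_def by (simp add: power2_eq_square algebra_simps)
    qed
    then show "Mul a b \<in> T" by (simp add: T_def)
  next
    fix a
    have "C (\<lambda>x. (ev (($) x) a)\<^sup>2)"
      by (rule CI[OF sos_square[OF real_polynomial_function_ev[of a]] sos_0 sos_0 sos_0]) simp
    then show "Mul a a \<in> T" by (simp add: T_def power2_eq_square)
  next
    show "Const (- 1) \<notin> T"
      using neg unfolding T_def C_def by (simp only: mem_Collect_eq peval.simps) metis
  qed
  then have "realizable T" by (rule precone_realizable)
  moreover have "C g" by (rule CI[OF sos_0 sos_const[of 1] sos_0 sos_0]) auto
  then have "eg \<in> T" by (simp add: T_def eg[abs_def])
  moreover have "C h" by (rule CI[OF sos_0 sos_0 sos_const[of 1] sos_0]) auto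
  then have "eh \<in> T" by (simp add: T_def eh[abs_def])
  ultimately have "\<exists>w. \<forall>e\<in>{eg, eh}. 0 \<le> ev w e"
    unfolding realizable_def by (elim allE[of _ "{eg, eh}"]) simp
  then obtain w where "\<forall>e\<in>{eg, eh}. 0 \<le> ev w e" by blast
  moreover have "($) (\<chi> i. w i) = w" by auto
  ultimately have "0 \<le> g (\<chi> i. w i)" "0 \<le> h (\<chi> i. w i)" by (simp_all add: eg eh)
  then show False using empty by blast
qed

section \<open>The archimedean property\<close>

text \<open>Since \<open>g * g\<close> is a square, the quadratic module of the single polynomial
  \<open>g\<close> coincides with its preorder; this is why it is closed under products.\<close>

definition quad_module :: "(real ^ 'n \<Rightarrow> real) \<Rightarrow> (real ^ 'n \<Rightarrow> real) set" where
  "quad_module g = {p. \<exists>s t. sos s \<and> sos t \<and> p = (\<lambda>x. s x + t x * g x)}"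

lemma quad_moduleI: "sos s \<Longrightarrow> sos t \<Longrightarrow> (\<And>x. p x = s x + t x * g x) \<Longrightarrow> p \<in> quad_module g"
  unfolding quad_module_def by blast

lemma quad_module_add:
  assumes "p \<in> quad_module g" "q \<in> quad_module g"
  shows "(\<lambda>x. p x + q x) \<in> quad_module g"
proof -
  obtain s t where st: "sos s" "sos t" "p = (\<lambda>x. s x + t x * g x)"
    using assms(1) unfolding quad_module_def by blast
  obtain s' t' where st': "sos s'" "sos t'" "q = (\<lambda>x. s' x + t' x * g x)"
    using assms(2) unfolding quad_module_def by blast
  show ?thesis
    by (rule quad_moduleI[OF sos_add[OF st(1) st'(1)] sos_add[OF st(2) st'(2)]])
      (simp add: st(3) st'(3) algebra_simps)
qed

lemma quad_module_mult:
  assumes g: "real_polynomial_function g" and "p \<in> quad_module g" "q \<in> quad_module g"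
  shows "(\<lambda>x. p x * q x) \<in> quad_module g"
proof -
  obtain s t where st: "sos s" "sos t" "p = (\<lambda>x. s x + t x * g x)"
    using assms(2) unfolding quad_module_def by blast
  obtain s' t' where st': "sos s'" "sos t'" "q = (\<lambda>x. s' x + t' x * g x)"
    using assms(3) unfolding quad_module_def by blast
  have "sos (\<lambda>x. s x * s' x + t x * t' x * (g x)\<^sup>2)" "sos (\<lambda>x. s x * t' x + t x * s' x)"
    using st st' g by (auto intro!: sos_add sos_mult sos_square)
  then show ?thesis
    by (rule quad_moduleI) (simp add: st(3) st'(3) algebra_simps power2_eq_square)
qed

lemma quad_module_sos: "sos s \<Longrightarrow> s \<in> quad_module g"
  by (rule quad_moduleI[OF _ sos_0]) auto

lemma quad_module_gen: "g \<in> quad_module g"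
  by (rule quad_moduleI[OF sos_0 sos_const[of 1]]) auto

lemma quad_module_const: "0 \<le> c \<Longrightarrow> (\<lambda>x. c) \<in> quad_module g"
  by (intro quad_module_sos sos_const)

lemma quad_module_scale: "0 \<le> c \<Longrightarrow> real_polynomial_function g \<Longrightarrow> p \<in> quad_module g \<Longrightarrow> (\<lambda>x. c * p x) \<in> quad_module g"
  using quad_module_mult[OF _ quad_module_const] by blast

lemma quad_module_sum:
  "finite S \<Longrightarrow> (\<And>s. s \<in> S \<Longrightarrow> p s \<in> quad_module g) \<Longrightarrow> (\<lambda>x. \<Sum>s\<in>S. p s x) \<in> quad_module g"
  by (induction S rule: finite_induct) (auto intro: quad_module_const quad_module_add)

lemma quad_module_prod:
  "finite S \<Longrightarrow> real_polynomial_function g \<Longrightarrow> (\<And>s. s \<in> S \<Longrightarrow> p s \<in> quad_module g) \<Longrightarrow>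
    (\<lambda>x. \<Prod>s\<in>S. p s x) \<in> quad_module g"
  by (induction S rule: finite_induct) (auto intro: quad_module_const quad_module_mult)

lemma quad_module_power:
  "real_polynomial_function g \<Longrightarrow> p \<in> quad_module g \<Longrightarrow> (\<lambda>x. p x ^ k) \<in> quad_module g"
  by (induction k) (auto intro: quad_module_const quad_module_mult)

definition bounded_by_module :: "(real ^ 'n \<Rightarrow> real) \<Rightarrow> (real ^ 'n \<Rightarrow> real) \<Rightarrow> bool" where
  "bounded_by_module g p \<longleftrightarrow> (\<exists>N. (\<lambda>x. N - p x) \<in> quad_module g \<and> (\<lambda>x. N + p x) \<in> quad_module g)"

lemma norm_power2_eq_sum: "(norm x)\<^sup>2 = (\<Sum>i\<in>UNIV. (x $ i)\<^sup>2)" for x :: "real ^ 'n"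
  by (simp add: norm_vec_def L2_set_def sum_nonneg)

text \<open>The bounded elements form a ring containing the constants, and the ball inequality
  bounds the coordinates, which generate all polynomials.\<close>

lemma bounded_by_module_polynomial:
  fixes g :: "real ^ 'n \<Rightarrow> real"
  assumes g: "real_polynomial_function g" and ball: "(\<lambda>x. R - (norm x)\<^sup>2) \<in> quad_module g"
    and p: "real_polynomial_function p"
  shows "bounded_by_module g p"
proof -
  have bI: "bounded_by_module g p" if "(\<lambda>x. N - p x) \<in> quad_module g" "(\<lambda>x. N + p x) \<in> quad_module g" for N p
    using that unfolding bounded_by_module_def by blast
  have const: "bounded_by_module g (\<lambda>x. c)" for c
    using quad_module_const[of "\<bar>c\<bar> - c" g] quad_module_const[of "\<bar>c\<bar> + c" g] by (intro bI[of "\<bar>c\<bar>"]) auto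
  have add: "bounded_by_module g (\<lambda>x. a x + b x)" if ab: "bounded_by_module g a" "bounded_by_module g b" for a b
  proof -
    obtain N M where N: "(\<lambda>x. N - a x) \<in> quad_module g" "(\<lambda>x. N + a x) \<in> quad_module g"
      and M: "(\<lambda>x. M - b x) \<in> quad_module g" "(\<lambda>x. M + b x) \<in> quad_module g"
      using ab unfolding bounded_by_module_def by blast
    show ?thesis
      using quad_module_add[OF N(1) M(1)] quad_module_add[OF N(2) M(2)]
      by (intro bI[of "N + M"]) (simp_all add: algebra_simps)
  qed
  have mult: "bounded_by_module g (\<lambda>x. a x * b x)" if ab: "bounded_by_module g a" "bounded_by_module g b" for a b
  proof -
    obtain N M where N: "(\<lambda>x. N - a x) \<in> quad_module g" "(\<lambda>x. N + a x) \<in> quad_module g"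
      and M: "(\<lambda>x. M - b x) \<in> quad_module g" "(\<lambda>x. M + b x) \<in> quad_module g"
      using ab unfolding bounded_by_module_def by blast
    note pr = quad_module_mult[OF g]
    \<comment> \<open>These two expressions equal \<open>N M - a b\<close> and
      \<open>N M + a b\<close>.\<close>
    have "(\<lambda>x. (1/2) * ((N - a x) * (M + b x) + (N + a x) * (M - b x))) \<in> quad_module g"
      "(\<lambda>x. (1/2) * ((N - a x) * (M - b x) + (N + a x) * (M + b x))) \<in> quad_module g"
      by (intro quad_module_scale[OF _ g] quad_module_add pr N M; simp)+
    then show ?thesis
      by (intro bI[of "N * M"]) (simp_all add: algebra_simps)
  qed
  have coord: "bounded_by_module g (\<lambda>x. x $ i)" for i
  proof -
    have comp: "real_polynomial_function (\<lambda>x :: real ^ 'n. x $ i)" for i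
      by (rule real_polynomial_function_component)
    \<comment> \<open>Completing the square leaves \<open>R + c^2 + 2 c x_i\<close>; taking
      \<open>c\<close> to be plus or minus \<open>1/2\<close> bounds the coordinate by
      \<open>R + 1/4\<close>.\<close>
    have "(\<lambda>x. (R - (norm x)\<^sup>2) + ((\<Sum>j\<in>UNIV - {i}. (x $ j)\<^sup>2) + (x $ i + c)\<^sup>2)) \<in> quad_module g" for c
      by (intro quad_module_add ball quad_module_sos sos_add sos_sum sos_square
          real_polynomial_function.intros(2,3) comp) auto
    moreover have "(R - (norm x)\<^sup>2) + ((\<Sum>j\<in>UNIV - {i}. (x $ j)\<^sup>2) + (x $ i + c)\<^sup>2) = R + c\<^sup>2 + 2 * c * x $ i"
      for x :: "real ^ 'n" and c
      by (simp add: norm_power2_eq_sum sum.remove[of UNIV i] power2_sum algebra_simps)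
    ultimately have "(\<lambda>x. R + c\<^sup>2 + 2 * c * x $ i) \<in> quad_module g" for c by simp
    from this[of "1/2"] this[of "-1/2"] show ?thesis
      by (intro bI[of "R + 1/4"]) (simp_all add: power2_eq_square)
  qed
  show ?thesis
    using p
  proof (induction rule: real_polynomial_function.induct)
    case (linear f)
    have "bounded_by_module g (\<lambda>x. \<Sum>i\<in>S. f (axis i 1) * x $ i)" if "finite S" for S
      using that by (induction S rule: finite_induct) (simp_all add: const add[OF mult[OF const coord]])
    then have "bounded_by_module g (\<lambda>x. \<Sum>i\<in>UNIV. f (axis i 1) * x $ i)" by simp
    moreover have "f x = (\<Sum>i\<in>UNIV. f (axis i 1) * x $ i)" for x
    proof -
      have "f x = f (\<Sum>i\<in>UNIV. x $ i *\<^sub>R axis i 1)"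
        by (subst basis_expansion[symmetric]) (simp add: scalar_mult_eq_scaleR)
      also have "\<dots> = (\<Sum>i\<in>UNIV. f (axis i 1) * x $ i)"
        using linear by (simp add: bounded_linear.linear linear_sum linear_cmul mult.commute)
      finally show ?thesis .
    qed
    then have "f = (\<lambda>x. \<Sum>i\<in>UNIV. f (axis i 1) * x $ i)" by (rule ext)
    ultimately show ?case by metis
  qed (auto intro: const add mult)
qed

lemma real_polynomial_function_norm2: "real_polynomial_function (\<lambda>x :: real ^ 'n. (norm x)\<^sup>2)"
  unfolding norm_power2_eq_sum
  by (intro real_polynomial_function_sum real_polynomial_function_power real_polynomial_function_component) auto

text \<open>Woermann's argument: \<open>1 + t = s (R - |x|^2)\<close> lies in the module times \<open>R - |x|^2\<close>, and
  \<open>t\<close> is bounded modulo the archimedean module of \<open>R - |x|^2\<close>; multiplying by \<open>1 + t\<close> moves the bound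
  into the module of \<open>g\<close>.\<close>

theorem quad_module_archimedean:
  fixes g :: "real ^ 'n \<Rightarrow> real"
  assumes g: "real_polynomial_function g" and bounded: "bounded {x. g x \<ge> 0}"
  shows "\<exists>N. (\<lambda>x. N - (norm x)\<^sup>2) \<in> quad_module g"
proof -
  obtain R0 where R0: "R0 > 0" "\<And>x. g x \<ge> 0 \<Longrightarrow> norm x \<le> R0"
    using bounded unfolding bounded_pos by blast
  \<comment> \<open>The additional 1 makes \<open>R - |x|^2\<close> positive on the whole set
    \<open>g \<ge> 0\<close>, so that \<open>g \<ge> 0\<close> and \<open>- b \<ge> 0\<close> are
    incompatible.\<close>
  define R where "R = R0\<^sup>2 + 1"
  have "R > 0" by (simp add: R_def add_nonneg_pos)
  define b where "b x = R - (norm x)\<^sup>2" for x :: "real ^ 'n"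
  have b: "real_polynomial_function b"
    unfolding b_def diff_conv_add_uminus
    using real_polynomial_function.intros(4)[OF real_polynomial_function.intros(2)[of "- 1"] real_polynomial_function_norm2]
    by (intro real_polynomial_function.intros(2,3)) simp_all
  have "real_polynomial_function (\<lambda>x. - 1 * b x)"
    by (intro real_polynomial_function.intros(2,4) b)
  then have "real_polynomial_function (\<lambda>x. - b x)" by simp
  moreover have False if "g x \<ge> 0" "- b x \<ge> 0" for x
  proof -
    have "(norm x)\<^sup>2 \<le> R0\<^sup>2" using R0(2)[OF that(1)] by (intro power_mono) auto
    then show False using that(2) by (simp add: b_def R_def)
  qed
  ultimately obtain t0 t1 t2 t3 where t: "sos t0" "sos t1" "sos t2" "sos t3"
    and id: "\<And>x. t0 x + t1 x * g x + t2 x * - b x + t3 x * (g x * - b x) = - 1"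
    using positivstellensatz_empty[OF g, of "\<lambda>x. - b x"] by blast
  define t where "t x = t0 x + t1 x * g x" for x
  define s where "s x = t2 x + t3 x * g x" for x
  have T: "t \<in> quad_module g" "s \<in> quad_module g"
    using t by (auto simp: t_def s_def intro: quad_moduleI)
  have id': "1 + t x = s x * b x" for x
    using id[of x] by (simp add: t_def s_def algebra_simps)
  have tp: "real_polynomial_function t"
    unfolding t_def by (intro real_polynomial_function.intros(3,4) sos_polynomial[OF t(1)] sos_polynomial[OF t(2)] g)
  have "(\<lambda>x. R - (norm x)\<^sup>2) \<in> quad_module b"
    using quad_module_gen[of b] by (simp add: b_def[abs_def])
  from bounded_by_module_polynomial[OF b this tp]
  obtain N where N: "(\<lambda>x. N - t x) \<in> quad_module b" unfolding bounded_by_module_def by blast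
  obtain p q where pq: "sos p" "sos q" "\<And>x. N - t x = p x + q x * b x"
    using N unfolding quad_module_def by (auto dest: fun_cong)
  have one: "(\<lambda>x. 1 + t x) \<in> quad_module g"
    by (intro quad_module_add quad_module_const T) simp
  note add = quad_module_add and mult = quad_module_mult[OF g] and sc = quad_module_scale[OF _ g]
  have bsq: "sos (\<lambda>x. (b x)\<^sup>2)" "sos (\<lambda>x. (N / 2 - t x)\<^sup>2)"
    using b tp real_polynomial_function.intros(4)[OF real_polynomial_function.intros(2)[of "- 1"] tp]
    by (auto intro!: sos_square real_polynomial_function_diff real_polynomial_function.intros(2))
  \<comment> \<open>In \<open>(1 + t) (N - t) = (1 + t) p + (1 + t) q b\<close> the factor
    \<open>1 + t = s b\<close> turns the stray \<open>b\<close> into the square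
    \<open>b^2\<close>.\<close>
  have "(\<lambda>x. (1 + t x) * p x + s x * q x * (b x)\<^sup>2) \<in> quad_module g"
    using pq by (intro add mult one T quad_module_sos bsq)
  moreover have "(1 + t x) * p x + s x * q x * (b x)\<^sup>2 = (1 + t x) * (N - t x)" for x
    unfolding pq(3) using id'[of x] by (simp add: algebra_simps power2_eq_square)
  ultimately have "(\<lambda>x. (1 + t x) * (N - t x)) \<in> quad_module g" by simp
  \<comment> \<open>Adding \<open>(N / 2 - t)^2\<close> cancels the terms in \<open>t^2\<close> and
    \<open>N t\<close> and leaves a bound for \<open>t\<close> itself.\<close>
  from add[OF this quad_module_sos[OF bsq(2)]]
  have Nt: "(\<lambda>x. (N + N\<^sup>2 / 4) - t x) \<in> quad_module g"
    by (simp add: algebra_simps power2_eq_square)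
  have u: "sos (\<lambda>x :: real ^ 'n. (norm x)\<^sup>2)"
    unfolding norm_power2_eq_sum by (intro sos_sum sos_square real_polynomial_function_component) auto
  \<comment> \<open>As \<open>s b^2 = (1 + t) b\<close> and \<open>b = R - |x|^2\<close>, the terms
    containing \<open>t\<close> cancel and only a constant minus \<open>|x|^2\<close>
    remains.\<close>
  have "(\<lambda>x. s x * (b x)\<^sup>2 + (norm x)\<^sup>2 * t x + R * ((N + N\<^sup>2 / 4) - t x)) \<in> quad_module g"
    using \<open>R > 0\<close> by (intro add mult T Nt sc quad_module_sos[OF u] quad_module_sos[OF bsq(1)]) simp
  moreover have "s x * (b x)\<^sup>2 + (norm x)\<^sup>2 * t x + R * ((N + N\<^sup>2 / 4) - t x)
      = (R + R * (N + N\<^sup>2 / 4)) - (norm x)\<^sup>2" for x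
  proof -
    have "s x * (b x)\<^sup>2 = (1 + t x) * b x" using id'[of x] by (simp add: power2_eq_square)
    then show ?thesis by (simp add: b_def algebra_simps)
  qed
  ultimately show ?thesis by (intro exI[of _ "R + R * (N + N\<^sup>2 / 4)"]) simp
qed

section \<open>Bernstein polynomials on a box\<close>

definition bern :: "nat \<Rightarrow> nat \<Rightarrow> real \<Rightarrow> real" where
  "bern d k y = real (d choose k) * y ^ k * (1 - y) ^ (d - k)"

text \<open>The coefficient of \<open>bern d k\<close> in the expansion of \<open>y ^ j\<close>; for
  large \<open>d\<close> it is close to \<open>(k / d) ^ j\<close>, the value of the monomial at a
  grid point.\<close>

definition bern_coeff :: "nat \<Rightarrow> nat \<Rightarrow> nat \<Rightarrow> real" where
  "bern_coeff d k j = real (k choose j) / real (d choose j)"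

text \<open>Expand \<open>y ^ j * (y + (1 - y)) ^ (d - j)\<close> by the binomial theorem.\<close>

lemma power_eq_bern:
  assumes "j \<le> d"
  shows "y ^ j = (\<Sum>k\<le>d. bern_coeff d k j * bern d k y)"
proof -
  have "(\<Sum>k\<le>d. bern_coeff d k j * bern d k y) = (\<Sum>k\<in>{j..d}. bern_coeff d k j * bern d k y)"
    by (rule sum.mono_neutral_right) (auto simp: bern_coeff_def binomial_eq_0)
  also have "\<dots> = (\<Sum>k\<in>{j..d}. real ((d - j) choose (k - j)) * y ^ k * (1 - y) ^ (d - k))"
  proof (rule sum.cong)
    fix k assume k: "k \<in> {j..d}"
    then have "(d choose k) * (k choose j) = (d choose j) * ((d - j) choose (k - j))"
      by (intro choose_mult) auto
    then have "real (d choose k) * real (k choose j) = real (d choose j) * real ((d - j) choose (k - j))"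
      by (metis of_nat_mult)
    moreover have "real (d choose j) \<noteq> 0" using assms by simp
    ultimately have "bern_coeff d k j * real (d choose k) = real ((d - j) choose (k - j))"
      by (simp add: bern_coeff_def field_simps)
    then show "bern_coeff d k j * bern d k y = real ((d - j) choose (k - j)) * y ^ k * (1 - y) ^ (d - k)"
      by (simp add: bern_def mult.assoc[symmetric])
  qed simp
  also have "\<dots> = (\<Sum>l\<le>d - j. real ((d - j) choose l) * y ^ (l + j) * (1 - y) ^ (d - (l + j)))"
    by (rule sum.reindex_bij_witness[of _ "\<lambda>l. l + j" "\<lambda>k. k - j"]) (use assms in auto)
  also have "\<dots> = y ^ j * (\<Sum>l\<le>d - j. real ((d - j) choose l) * y ^ l * (1 - y) ^ ((d - j) - l))"
    by (simp add: sum_distrib_left power_add mult_ac diff_diff_eq add.commute)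
  also have "(\<Sum>l\<le>d - j. real ((d - j) choose l) * y ^ l * (1 - y) ^ ((d - j) - l)) = (y + (1 - y)) ^ (d - j)"
    by (subst binomial_ring) simp
  finally show ?thesis by simp
qed

lemma bern_coeff_bounds: "k \<le> d \<Longrightarrow> j \<le> d \<Longrightarrow> 0 \<le> bern_coeff d k j \<and> bern_coeff d k j \<le> 1"
  using binomial_right_mono[of k d j] by (simp add: bern_coeff_def)

lemma bern_coeff_Suc:
  assumes "k \<le> d" "j < d" "j \<le> k"
  shows "bern_coeff d k (Suc j) = bern_coeff d k j * (real (k - j) / real (d - j))"
proof -
  have rec: "Suc j * (n choose Suc j) = (n - j) * (n choose j)" for n
    by (simp only: binomial_absorption binomial_absorb_comp)
  have "real (Suc j) * real (k choose Suc j) = real (k - j) * real (k choose j)"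
    "real (Suc j) * real (d choose Suc j) = real (d - j) * real (d choose j)"
    using rec[of k] rec[of d] by (metis of_nat_mult)+
  then have "real (k choose Suc j) = real (k - j) * real (k choose j) / real (Suc j)"
    "real (d choose Suc j) = real (d - j) * real (d choose j) / real (Suc j)"
    by (simp_all add: field_simps del: of_nat_Suc)
  then show ?thesis by (simp add: bern_coeff_def mult.commute del: of_nat_Suc binomial_Suc_Suc)
qed

text \<open>The coefficient is the product of \<open>(k - i) / (d - i)\<close> over
  \<open>i < j\<close>, with truncated subtraction, and each factor is within
  \<open>D / (d - D)\<close> of \<open>k / d\<close>. All these numbers lie in
  \<open>[0, 1]\<close>, so the errors add up.\<close>

lemma bern_coeff_approx:
  assumes "k \<le> d" "D < d" "j \<le> D"
  shows "\<bar>bern_coeff d k j - (real k / real d) ^ j\<bar> \<le> real j * (real D / real (d - D))"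
  using assms(3)
proof (induction j)
  case 0
  then show ?case by (simp add: bern_coeff_def)
next
  case (Suc j)
  define w where "w = bern_coeff d k j"
  define t where "t = real k / real d"
  have t: "0 \<le> t" "t \<le> 1" using assms by (auto simp: t_def)
  have IH: "\<bar>w - t ^ j\<bar> \<le> real j * (real D / real (d - D))" using Suc by (simp add: w_def t_def)
  have w: "0 \<le> w" "w \<le> 1" using bern_coeff_bounds[of k d j] Suc.prems assms by (auto simp: w_def)
  have "\<bar>bern_coeff d k (Suc j) - w * t\<bar> \<le> real D / real (d - D)"
  proof (cases "j \<le> k")
    case True
    define r where "r = real (k - j) / real (d - j)"
    have "t - r = real j * (real d - real k) / (real d * real (d - j))"
      using True assms Suc.prems by (simp add: r_def t_def of_nat_diff field_simps)
    also have "\<dots> = (real j / real (d - j)) * ((real d - real k) / real d)" by simp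
    finally have tr: "t - r = (real j / real (d - j)) * ((real d - real k) / real d)" .
    have f: "0 \<le> (real d - real k) / real d" "(real d - real k) / real d \<le> 1" using assms by auto
    have g: "0 \<le> real j / real (d - j)" "real j / real (d - j) \<le> real D / real (d - D)"
      using assms Suc.prems by (auto intro!: frac_le)
    have "0 \<le> t - r" "t - r \<le> real D / real (d - D)"
      unfolding tr using mult_nonneg_nonneg[OF g(1) f(1)] mult_mono[OF g(2) f(2) _ f(1)] by auto
    then have tr2: "\<bar>r - t\<bar> \<le> real D / real (d - D)" by simp
    have "bern_coeff d k (Suc j) = w * r"
      unfolding w_def r_def using assms Suc.prems True by (intro bern_coeff_Suc) auto
    then have "\<bar>bern_coeff d k (Suc j) - w * t\<bar> = w * \<bar>r - t\<bar>"
      using w by (simp add: right_diff_distrib[symmetric] abs_mult)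
    also have "\<dots> \<le> 1 * (real D / real (d - D))" using w tr2 by (intro mult_mono) auto
    finally show ?thesis by simp
  next
    case False
    then show ?thesis by (simp add: w_def bern_coeff_def binomial_eq_0)
  qed
  moreover have "\<bar>w * t - t ^ Suc j\<bar> \<le> real j * (real D / real (d - D))"
  proof -
    have "w * t - t ^ Suc j = (w - t ^ j) * t" by (simp add: algebra_simps)
    then have "\<bar>w * t - t ^ Suc j\<bar> = \<bar>w - t ^ j\<bar> * t" using t by (simp add: abs_mult)
    also have "\<dots> \<le> (real j * (real D / real (d - D))) * 1" using IH t by (intro mult_mono) auto
    finally show ?thesis by simp
  qed
  ultimately have "\<bar>bern_coeff d k (Suc j) - w * t\<bar> + \<bar>w * t - t ^ Suc j\<bar>
      \<le> real D / real (d - D) + real j * (real D / real (d - D))" by (rule add_mono)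
  then have "\<bar>bern_coeff d k (Suc j) - t ^ Suc j\<bar> \<le> real D / real (d - D) + real j * (real D / real (d - D))"
    using abs_triangle_ineq[of "bern_coeff d k (Suc j) - w * t" "w * t - t ^ Suc j"] by simp
  then show ?case by (simp add: t_def distrib_right add_divide_distrib)
qed

lemma poly_bern_expansion:
  fixes c :: "('n::finite \<Rightarrow> nat) \<Rightarrow> real"
  assumes "finite M" "\<And>m i. m \<in> M \<Longrightarrow> m i \<le> d"
  shows "(\<Sum>m\<in>M. c m * (\<Prod>i\<in>UNIV. y i ^ m i)) =
    (\<Sum>k\<in>PiE UNIV (\<lambda>_. {..d}). (\<Sum>m\<in>M. c m * (\<Prod>i\<in>UNIV. bern_coeff d (k i) (m i))) * (\<Prod>i\<in>UNIV. bern d (k i) (y i)))"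
proof -
  have "(\<Prod>i\<in>UNIV. y i ^ m i) = (\<Sum>k\<in>PiE UNIV (\<lambda>_. {..d}). \<Prod>i\<in>UNIV. bern_coeff d (k i) (m i) * bern d (k i) (y i))"
    if "m \<in> M" for m
  proof -
    have "(\<Prod>i\<in>UNIV. y i ^ m i) = (\<Prod>i\<in>UNIV. \<Sum>k\<le>d. bern_coeff d k (m i) * bern d k (y i))"
      using assms(2)[OF that] by (intro prod.cong power_eq_bern) auto
    also have "\<dots> = (\<Sum>k\<in>PiE UNIV (\<lambda>_. {..d}). \<Prod>i\<in>UNIV. bern_coeff d (k i) (m i) * bern d (k i) (y i))"
      by (subst prod_sum_PiE) auto
    finally show ?thesis .
  qed
  then have "(\<Sum>m\<in>M. c m * (\<Prod>i\<in>UNIV. y i ^ m i)) =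
      (\<Sum>m\<in>M. \<Sum>k\<in>PiE UNIV (\<lambda>_. {..d}). (c m * (\<Prod>i\<in>UNIV. bern_coeff d (k i) (m i))) * (\<Prod>i\<in>UNIV. bern d (k i) (y i)))"
    by (intro sum.cong) (auto simp: prod.distrib sum_distrib_left mult.assoc)
  also have "\<dots> = (\<Sum>k\<in>PiE UNIV (\<lambda>_. {..d}). \<Sum>m\<in>M. (c m * (\<Prod>i\<in>UNIV. bern_coeff d (k i) (m i))) * (\<Prod>i\<in>UNIV. bern d (k i) (y i)))"
    by (rule sum.swap)
  finally show ?thesis by (simp add: sum_distrib_right)
qed

lemma bern_coeff_prod_approx:
  fixes k m :: "'n::finite \<Rightarrow> nat"
  assumes "\<And>i. k i \<le> d" "D < d" "\<And>i. m i \<le> D"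
  shows "\<bar>(\<Prod>i\<in>UNIV. bern_coeff d (k i) (m i)) - (\<Prod>i\<in>UNIV. (real (k i) / real d) ^ m i)\<bar>
    \<le> real CARD('n) * (real D * (real D / real (d - D)))"
proof -
  have "norm ((\<Prod>i\<in>UNIV. bern_coeff d (k i) (m i)) - (\<Prod>i\<in>UNIV. (real (k i) / real d) ^ m i))
      \<le> (\<Sum>i\<in>UNIV. norm (bern_coeff d (k i) (m i) - (real (k i) / real d) ^ m i))"
  proof (rule norm_prod_diff)
    fix i
    have "m i \<le> d" using assms(2) assms(3)[of i] by linarith
    then show "norm (bern_coeff d (k i) (m i)) \<le> 1" using bern_coeff_bounds[of "k i" d "m i"] assms by simp
    have "real (k i) / real d \<le> 1" using assms by (simp add: divide_le_eq)
    then show "norm ((real (k i) / real d) ^ m i) \<le> 1" by (simp add: power_le_one)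
  qed
  also have "\<dots> \<le> (\<Sum>i\<in>(UNIV :: 'n set). real D * (real D / real (d - D)))"
  proof (rule sum_mono)
    fix i
    have "norm (bern_coeff d (k i) (m i) - (real (k i) / real d) ^ m i) \<le> real (m i) * (real D / real (d - D))"
      using bern_coeff_approx[of "k i" d D "m i"] assms by simp
    also have "\<dots> \<le> real D * (real D / real (d - D))" using assms by (intro mult_right_mono) auto
    finally show "norm (bern_coeff d (k i) (m i) - (real (k i) / real d) ^ m i) \<le> real D * (real D / real (d - D))" .
  qed
  finally show ?thesis by simp
qed

text \<open>As \<open>d\<close> grows, the Bernstein coefficients approach the values of the
  polynomial on the grid, which are at least the positive minimum \<open>e\<close> over the box.
  Once all coefficients are nonnegative, the expansion lies in the module, because the Bernstein
  polynomials are products of the linear forms bounding the box.\<close>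

lemma box_positive_in_module:
  fixes g p :: "real ^ 'n \<Rightarrow> real"
  assumes g: "real_polynomial_function g" and p: "real_polynomial_function p" and a: "a > 0"
    and lin: "\<And>i. (\<lambda>x. a + x $ i) \<in> quad_module g" "\<And>i. (\<lambda>x. a - x $ i) \<in> quad_module g"
    and pos: "\<And>x. (\<And>i. \<bar>x $ i\<bar> \<le> a) \<Longrightarrow> p x > 0"
  shows "p \<in> quad_module g"
proof -
  define B where "B = {x :: real ^ 'n. \<forall>i. \<bar>x $ i\<bar> \<le> a}"
  have B_eq: "B = cbox (\<chi> i. - a) (\<chi> i. a)"
    by (auto simp: B_def mem_box_cart abs_le_iff minus_le_iff)
  have contp: "continuous_on S p" for S
    using continuous_real_polymonial_function[OF p] by (simp add: continuous_at_imp_continuous_on)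
  have "compact B" "B \<noteq> {}" using a by (auto simp: B_eq interval_ne_empty_cart)
  then obtain x0 where x0: "x0 \<in> B" "\<And>x. x \<in> B \<Longrightarrow> p x0 \<le> p x"
    using continuous_attains_inf[OF _ _ contp, of B] by blast
  define e where "e = p x0"
  have e: "e > 0" using x0(1) pos by (auto simp: e_def B_def)
  \<comment> \<open>The affine substitution carrying the unit cube onto the box.\<close>
  define q where "q y = p (\<chi> i. 2 * a * y $ i - a)" for y :: "real ^ 'n"
  have "polynomial_function (\<lambda>y :: real ^ 'n. (2 * a) *\<^sub>R y - (\<chi> i. a))"
    by (intro polynomial_function_diff polynomial_function_cmul polynomial_function_id polynomial_function_const)
  moreover have "(2 * a) *\<^sub>R y - (\<chi> i. a) = (\<chi> i. 2 * a * y $ i - a)" for y :: "real ^ 'n"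
    by (simp add: vec_eq_iff)
  ultimately have "polynomial_function (\<lambda>y :: real ^ 'n. (\<chi> i. 2 * a * y $ i - a))" by simp
  then have "real_polynomial_function q"
    using real_polynomial_function_compose[OF _ p] unfolding q_def comp_def by blast
  then obtain D where "q \<in> poly_deg_le D" using real_polynomial_function_iff_poly_deg_le by blast
  then obtain c where q: "\<And>y. q y = (\<Sum>m | (\<Sum>i\<in>UNIV. m i) \<le> D. c m * monomial_fun m y)"
    unfolding poly_deg_le_def by (auto simp: fun_eq_iff)
  define M where "M = {m :: 'n \<Rightarrow> nat. (\<Sum>i\<in>UNIV. m i) \<le> D}"
  have M: "finite M" "\<And>m i. m \<in> M \<Longrightarrow> m i \<le> D"
    using finite_exponents[of D] member_le_sum[of _ "UNIV :: 'n set"] unfolding M_def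
    by (auto intro: order.trans)
  \<comment> \<open>Coefficients and grid values differ by at most \<open>K / (d - D)\<close>, so
    \<open>d - D > K / e\<close> makes the error smaller than \<open>e\<close>.\<close>
  define K where "K = real CARD('n) * (real D * real D) * (\<Sum>m\<in>M. \<bar>c m\<bar>)"
  have "K \<ge> 0" unfolding K_def by (auto intro!: mult_nonneg_nonneg sum_nonneg)
  obtain n where n: "real n > K / e" using reals_Archimedean2 by blast
  define d where "d = D + n + 1"
  have d: "D < d" "real (d - D) > K / e" using n by (auto simp: d_def)
  define C where "C k = (\<Sum>m\<in>M. c m * (\<Prod>i\<in>UNIV. bern_coeff d (k i) (m i)))" for k
  have Cpos: "C k \<ge> 0" if k: "k \<in> PiE UNIV (\<lambda>_. {..d})" for k
  proof -
    have kd: "k i \<le> d" for i using k by (auto simp: PiE_def Pi_def)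
    define y where "y = (\<chi> i. real (k i) / real d)"
    have "\<bar>C k - q y\<bar> = \<bar>\<Sum>m\<in>M. c m * ((\<Prod>i\<in>UNIV. bern_coeff d (k i) (m i)) - (\<Prod>i\<in>UNIV. (real (k i) / real d) ^ m i))\<bar>"
      unfolding C_def q M_def[symmetric] monomial_fun_def y_def
      by (simp add: sum_subtractf right_diff_distrib)
    also have "\<dots> \<le> (\<Sum>m\<in>M. \<bar>c m\<bar> * (real CARD('n) * (real D * (real D / real (d - D)))))"
    proof (rule order.trans[OF sum_abs sum_mono], unfold abs_mult)
      fix m assume "m \<in> M"
      then show "\<bar>c m\<bar> * \<bar>(\<Prod>i\<in>UNIV. bern_coeff d (k i) (m i)) - (\<Prod>i\<in>UNIV. (real (k i) / real d) ^ m i)\<bar>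
          \<le> \<bar>c m\<bar> * (real CARD('n) * (real D * (real D / real (d - D))))"
        using kd d(1) M(2) by (intro mult_left_mono bern_coeff_prod_approx) auto
    qed
    also have "\<dots> = K / real (d - D)"
      unfolding K_def by (subst sum_distrib_right[symmetric]) simp
    also have "\<dots> \<le> e"
    proof -
      have "real (d - D) > 0" using d by simp
      moreover have "K < real (d - D) * e" using d(2) e by (simp only: pos_divide_less_eq)
      ultimately show ?thesis by (simp only: pos_divide_le_eq mult.commute less_imp_le)
    qed
    finally have "C k \<ge> q y - e" by simp
    moreover have "q y \<ge> e"
    proof -
      have "(\<chi> i. 2 * a * y $ i - a) \<in> B"
      proof -
        have "\<bar>2 * a * (real (k i) / real d) - a\<bar> \<le> a" for i
        proof -
          have "0 \<le> real (k i) / real d" "real (k i) / real d \<le> 1" using kd[of i] d by auto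
          then have "0 \<le> a * (real (k i) / real d)" "a * (real (k i) / real d) \<le> a * 1"
            using a by (simp, intro mult_left_mono) simp_all
          then show ?thesis by (simp add: abs_le_iff)
        qed
        then show ?thesis by (auto simp: B_def y_def)
      qed
      then show ?thesis unfolding q_def e_def by (rule x0(2))
    qed
    ultimately show ?thesis by simp
  qed
  define u where "u i x = (1 / (2 * a)) * (a + x $ i)" for i and x :: "real ^ 'n"
  have px: "p x = (\<Sum>k\<in>PiE UNIV (\<lambda>_. {..d}). C k * (\<Prod>i\<in>UNIV. bern d (k i) (u i x)))" for x
  proof -
    have "2 * a * u i x - a = x $ i" for i using a by (simp add: u_def)
    then have "p x = q (\<chi> i. u i x)" unfolding q_def by (auto intro!: arg_cong[of _ _ p] simp: vec_eq_iff)
    also have "\<dots> = (\<Sum>m\<in>M. c m * (\<Prod>i\<in>UNIV. u i x ^ m i))"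
      unfolding q M_def[symmetric] monomial_fun_def by simp
    also have "\<dots> = (\<Sum>k\<in>PiE UNIV (\<lambda>_. {..d}). C k * (\<Prod>i\<in>UNIV. bern d (k i) (u i x)))"
      unfolding C_def using M(1) order.trans[OF M(2) less_imp_le[OF d(1)]] by (intro poly_bern_expansion)
    finally show ?thesis .
  qed
  note sc = quad_module_scale[OF _ g] and mult = quad_module_mult[OF g] and pw = quad_module_power[OF g]
  have u1: "u i \<in> quad_module g" for i
    unfolding u_def using a by (intro sc lin) simp
  have u2: "(\<lambda>x. 1 - u i x) \<in> quad_module g" for i
  proof -
    have "(\<lambda>x. (1 / (2 * a)) * (a - x $ i)) \<in> quad_module g" using a by (intro sc lin) simp
    moreover have "(1 / (2 * a)) * (a - x $ i) = 1 - u i x" for x using a by (simp add: u_def field_simps)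
    ultimately show ?thesis by simp
  qed
  have "(\<lambda>x. \<Sum>k\<in>PiE UNIV (\<lambda>_. {..d}). C k * (\<Prod>i\<in>UNIV. bern d (k i) (u i x))) \<in> quad_module g"
  proof (intro quad_module_sum sc Cpos quad_module_prod finite_PiE g)
    fix k i
    show "(\<lambda>x. bern d (k i) (u i x)) \<in> quad_module g"
      unfolding bern_def by (intro mult sc pw u1 u2) simp
  qed auto
  then show ?thesis unfolding px[symmetric] .
qed

section \<open>From the box to a compact set\<close>

lemma power_decay_bound:
  fixes t :: real
  assumes "0 \<le> t" "t \<le> 1" "n > 0"
  shows "t * (1 - t) ^ n \<le> 1 / real n"
proof -
  \<comment> \<open>Bernoulli's inequality replaces \<open>1 + n t\<close> by
    \<open>(1 + t) ^ n\<close>, and \<open>(1 - t) (1 + t) \<le> 1\<close>.\<close>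
  have "(1 - t) ^ n * (1 + real n * t) \<le> (1 - t) ^ n * (1 + t) ^ n"
    using Bernoulli_inequality[of t n] assms by (intro mult_left_mono) auto
  also have "\<dots> = ((1 - t) * (1 + t)) ^ n" by (simp add: power_mult_distrib)
  also have "\<dots> \<le> 1" using assms by (intro power_le_one) (auto simp: algebra_simps mult_le_one)
  finally have "(1 - t) ^ n * (1 + real n * t) \<le> 1" .
  moreover have "(1 - t) ^ n * (real n * t) \<le> (1 - t) ^ n * (1 + real n * t)"
    using assms by (intro mult_left_mono) auto
  ultimately have "real n * (t * (1 - t) ^ n) \<le> 1" by (simp add: mult_ac)
  then show ?thesis using assms by (simp add: field_simps)
qed

text \<open>Subtracting \<open>s g\<close> with \<open>s = (1 - g / G)^n\<close> makes
  \<open>p\<close> positive on the whole box: where \<open>g \<ge> 0\<close> the correction is tiny,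
  where \<open>g < 0\<close> it increases \<open>p\<close>, and where \<open>p \<le> 0\<close> the
  value of \<open>g\<close> is at most \<open>- m\<close>, so \<open>s\<close> is large.\<close>

theorem positivstellensatz_compact:
  fixes g p :: "real ^ 'n \<Rightarrow> real"
  assumes g: "real_polynomial_function g" and p: "real_polynomial_function p"
    and bounded: "bounded {x. g x \<ge> 0}" and pos: "\<And>x. g x \<ge> 0 \<Longrightarrow> p x > 0"
  shows "p \<in> quad_module g"
proof -
  note sc = quad_module_scale[OF _ g] and mult = quad_module_mult[OF g] and pw = quad_module_power[OF g]
  obtain R where R: "(\<lambda>x. R - (norm x)\<^sup>2) \<in> quad_module g"
    using quad_module_archimedean[OF g bounded] by blast
  have "\<exists>N. (\<lambda>x. N - x $ i) \<in> quad_module g \<and> (\<lambda>x. N + x $ i) \<in> quad_module g" for i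
    using bounded_by_module_polynomial[OF g R real_polynomial_function_component] unfolding bounded_by_module_def .
  then obtain N where N: "\<And>i. (\<lambda>x. N i - x $ i) \<in> quad_module g" "\<And>i. (\<lambda>x. N i + x $ i) \<in> quad_module g" by metis
  define a where "a = 1 + (\<Sum>i\<in>UNIV. \<bar>N i\<bar>)"
  have "a > 0" unfolding a_def by (intro add_pos_nonneg sum_nonneg) auto
  have Na: "N i \<le> a" for i
    using member_le_sum[of i UNIV "\<lambda>i. \<bar>N i\<bar>"] by (simp add: a_def)
  have lin: "(\<lambda>x. a + x $ i) \<in> quad_module g" "(\<lambda>x. a - x $ i) \<in> quad_module g" for i
    using quad_module_add[OF quad_module_const[of "a - N i" g] N(1)[of i]]
      quad_module_add[OF quad_module_const[of "a - N i" g] N(2)[of i]] Na[of i] by simp_all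
  define B where "B = {x :: real ^ 'n. \<forall>i. \<bar>x $ i\<bar> \<le> a}"
  have "B = cbox (\<chi> i. - a) (\<chi> i. a)"
    by (auto simp: B_def mem_box_cart abs_le_iff minus_le_iff)
  then have B: "compact B" by simp
  have cont: "continuous_on UNIV p" "continuous_on UNIV g"
    using continuous_real_polymonial_function[OF p] continuous_real_polymonial_function[OF g]
    by (simp_all add: continuous_at_imp_continuous_on)
  have cB: "continuous_on S p" "continuous_on S g" for S using cont continuous_on_subset by blast+
  have closed: "closed {x. p x \<le> 0}" "closed {x. g x \<ge> 0}"
    using cont by (auto intro: closed_Collect_le continuous_on_const)
  obtain G where G: "G > 0" "\<And>x. x \<in> B \<Longrightarrow> \<bar>g x\<bar> \<le> G"
    using compact_imp_bounded[OF compact_continuous_image[OF cB(2) B]] unfolding bounded_pos by auto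
  obtain P where P: "P > 0" "\<And>x. x \<in> B \<Longrightarrow> \<bar>p x\<bar> \<le> P"
    using compact_imp_bounded[OF compact_continuous_image[OF cB(1) B]] unfolding bounded_pos by auto
  have "\<exists>e>0. \<forall>x\<in>B. g x \<ge> 0 \<longrightarrow> p x \<ge> e"
  proof (cases "B \<inter> {x. g x \<ge> 0} = {}")
    case False
    then obtain x0 where "x0 \<in> B \<inter> {x. g x \<ge> 0}" "\<And>x. x \<in> B \<inter> {x. g x \<ge> 0} \<Longrightarrow> p x0 \<le> p x"
      using continuous_attains_inf[OF compact_Int_closed[OF B closed(2)] _ cB(1)] by blast
    then show ?thesis using pos[of x0] by (intro exI[of _ "p x0"]) auto
  next
    case True
    then show ?thesis by (intro exI[of _ 1]) auto
  qed
  then obtain e where e: "e > 0" "\<And>x. x \<in> B \<Longrightarrow> g x \<ge> 0 \<Longrightarrow> p x \<ge> e" by blast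
  have "\<exists>m>0. \<forall>x\<in>B. p x \<le> 0 \<longrightarrow> g x \<le> - m"
  proof (cases "B \<inter> {x. p x \<le> 0} = {}")
    case False
    then obtain x0 where x0: "x0 \<in> B \<inter> {x. p x \<le> 0}" "\<And>x. x \<in> B \<inter> {x. p x \<le> 0} \<Longrightarrow> g x \<le> g x0"
      using continuous_attains_sup[OF compact_Int_closed[OF B closed(1)] _ cB(2)] by blast
    then have "g x0 < 0" using pos[of x0] by force
    then show ?thesis using x0 by (intro exI[of _ "- g x0"]) auto
  next
    case True
    then show ?thesis by (intro exI[of _ 1]) auto
  qed
  then obtain m where m: "m > 0" "\<And>x. x \<in> B \<Longrightarrow> p x \<le> 0 \<Longrightarrow> g x \<le> - m" by blast
  \<comment> \<open>\<open>G / e\<close> gives \<open>s g < e\<close> where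
    \<open>g \<ge> 0\<close>, and \<open>P G / m^2\<close> lets \<open>- s g\<close> exceed the
    bound \<open>P\<close> of \<open>p\<close> where \<open>p \<le> 0\<close>. The exponent
    \<open>2 k\<close> is even, so \<open>s\<close> is a square.\<close>
  obtain k where k: "real k > max (G / e) (P * G / m\<^sup>2)" using reals_Archimedean2 by blast
  have "G / e > 0" using G e by simp
  then have k0: "k > 0" using k by (cases k) auto
  define n where "n = 2 * k"
  define s where "s x = (1 - g x / G) ^ n" for x
  have s2: "s x = ((1 - g x / G) ^ k)\<^sup>2" for x by (simp add: s_def n_def power_mult[symmetric] mult.commute)
  have "real_polynomial_function (\<lambda>x. (1 - g x / G) ^ k)"
    by (intro real_polynomial_function_power real_polynomial_function_diff real_polynomial_function_divide
        g real_polynomial_function.intros(2))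
  then have sos: "sos s" unfolding s2 by (rule sos_square)
  have "p x - s x * g x > 0" if x: "\<And>i. \<bar>x $ i\<bar> \<le> a" for x :: "real ^ 'n"
  proof -
    have xB: "x \<in> B" using x by (simp add: B_def)
    consider "g x \<ge> 0" | "g x < 0" "p x > 0" | "p x \<le> 0" by linarith
    then show ?thesis
    proof cases
      case 1
      have "g x / G * (1 - g x / G) ^ n \<le> 1 / real n"
        using 1 G(1) G(2)[OF xB] k0 by (intro power_decay_bound) (auto simp: n_def)
      then have "s x * g x \<le> G / real n" using G(1) by (simp add: s_def field_simps)
      also have "\<dots> \<le> G / real k" using G(1) k0 by (intro divide_left_mono) (auto simp: n_def)
      also have "\<dots> < e" using k k0 e G by (simp add: field_simps)
      finally show ?thesis using e(2)[OF xB 1] by simp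
    next
      case 2
      have "s x \<ge> 0" by (simp add: s2)
      then have "s x * g x \<le> 0" using 2 by (simp add: mult_nonneg_nonpos)
      then show ?thesis using 2 by simp
    next
      case 3
      have gm: "g x \<le> - m" using m(2)[OF xB 3] .
      have "1 + real k * (m / G) \<le> (1 + m / G) ^ k" using m G by (intro Bernoulli_inequality) (simp add: order.trans[of _ 0])
      also have "\<dots> \<le> (1 + m / G) ^ n" using m G by (intro power_increasing) (auto simp: n_def)
      also have "\<dots> \<le> s x" unfolding s_def using m G gm by (intro power_mono) (auto simp: field_simps)
      finally have "real k * (m / G) < s x" by simp
      then have "real k * (m / G) * m < s x * (- g x)"
        using m gm G by (intro mult_less_le_imp_less) auto
      moreover have "P \<le> real k * (m / G) * m"
        using k m G by (simp add: field_simps power2_eq_square)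
      ultimately show ?thesis using P(2)[OF xB] by simp
    qed
  qed
  moreover have "real_polynomial_function (\<lambda>x. p x - s x * g x)"
    using p g sos_polynomial[OF sos] by auto
  ultimately have "(\<lambda>x. p x - s x * g x) \<in> quad_module g"
    using box_positive_in_module[OF g _ \<open>a > 0\<close> lin] by blast
  from quad_module_add[OF this mult[OF quad_module_sos[OF sos] quad_module_gen]]
  show ?thesis by simp
qed

section \<open>The flow of a polynomial vector field\<close>

lemma real_polynomial_function_lipschitz:
  fixes p :: "'a::euclidean_space \<Rightarrow> real"
  assumes "real_polynomial_function p"
  shows "\<exists>L\<ge>0. \<forall>x\<in>cball 0 R. \<forall>y\<in>cball 0 R. \<bar>p x - p y\<bar> \<le> L * norm (x - y)"
  using assms
proof (induction rule: real_polynomial_function.induct)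
  case (linear h)
  then obtain K where "\<And>x. norm (h x) \<le> norm x * K" "K \<ge> 0" using bounded_linear.nonneg_bounded by blast
  moreover have "h x - h y = h (x - y)" for x y using linear by (simp add: linear_diff bounded_linear.linear)
  ultimately show ?case by (intro exI[of _ K]) (simp add: mult.commute)
next
  case (const c)
  then show ?case by (intro exI[of _ 0]) simp
next
  case (add p q)
  then obtain L M where L: "L \<ge> 0" "\<And>x y. x \<in> cball 0 R \<Longrightarrow> y \<in> cball 0 R \<Longrightarrow> \<bar>p x - p y\<bar> \<le> L * norm (x - y)"
    and M: "M \<ge> 0" "\<And>x y. x \<in> cball 0 R \<Longrightarrow> y \<in> cball 0 R \<Longrightarrow> \<bar>q x - q y\<bar> \<le> M * norm (x - y)" by blast
  have "\<bar>(p x + q x) - (p y + q y)\<bar> \<le> (L + M) * norm (x - y)" if "x \<in> cball 0 R" "y \<in> cball 0 R" for x y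
    using L(2)[OF that] M(2)[OF that] by (simp add: distrib_right)
  then show ?case using L M by (intro exI[of _ "L + M"]) auto
next
  case (mult p q)
  then obtain L M where L: "L \<ge> 0" "\<And>x y. x \<in> cball 0 R \<Longrightarrow> y \<in> cball 0 R \<Longrightarrow> \<bar>p x - p y\<bar> \<le> L * norm (x - y)"
    and M: "M \<ge> 0" "\<And>x y. x \<in> cball 0 R \<Longrightarrow> y \<in> cball 0 R \<Longrightarrow> \<bar>q x - q y\<bar> \<le> M * norm (x - y)" by blast
  have bd: "\<exists>B>0. \<forall>x\<in>cball 0 R. \<bar>h x\<bar> \<le> B" if "real_polynomial_function h" for h :: "'a \<Rightarrow> real"
  proof -
    have "continuous_on (cball 0 R) h"
      using continuous_real_polymonial_function[OF that] by (simp add: continuous_at_imp_continuous_on)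
    then have "bounded (h ` cball 0 R)" by (intro compact_imp_bounded compact_continuous_image) auto
    then show ?thesis unfolding bounded_pos by auto
  qed
  obtain B where B: "B > 0" "\<And>x. x \<in> cball 0 R \<Longrightarrow> \<bar>p x\<bar> \<le> B" using bd[OF mult.hyps(1)] by blast
  obtain C where C: "C > 0" "\<And>x. x \<in> cball 0 R \<Longrightarrow> \<bar>q x\<bar> \<le> C" using bd[OF mult.hyps(2)] by blast
  have "\<bar>p x * q x - p y * q y\<bar> \<le> (B * M + C * L) * norm (x - y)" if xy: "x \<in> cball 0 R" "y \<in> cball 0 R" for x y
  proof -
    have "p x * q x - p y * q y = p x * (q x - q y) + q y * (p x - p y)" by (simp add: algebra_simps)
    then have "\<bar>p x * q x - p y * q y\<bar> \<le> \<bar>p x\<bar> * \<bar>q x - q y\<bar> + \<bar>q y\<bar> * \<bar>p x - p y\<bar>"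
      by (metis abs_mult abs_triangle_ineq)
    also have "\<dots> \<le> B * (M * norm (x - y)) + C * (L * norm (x - y))"
      using B(2)[OF xy(1)] C(2)[OF xy(2)] L(2)[OF xy] M(2)[OF xy] B(1) C(1)
      by (intro add_mono mult_mono) auto
    finally show ?thesis by (simp add: algebra_simps)
  qed
  then show ?case using L M B C by (intro exI[of _ "B * M + C * L"]) auto
qed

lemma polynomial_function_component: "polynomial_function f \<Longrightarrow> real_polynomial_function (\<lambda>x. f x $ i)"
  for f :: "'a::real_normed_vector \<Rightarrow> real ^ 'n"
  unfolding polynomial_function_def using bounded_linear_vec_nth[of i] by (auto simp: comp_def)

lemma polynomial_function_lipschitz:
  fixes f :: "real ^ 'n \<Rightarrow> real ^ 'm"
  assumes "polynomial_function f"
  shows "\<exists>L\<ge>0. \<forall>x\<in>cball 0 R. \<forall>y\<in>cball 0 R. norm (f x - f y) \<le> L * norm (x - y)"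
proof -
  have "\<exists>L\<ge>0. \<forall>x\<in>cball 0 R. \<forall>y\<in>cball 0 R. \<bar>f x $ i - f y $ i\<bar> \<le> L * norm (x - y)" for i
    using real_polynomial_function_lipschitz[OF polynomial_function_component[OF assms]] .
  then obtain L where L: "\<And>i. L i \<ge> 0"
    "\<And>i x y. x \<in> cball 0 R \<Longrightarrow> y \<in> cball 0 R \<Longrightarrow> \<bar>f x $ i - f y $ i\<bar> \<le> L i * norm (x - y)" by metis
  have "norm (f x - f y) \<le> (\<Sum>i\<in>UNIV. L i) * norm (x - y)" if "x \<in> cball 0 R" "y \<in> cball 0 R" for x y
  proof -
    have "norm (f x - f y) \<le> (\<Sum>i\<in>UNIV. \<bar>(f x - f y) $ i\<bar>)" by (rule norm_le_l1_cart)
    also have "\<dots> \<le> (\<Sum>i\<in>UNIV. L i * norm (x - y))" using L(2)[OF that] by (intro sum_mono) simp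
    finally show ?thesis by (simp add: sum_distrib_right)
  qed
  then show ?thesis using L(1) by (intro exI[of _ "\<Sum>i\<in>UNIV. L i"]) (auto intro: sum_nonneg)
qed

locale polynomial_flow =
  fixes f :: "real ^ 'n \<Rightarrow> real ^ 'n" and \<phi> :: "real ^ 'n \<Rightarrow> real \<Rightarrow> real ^ 'n"
  assumes poly: "polynomial_function f" and sol: "solution_map f \<phi>"
begin

lemma flow_0: "\<phi> x 0 = x"
  using sol by (simp add: solution_map_def)

lemma flow_flow: "0 \<le> s \<Longrightarrow> 0 \<le> t \<Longrightarrow> \<phi> (\<phi> x t) s = \<phi> x (t + s)"
  using sol by (simp add: solution_map_def)

lemma flow_deriv: "0 \<le> t \<Longrightarrow> (\<phi> x has_vector_derivative f (\<phi> x t)) (at t within {0..})"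
  using sol by (simp add: solution_map_def)

lemma flow_deriv_at: "0 < t \<Longrightarrow> (\<phi> x has_vector_derivative f (\<phi> x t)) (at t)"
  using flow_deriv[of t x] at_within_open_subset[of t "{0<..}" "{0..}"] by (simp add: subset_eq)

lemma flow_continuous: "continuous_on {0..} (\<phi> x)"
  using flow_deriv by (intro continuous_on_vector_derivative) auto

lemma flow_continuous_on: "S \<subseteq> {0..} \<Longrightarrow> continuous_on S (\<phi> x)"
  using flow_continuous continuous_on_subset by blast

text \<open>The squared distance times \<open>exp (- 2 L s)\<close> is nonincreasing. Both
  trajectories are assumed to stay in one ball, as a polynomial field is only locally
  Lipschitz.\<close>

lemma flow_gronwall:
  assumes L: "L \<ge> 0" "\<And>u v. u \<in> cball 0 R \<Longrightarrow> v \<in> cball 0 R \<Longrightarrow> norm (f u - f v) \<le> L * norm (u - v)"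
    and bx: "\<And>s. 0 \<le> s \<Longrightarrow> s \<le> t \<Longrightarrow> norm (\<phi> x s) \<le> R" and by': "\<And>s. 0 \<le> s \<Longrightarrow> s \<le> t \<Longrightarrow> norm (\<phi> y s) \<le> R"
    and t: "0 \<le> t"
  shows "norm (\<phi> x t - \<phi> y t) \<le> exp (L * t) * norm (x - y)"
proof -
  define w where "w s = \<phi> x s - \<phi> y s" for s
  define u where "u s = (w s \<bullet> w s) * exp (- (2 * L) * s)" for s
  have "u t \<le> u 0"
  proof (rule DERIV_nonpos_imp_decreasing_open[OF t])
    show "continuous_on {0..t} u"
      unfolding u_def w_def by (intro continuous_intros flow_continuous_on) auto
    fix s assume s: "0 < s" "s < t"
    define w' where "w' = f (\<phi> x s) - f (\<phi> y s)"
    have "(w has_vector_derivative w') (at s)"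
      unfolding w_def w'_def by (intro has_vector_derivative_diff flow_deriv_at s)
    then have "(w has_derivative (\<lambda>h. h *\<^sub>R w')) (at s)" by (simp add: has_vector_derivative_def)
    then have "((\<lambda>s. w s \<bullet> w s) has_derivative (\<lambda>h. w s \<bullet> (h *\<^sub>R w') + (h *\<^sub>R w') \<bullet> w s)) (at s)"
      by (intro has_derivative_inner)
    then have d1: "((\<lambda>s. w s \<bullet> w s) has_real_derivative (2 * (w s \<bullet> w'))) (at s)"
      unfolding has_field_derivative_def by (rule has_derivative_eq_rhs) (auto simp: inner_commute fun_eq_iff)
    have "(u has_real_derivative (2 * (w s \<bullet> w')) * exp (- (2 * L) * s) + (w s \<bullet> w s) * (exp (- (2 * L) * s) * (- (2 * L)))) (at s)"
      unfolding u_def by (rule DERIV_mult'[THEN DERIV_cong]) (rule d1 derivative_eq_intros refl | simp)+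
    moreover have "(2 * (w s \<bullet> w')) * exp (- (2 * L) * s) + (w s \<bullet> w s) * (exp (- (2 * L) * s) * (- (2 * L))) \<le> 0"
    proof -
      have "w s \<bullet> w' \<le> norm (w s) * norm w'" by (rule norm_cauchy_schwarz)
      also have "\<dots> \<le> norm (w s) * (L * norm (w s))"
        unfolding w'_def w_def using s bx by' by (intro mult_left_mono L(2)) auto
      also have "\<dots> = L * (w s \<bullet> w s)" by (simp add: dot_square_norm power2_eq_square)
      finally have "(2 * (w s \<bullet> w')) * exp (- (2 * L) * s) \<le> (2 * (L * (w s \<bullet> w s))) * exp (- (2 * L) * s)"
        by (intro mult_right_mono) auto
      then show ?thesis by (simp add: algebra_simps)
    qed
    ultimately show "\<exists>z. DERIV u s :> z \<and> z \<le> 0" by blast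
  qed
  then have "(norm (w t))\<^sup>2 * exp (- (2 * L) * t) \<le> (norm (w 0))\<^sup>2"
    by (simp add: u_def dot_square_norm)
  then have "(norm (w t))\<^sup>2 \<le> (norm (w 0))\<^sup>2 * exp (2 * L * t)"
    by (simp add: exp_minus field_simps)
  also have "\<dots> = (exp (L * t) * norm (w 0))\<^sup>2"
    by (simp add: power_mult_distrib exp_double[symmetric] mult.assoc mult.commute)
  finally have "norm (w t) \<le> exp (L * t) * norm (w 0)"
    by (rule power2_le_imp_le) simp
  then show ?thesis by (simp add: w_def flow_0)
qed

lemma flow_bounded: "\<exists>B. \<forall>t\<in>{0..T}. norm (\<phi> x t) \<le> B"
proof -
  have "bounded (\<phi> x ` {0..T})"
    by (intro compact_imp_bounded compact_continuous_image flow_continuous_on) auto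
  then show ?thesis unfolding bounded_iff by auto
qed

text \<open>Nothing bounds the neighbouring trajectory a priori. Until the first time \<tau> at
  which the distance equals \<open>e\<close> it stays within \<open>B + e\<close>, so Gronwall's
  estimate applies and gives a distance below \<open>e\<close> at \<tau>, a contradiction.\<close>

lemma flow_continuous_initial:
  assumes e: "e > 0"
  shows "\<exists>d>0. \<forall>y. norm (y - x) < d \<longrightarrow> (\<forall>t\<in>{0..T}. norm (\<phi> y t - \<phi> x t) < e)"
proof -
  obtain B where B: "\<And>t. t \<in> {0..T} \<Longrightarrow> norm (\<phi> x t) \<le> B" using flow_bounded by blast
  obtain L where L: "L \<ge> 0" "\<And>u v. u \<in> cball 0 (B + e) \<Longrightarrow> v \<in> cball 0 (B + e) \<Longrightarrow> norm (f u - f v) \<le> L * norm (u - v)"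
    using polynomial_function_lipschitz[OF poly] by blast
  \<comment> \<open>The inverse of the largest Gronwall factor on the interval;
    \<open>\<bar>T\<bar>\<close> covers negative \<open>T\<close>, for which the interval is
    empty.\<close>
  define d where "d = e * exp (- (L * \<bar>T\<bar>))"
  have d: "d > 0" "d \<le> e" using e L by (auto simp: d_def)
  have "norm (\<phi> y t - \<phi> x t) < e" if y: "norm (y - x) < d" and t: "t \<in> {0..T}" for y t
  proof (rule ccontr)
    define D where "D s = norm (\<phi> y s - \<phi> x s)" for s
    assume "\<not> norm (\<phi> y t - \<phi> x t) < e"
    then have Dt: "e \<le> D t" by (simp add: D_def)
    have D0: "D 0 < e" using y d by (simp add: D_def flow_0)
    have contD: "continuous_on {0..s} D" for s
      unfolding D_def by (intro continuous_intros flow_continuous_on) auto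
    define S where "S = {0..t} \<inter> D -` {e}"
    have "closed S" unfolding S_def by (intro continuous_closed_preimage contD) auto
    then have "compact S" unfolding S_def by (metis bounded_Int bounded_closed_interval compact_eq_bounded_closed)
    moreover have "S \<noteq> {}"
      using IVT'[of D 0 e t] D0 Dt t contD by (auto simp: S_def)
    ultimately have "\<exists>\<tau>\<in>S. \<forall>s\<in>S. \<tau> \<le> s" by (rule compact_attains_inf)
    then obtain \<tau> where \<tau>: "\<tau> \<in> S" "\<And>s. s \<in> S \<Longrightarrow> \<tau> \<le> s" by blast
    have le: "D s \<le> e" if s: "0 \<le> s" "s \<le> \<tau>" for s
    proof (rule ccontr)
      assume "\<not> D s \<le> e"
      then obtain r where "0 \<le> r" "r \<le> s" "D r = e"
        using IVT'[of D 0 e s] D0 s contD by auto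
      then have "r \<in> S" using s \<tau>(1) by (auto simp: S_def)
      then have "r = s" using \<tau>(2)[of r] s \<open>r \<le> s\<close> by simp
      then show False using \<open>D r = e\<close> \<open>\<not> D s \<le> e\<close> by simp
    qed
    have T: "\<tau> \<le> T" "0 \<le> \<tau>" using \<tau>(1) t by (auto simp: S_def)
    have "norm (\<phi> y \<tau> - \<phi> x \<tau>) \<le> exp (L * \<tau>) * norm (y - x)"
    proof (rule flow_gronwall[OF L])
      fix s assume s: "0 \<le> s" "s \<le> \<tau>"
      have "norm (\<phi> x s) \<le> B" using B[of s] s T by simp
      moreover have "norm (\<phi> y s) \<le> norm (\<phi> x s) + D s"
        unfolding D_def by (metis add.commute norm_triangle_sub)
      ultimately show "norm (\<phi> y s) \<le> B + e" "norm (\<phi> x s) \<le> B + e" using le[OF s] e by auto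
    qed (use T in auto)
    also have "\<dots> \<le> exp (L * \<bar>T\<bar>) * norm (y - x)"
      using T L by (intro mult_right_mono) (auto intro!: mult_left_mono)
    also have "\<dots> < exp (L * \<bar>T\<bar>) * d" using y by simp
    also have "\<dots> = e" by (simp add: d_def exp_minus)
    finally show False using \<tau>(1) by (simp add: S_def D_def)
  qed
  then show ?thesis using d by blast
qed

end

section \<open>Uniform attraction and a converse Lyapunov function\<close>

lemma attractor_setD:
  assumes "attractor_set \<phi> A"
  shows "compact A" "A \<noteq> {}" "x \<in> A \<Longrightarrow> 0 \<le> t \<Longrightarrow> \<phi> x t \<in> A"
    "x \<in> A \<Longrightarrow> \<exists>\<delta>>0. \<forall>\<epsilon>>0. \<exists>T\<ge>0. \<forall>y\<in>ball x \<delta>. \<forall>t\<ge>T. infdist (\<phi> y t) A < \<epsilon>"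
    "0 < \<epsilon> \<Longrightarrow> \<exists>\<delta>>0. \<forall>x\<in>nhd A \<delta>. \<forall>t\<ge>0. infdist (\<phi> x t) A < \<epsilon>"
  using assms by (simp_all add: attractor_set_def)

lemma infdist_less_nhd:
  assumes "A \<noteq> {}" "infdist x A < e"
  shows "x \<in> nhd A e"
proof -
  have "(INF a\<in>A. dist x a) < e" using assms by (simp add: infdist_def)
  then obtain a where "a \<in> A" "dist x a < e"
    using assms(1) cINF_less_iff[of A "dist x" e] by (auto intro: bdd_belowI2[of _ 0])
  then show ?thesis by (auto simp: nhd_def dist_commute)
qed

context polynomial_flow begin

text \<open>Each point of \<open>K\<close> enters the neighbourhood in which stability keeps
  trajectories close to \<open>A\<close>; by continuity in the initial value a ball around it enters
  at the same time, and finitely many balls suffice. The margin \<eta> around \<open>K\<close> is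
  there because convolution samples the Lyapunov function off \<open>K\<close>.\<close>

lemma uniform_attraction:
  assumes A: "attractor_set \<phi> A" and K: "compact K" "K \<subseteq> basin_of_attraction \<phi> A" and r: "r > 0"
  shows "\<exists>\<eta>>0. \<exists>T\<ge>0. \<exists>R. \<forall>x\<in>K. \<forall>y\<in>ball x \<eta>. (\<forall>t\<ge>T. infdist (\<phi> y t) A < r) \<and> (\<forall>t\<ge>0. norm (\<phi> y t) \<le> R)"
proof -
  have Ane: "A \<noteq> {}" and cA: "compact A" using A by (auto simp: attractor_set_def)
  obtain \<delta> where \<delta>: "\<delta> > 0" "\<And>z t. z \<in> nhd A \<delta> \<Longrightarrow> t \<ge> 0 \<Longrightarrow> infdist (\<phi> z t) A < r"
    using attractor_setD(5)[OF A r] by blast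
  obtain RA where RA: "\<And>z. z \<in> A \<Longrightarrow> norm z \<le> RA" using compact_imp_bounded[OF cA] unfolding bounded_iff by blast
  have near: "norm z \<le> RA + r" if z: "infdist z A < r" for z
  proof -
    obtain a where "a \<in> A" "dist a z < r" using infdist_less_nhd[OF Ane z] by (auto simp: nhd_def)
    then show ?thesis using RA[of a] norm_triangle_ineq2[of z a] by (simp add: dist_norm norm_minus_commute)
  qed
  have "\<exists>d T R. d > 0 \<and> T \<ge> 0 \<and> (\<forall>y\<in>ball x d. (\<forall>t\<ge>T. infdist (\<phi> y t) A < r) \<and> (\<forall>t\<ge>0. norm (\<phi> y t) \<le> R))"
    if "x \<in> K" for x
  proof -
    have "((\<lambda>t. infdist (\<phi> x t) A) \<longlongrightarrow> 0) at_top" using K \<open>x \<in> K\<close> by (auto simp: basin_of_attraction_def)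
    then have "eventually (\<lambda>t. dist (infdist (\<phi> x t) A) 0 < \<delta> / 2) at_top" by (rule tendstoD) (use \<delta> in simp)
    then obtain N where N: "\<And>t. t \<ge> N \<Longrightarrow> dist (infdist (\<phi> x t) A) 0 < \<delta> / 2"
      unfolding eventually_at_top_linorder by blast
    define T where "T = max N 0"
    have T: "T \<ge> 0" "infdist (\<phi> x T) A < \<delta> / 2" using N[of T] by (auto simp: T_def)
    obtain d where d: "d > 0" "\<And>y t. norm (y - x) < d \<Longrightarrow> t \<in> {0..T} \<Longrightarrow> norm (\<phi> y t - \<phi> x t) < \<delta> / 2"
      using flow_continuous_initial[of "\<delta> / 2" x T] \<delta>(1) by auto
    obtain B where B: "\<And>t. t \<in> {0..T} \<Longrightarrow> norm (\<phi> x t) \<le> B" using flow_bounded by blast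
    have "(\<forall>t\<ge>T. infdist (\<phi> y t) A < r) \<and> (\<forall>t\<ge>0. norm (\<phi> y t) \<le> max (B + \<delta>) (RA + r))" if y: "y \<in> ball x d" for y
    proof -
      have yd: "norm (y - x) < d" using y by (simp add: dist_norm norm_minus_commute)
      have "infdist (\<phi> y T) A \<le> infdist (\<phi> x T) A + dist (\<phi> y T) (\<phi> x T)" by (rule infdist_triangle)
      also have "\<dots> < \<delta>" using T d(2)[OF yd, of T] by (simp add: dist_norm)
      finally have n: "\<phi> y T \<in> nhd A \<delta>" by (rule infdist_less_nhd[OF Ane])
      have far: "infdist (\<phi> y t) A < r" if "t \<ge> T" for t
        using \<delta>(2)[OF n, of "t - T"] flow_flow[of "t - T" T y] T that by simp
      have "norm (\<phi> y t) \<le> max (B + \<delta>) (RA + r)" if "t \<ge> 0" for t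
      proof (cases "t \<le> T")
        case True
        have "norm (\<phi> y t) \<le> norm (\<phi> x t) + norm (\<phi> y t - \<phi> x t)"
          by (metis add.commute norm_triangle_sub)
        also have "\<dots> \<le> B + \<delta>" using B[of t] d(2)[OF yd, of t] True that \<delta>(1) by auto
        finally show ?thesis by simp
      next
        case False
        then show ?thesis using near[OF far[of t]] by simp
      qed
      then show ?thesis using far by blast
    qed
    then show ?thesis using d(1) T(1) by blast
  qed
  then obtain d T R where dTR: "\<And>x. x \<in> K \<Longrightarrow> d x > 0 \<and> T x \<ge> (0::real)"
    "\<And>x y t. x \<in> K \<Longrightarrow> y \<in> ball x (d x) \<Longrightarrow> t \<ge> T x \<Longrightarrow> infdist (\<phi> y t) A < r"
    "\<And>x y t. x \<in> K \<Longrightarrow> y \<in> ball x (d x) \<Longrightarrow> t \<ge> 0 \<Longrightarrow> norm (\<phi> y t) \<le> R x"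
    by metis
  have "K \<subseteq> (\<Union>x\<in>K. ball x (d x))" using dTR(1) by force
  then obtain C where C: "C \<subseteq> K" "finite C" "K \<subseteq> (\<Union>x\<in>C. ball x (d x))"
    using compactE_image[OF K(1), of K "\<lambda>x. ball x (d x)"] by auto
  have op: "open (\<Union>x\<in>C. ball x (d x))" by auto
  obtain \<eta> where \<eta>: "\<eta> > 0" "(\<Union>x\<in>K. ball x \<eta>) \<subseteq> (\<Union>x\<in>C. ball x (d x))"
    by (rule compact_subset_open_imp_ball_epsilon_subset[OF K(1) op C(3)])
  define T' where "T' = Max (insert 0 (T ` C))"
  define R' where "R' = Max (insert 0 (R ` C))"
  have "(\<forall>t\<ge>T'. infdist (\<phi> y t) A < r) \<and> (\<forall>t\<ge>0. norm (\<phi> y t) \<le> R')" if xy: "x \<in> K" "y \<in> ball x \<eta>" for x y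
  proof -
    have "y \<in> (\<Union>x\<in>C. ball x (d x))" using \<eta>(2) xy by blast
    then obtain z where z: "z \<in> C" "y \<in> ball z (d z)" by blast
    have "T z \<le> T'" "R z \<le> R'" using z C(2) by (auto simp: T'_def R'_def)
    moreover have "z \<in> K" using z C(1) by blast
    ultimately show ?thesis
      using dTR(2)[OF \<open>z \<in> K\<close> z(2)] dTR(3)[OF \<open>z \<in> K\<close> z(2)] order.trans by metis
  qed
  moreover have "T' \<ge> 0" using C(2) by (simp add: T'_def)
  ultimately show ?thesis using \<eta>(1) by blast
qed

text \<open>The function \<open>V\<close> is the supremum over \<open>t\<close> of \<open>exp (2 t) max 0 (D(\<phi> x t, A) - r)\<close>; only times up to the
  uniform attraction time contribute, so it is Lipschitz near \<open>K\<close>, and it is then extended to the whole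
  space by McShane's formula, truncated at \<open>0\<close> to keep the support bounded.\<close>

lemma converse_lyapunov:
  assumes A: "attractor_set \<phi> A" and K: "compact K" "K \<noteq> {}" "K \<subseteq> basin_of_attraction \<phi> A" and r: "r > 0"
  shows "\<exists>V L \<eta> \<rho> R. L > 0 \<and> \<eta> > 0 \<and> (\<forall>x y. \<bar>V x - V y\<bar> \<le> L * norm (x - y)) \<and> (\<forall>x. V x \<ge> (0::real)) \<and>
    (\<forall>x. norm x > \<rho> \<longrightarrow> V x = 0) \<and> (\<forall>x\<in>K. infdist x A - r \<le> V x) \<and>
    (\<forall>x\<in>K. \<forall>y\<in>ball x \<eta>. \<forall>t\<ge>0. norm (\<phi> y t) \<le> R) \<and>
    (\<forall>x\<in>K. \<forall>y\<in>ball x \<eta>. \<forall>h\<in>{0..\<eta>}. V (\<phi> y h) \<le> exp (- 2 * h) * V y)"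
proof -
  have Ane: "A \<noteq> {}" using A by (auto simp: attractor_set_def)
  obtain \<eta> T R where \<eta>: "\<eta> > 0" and T: "T \<ge> 0"
    and att: "\<And>x y t. x \<in> K \<Longrightarrow> y \<in> ball x \<eta> \<Longrightarrow> t \<ge> T \<Longrightarrow> infdist (\<phi> y t) A < r"
    and bd: "\<And>x y t. x \<in> K \<Longrightarrow> y \<in> ball x \<eta> \<Longrightarrow> t \<ge> 0 \<Longrightarrow> norm (\<phi> y t) \<le> R"
    using uniform_attraction[OF A K(1,3) r] by blast
  define W where "W = (\<Union>x\<in>K. ball x \<eta>)"
  have attW: "infdist (\<phi> y t) A < r" if "y \<in> W" "t \<ge> T" for y t using that att by (auto simp: W_def)
  have bdW: "norm (\<phi> y t) \<le> R" if "y \<in> W" "t \<ge> 0" for y t using that bd unfolding W_def by blast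
  obtain x0 where "x0 \<in> K" using K(2) by blast
  then have x0: "x0 \<in> W" using \<eta> by (auto simp: W_def intro!: bexI[of _ x0])
  obtain L0 where L0: "L0 \<ge> 0" "\<And>u v. u \<in> cball 0 R \<Longrightarrow> v \<in> cball 0 R \<Longrightarrow> norm (f u - f v) \<le> L0 * norm (u - v)"
    using polynomial_function_lipschitz[OF poly] by blast
  obtain a where a: "a \<in> A" using Ane by blast
  define \<theta> where "\<theta> z = max 0 (infdist z A - r)" for z
  have \<theta>0: "\<theta> z \<ge> 0" for z by (simp add: \<theta>_def)
  have \<theta>lip: "\<bar>\<theta> u - \<theta> v\<bar> \<le> norm (u - v)" for u v
    using infdist_triangle_abs[of u A v] unfolding \<theta>_def dist_norm by linarith
  define b where "b = exp (2 * T) * (R + norm a)"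
  define E where "E x t = exp (2 * t) * \<theta> (\<phi> x t)" for x t
  have E0: "E x t \<ge> 0" for x t using \<theta>0 by (simp add: E_def)
  have Eb: "E x t \<le> b" if "x \<in> W" "t \<in> {0..T}" for x t
  proof -
    have "\<theta> (\<phi> x t) \<le> infdist (\<phi> x t) A" using r infdist_nonneg[of "\<phi> x t" A] by (auto simp: \<theta>_def)
    also have "\<dots> \<le> norm (\<phi> x t - a)" using infdist_le[OF a] by (simp add: dist_norm)
    also have "\<dots> \<le> R + norm a" using bdW[OF that(1), of t] norm_triangle_ineq4[of "\<phi> x t" a] that by simp
    finally show ?thesis unfolding E_def b_def using that \<theta>0 by (intro mult_mono) auto
  qed
  define V0 where "V0 x = (SUP t\<in>{0..T}. E x t)" for x
  have bdd: "bdd_above (E x ` {0..T})" if "x \<in> W" for x using Eb[OF that] by (intro bdd_aboveI2[of _ _ b])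
  have V0_upper: "E x t \<le> V0 x" if "x \<in> W" "t \<ge> 0" for x t
  proof (cases "t \<le> T")
    case True
    then show ?thesis unfolding V0_def using that by (intro cSUP_upper bdd) auto
  next
    case False
    then have "E x t = 0" using attW[OF that(1), of t] by (simp add: E_def \<theta>_def)
    also have "0 \<le> E x 0" by (rule E0)
    also have "\<dots> \<le> V0 x" unfolding V0_def using that T by (intro cSUP_upper bdd) auto
    finally show ?thesis .
  qed
  have V0_least: "V0 x \<le> c" if "\<And>t. t \<in> {0..T} \<Longrightarrow> E x t \<le> c" for x c
    unfolding V0_def using that T by (intro cSUP_least) auto
  have V0b: "V0 x \<le> b" if "x \<in> W" for x using Eb[OF that] by (rule V0_least)
  have V0nn: "V0 x \<ge> 0" if "x \<in> W" for x using V0_upper[OF that, of 0] E0[of x 0] by simp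
  \<comment> \<open>The largest weight \<open>exp (2 * T)\<close> times the largest Gronwall factor
    up to time \<open>T\<close>.\<close>
  define L where "L = exp (2 * T) * exp (L0 * T)"
  have L: "L > 0" by (simp add: L_def)
  have V0_lip: "V0 x \<le> V0 y + L * norm (x - y)" if "x \<in> W" "y \<in> W" for x y
  proof (rule V0_least)
    fix t assume t: "t \<in> {0..T}"
    have "norm (\<phi> x t - \<phi> y t) \<le> exp (L0 * t) * norm (x - y)"
      by (rule flow_gronwall[OF L0]) (use bdW that t in auto)
    also have "\<dots> \<le> exp (L0 * T) * norm (x - y)"
      using t L0 by (intro mult_right_mono) (auto intro!: mult_left_mono)
    finally have d: "norm (\<phi> x t - \<phi> y t) \<le> exp (L0 * T) * norm (x - y)" .
    have "E x t - E y t = exp (2 * t) * (\<theta> (\<phi> x t) - \<theta> (\<phi> y t))" by (simp add: E_def algebra_simps)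
    also have "\<dots> \<le> exp (2 * t) * norm (\<phi> x t - \<phi> y t)"
      using \<theta>lip[of "\<phi> x t" "\<phi> y t"] by (intro mult_left_mono) auto
    also have "\<dots> \<le> exp (2 * T) * (exp (L0 * T) * norm (x - y))"
      using t d by (intro mult_mono) auto
    finally have "E x t \<le> E y t + L * norm (x - y)" by (simp add: L_def)
    then show "E x t \<le> V0 y + L * norm (x - y)" using V0_upper[OF that(2), of t] t by simp
  qed
  have V0_decr: "V0 (\<phi> x h) \<le> exp (- 2 * h) * V0 x" if x: "x \<in> W" and h: "h \<ge> 0" and "\<phi> x h \<in> W" for x h
  proof (rule V0_least)
    fix t assume t: "t \<in> {0..T}"
    \<comment> \<open>Shifting time by \<open>h\<close> turns the weight into the factor
      \<open>exp (- 2 * h)\<close>. The shifted time may exceed \<open>T\<close>, which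
      \<open>V0_upper\<close> permits.\<close>
    have "E (\<phi> x h) t = exp (- 2 * h) * E x (h + t)"
      using flow_flow[of t h x] t h by (simp add: E_def exp_add[symmetric] mult.assoc[symmetric])
    also have "\<dots> \<le> exp (- 2 * h) * V0 x" using V0_upper[OF x, of "h + t"] h t by (intro mult_left_mono) auto
    finally show "E (\<phi> x h) t \<le> exp (- 2 * h) * V0 x" .
  qed
  define V where "V z = max 0 (SUP w\<in>W. V0 w - L * norm (z - w))" for z
  have bddV: "bdd_above ((\<lambda>w. V0 w - L * norm (z - w)) ` W)" for z
  proof (rule bdd_aboveI2)
    fix w assume "w \<in> W"
    moreover have "0 \<le> L * norm (z - w)" using L by simp
    ultimately show "V0 w - L * norm (z - w) \<le> b" using V0b[of w] by linarith
  qed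
  have V_eq: "V z = V0 z" if z: "z \<in> W" for z
  proof -
    have "(SUP w\<in>W. V0 w - L * norm (z - w)) = V0 z"
    proof (rule antisym)
      show "(SUP w\<in>W. V0 w - L * norm (z - w)) \<le> V0 z"
        using V0_lip[OF _ z] x0 by (intro cSUP_least) (auto simp: norm_minus_commute algebra_simps)
      show "V0 z \<le> (SUP w\<in>W. V0 w - L * norm (z - w))"
        using cSUP_upper[OF z bddV[of z]] by simp
    qed
    then show ?thesis using V0nn[OF z] by (simp add: V_def)
  qed
  have V_lip1: "V x \<le> V y + L * norm (x - y)" for x y
  proof -
    have "(SUP w\<in>W. V0 w - L * norm (x - w)) \<le> (SUP w\<in>W. V0 w - L * norm (y - w)) + L * norm (x - y)"
    proof (rule cSUP_least)
      fix w assume w: "w \<in> W"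
      have "L * norm (y - w) \<le> L * (norm (y - x) + norm (x - w))"
        using L norm_triangle_ineq[of "y - x" "x - w"] by (intro mult_left_mono) auto
      then have "V0 w - L * norm (x - w) \<le> (V0 w - L * norm (y - w)) + L * norm (x - y)"
        by (simp add: algebra_simps norm_minus_commute)
      also have "V0 w - L * norm (y - w) \<le> (SUP w\<in>W. V0 w - L * norm (y - w))"
        by (rule cSUP_upper[OF w bddV])
      finally show "V0 w - L * norm (x - w) \<le> (SUP w\<in>W. V0 w - L * norm (y - w)) + L * norm (x - y)" by simp
    qed (use x0 in blast)
    moreover have "L * norm (x - y) \<ge> 0" using L by simp
    ultimately show ?thesis by (simp add: V_def max_def)
  qed
  have V_lip: "\<bar>V x - V y\<bar> \<le> L * norm (x - y)" for x y
    using V_lip1[of x y] V_lip1[of y x] by (simp add: abs_le_iff norm_minus_commute)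
  \<comment> \<open>At distance \<open>b / L\<close> from \<open>W\<close>, a cone of slope
    \<open>L\<close> and height at most \<open>b\<close> has fallen to 0.\<close>
  define \<rho> where "\<rho> = R + b / L"
  have V_supp: "V z = 0" if z: "norm z > \<rho>" for z
  proof -
    have "(SUP w\<in>W. V0 w - L * norm (z - w)) \<le> 0"
    proof (rule cSUP_least)
      fix w assume w: "w \<in> W"
      have "norm w \<le> R" using bdW[OF w, of 0] by (simp add: flow_0)
      then have "b / L \<le> norm (z - w)" using z norm_triangle_ineq2[of z w] by (simp add: \<rho>_def)
      then have "b \<le> L * norm (z - w)" using L by (simp add: pos_divide_le_eq mult.commute)
      then show "V0 w - L * norm (z - w) \<le> 0" using V0b[OF w] by simp
    qed (use x0 in blast)
    then show ?thesis by (simp add: V_def)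
  qed
  have KW: "x \<in> W" if "x \<in> K" for x using that \<eta> by (auto simp: W_def intro!: bexI[of _ x])
  have V_low: "infdist x A - r \<le> V x" if "x \<in> K" for x
    using V0_upper[OF KW[OF that], of 0] V_eq[OF KW[OF that]] by (simp add: E_def \<theta>_def flow_0)
  obtain M where M: "M > 0" "\<And>u. u \<in> cball 0 R \<Longrightarrow> norm (f u) \<le> M"
  proof -
    have "continuous_on (cball 0 R) f" using continuous_on_polymonial_function[OF poly] .
    then have "bounded (f ` cball 0 R)" by (intro compact_imp_bounded compact_continuous_image) auto
    then show ?thesis using that unfolding bounded_pos by auto
  qed
  \<comment> \<open>At speed at most \<open>M\<close> the flow moves at most
    \<open>\<eta> / 2\<close> in this time; with a start within \<open>\<eta> / 2\<close> of
    \<open>K\<close> it remains in \<open>W\<close>.\<close>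
  define \<eta>' where "\<eta>' = min (\<eta> / 2) (\<eta> / (2 * M))"
  have \<eta>': "\<eta>' > 0" using \<eta> M by (simp add: \<eta>'_def)
  have "V (\<phi> y h) \<le> exp (- 2 * h) * V y" if x: "x \<in> K" and y: "y \<in> ball x \<eta>'" and h: "h \<in> {0..\<eta>'}" for x y h
  proof -
    have y2: "y \<in> ball x \<eta>" using y \<eta> by (auto simp: \<eta>'_def)
    then have yW: "y \<in> W" using x unfolding W_def by (rule UN_I[rotated])
    have "norm (\<phi> y h - \<phi> y 0) \<le> M * norm (h - 0)"
    proof (rule differentiable_bound[of "{0..h}" "\<phi> y" "\<lambda>t k. k *\<^sub>R f (\<phi> y t)"])
      fix t assume t: "t \<in> {0..h}"
      have "(\<phi> y has_derivative (\<lambda>k. k *\<^sub>R f (\<phi> y t))) (at t within {0..})"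
        using flow_deriv[of t y] t by (simp add: has_vector_derivative_def)
      then show "(\<phi> y has_derivative (\<lambda>k. k *\<^sub>R f (\<phi> y t))) (at t within {0..h})"
        by (rule has_derivative_subset) simp
      have "norm (f (\<phi> y t)) \<le> M" using M(2) bdW[OF yW, of t] t by simp
      then show "onorm (\<lambda>k. k *\<^sub>R f (\<phi> y t)) \<le> M"
        by (intro onorm_le) (simp add: mult.commute[of _ "norm (f (\<phi> y t))"] mult_right_mono)
    qed (use h in auto)
    also have "\<dots> \<le> \<eta> / 2"
    proof -
      have "h \<le> \<eta> / (2 * M)" using h by (simp add: \<eta>'_def)
      then show ?thesis using h M by (simp add: field_simps)
    qed
    finally have "norm (\<phi> y h - y) \<le> \<eta> / 2" by (simp add: flow_0)
    moreover have "dist x y < \<eta> / 2" using y by (simp add: \<eta>'_def)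
    ultimately have "dist x (\<phi> y h) < \<eta>"
      using dist_triangle[of x "\<phi> y h" y] by (simp add: dist_norm norm_minus_commute)
    then have "\<phi> y h \<in> ball x \<eta>" by simp
    then have W': "\<phi> y h \<in> W" using x unfolding W_def by (rule UN_I[rotated])
    show ?thesis using V0_decr[OF yW _ W'] h V_eq[OF yW] V_eq[OF W'] by simp
  qed
  moreover have "norm (\<phi> y t) \<le> R" if x: "x \<in> K" and y: "y \<in> ball x \<eta>'" and t: "t \<ge> 0" for x y t
  proof -
    have "y \<in> ball x \<eta>" using y \<eta> by (auto simp: \<eta>'_def)
    then show ?thesis using bd x t by blast
  qed
  moreover have "V x \<ge> 0" for x by (simp add: V_def)
  ultimately show ?thesis
    using L \<eta>' V_lip V_supp V_low
    by (intro exI[of _ V] exI[of _ L] exI[of _ \<eta>'] exI[of _ \<rho>] exI[of _ R]) simp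
qed

end

section \<open>Polynomial kernels\<close>

lemma set_integrable_compact:
  fixes f :: "'a::euclidean_space \<Rightarrow> real"
  shows "compact S \<Longrightarrow> continuous_on S f \<Longrightarrow> set_integrable lborel S f"
  unfolding set_integrable_def by (rule borel_integrable_compact)

lemma continuous_on_polynomial: "real_polynomial_function p \<Longrightarrow> continuous_on S p"
  using continuous_real_polymonial_function continuous_at_imp_continuous_on by blast

text \<open>The Landau kernel, a normalized power of \<open>1 - |z|^2 / R^2\<close>. The bounded
  quantity is the first moment because that is the error of averaging a Lipschitz function.\<close>

lemma polynomial_kernel:
  assumes R: "R > 0" and e: "e > 0"
  shows "\<exists>\<kappa> :: real ^ 'n \<Rightarrow> real. real_polynomial_function \<kappa> \<and> (\<forall>z\<in>cball 0 R. 0 \<le> \<kappa> z) \<and>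
    (LINT z:cball 0 R|lborel. \<kappa> z) = 1 \<and> (LINT z:cball 0 R|lborel. norm z * \<kappa> z) \<le> e"
proof -
  define d where "d = min e R"
  have d: "d > 0" "d \<le> e" "d \<le> R" using R e by (auto simp: d_def)
  define a where "a = 1 - (d / 2)\<^sup>2 / R\<^sup>2"
  define b where "b = 1 - (d / 4)\<^sup>2 / R\<^sup>2"
  have "(d / 2)\<^sup>2 \<le> R\<^sup>2" "(d / 4)\<^sup>2 < (d / 2)\<^sup>2" "(d / 4)\<^sup>2 < R\<^sup>2" using d R by (auto intro!: power_mono power_strict_mono)
  then have ab: "0 \<le> a" "a < b" "0 < b" using R by (auto simp: a_def b_def divide_strict_right_mono)
  define vR where "vR = measure lborel (cball (0 :: real ^ 'n) R)"
  define vd where "vd = measure lborel (cball (0 :: real ^ 'n) (d / 4))"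
  have vd: "vd > 0" using d by (simp add: vd_def content_cball_pos)
  have vR: "vR \<ge> 0" by (simp add: vR_def)
  \<comment> \<open>The base is at most \<open>a\<close> for \<open>|z| \<ge> d / 2\<close> and at
    least \<open>b > a\<close> for \<open>|z| \<le> d / 4\<close>. For large \<open>k\<close> the
    outer part of the first moment is therefore below \<open>d / 2\<close> times the total
    mass.\<close>
  have "(\<lambda>k. R * vR * (a / b) ^ k) \<longlonglongrightarrow> R * vR * 0"
    using ab by (intro tendsto_mult tendsto_const LIMSEQ_realpow_zero) auto
  then have "eventually (\<lambda>k. R * vR * (a / b) ^ k < d / 2 * vd) sequentially"
    using d vd by (intro order_tendstoD) auto
  then obtain k where k: "R * vR * (a / b) ^ k < d / 2 * vd" by (auto simp: eventually_sequentially)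
  define \<kappa>0 where "\<kappa>0 z = (1 - (norm z)\<^sup>2 / R\<^sup>2) ^ k" for z :: "real ^ 'n"
  have poly: "real_polynomial_function \<kappa>0"
    unfolding \<kappa>0_def by (intro real_polynomial_function_power real_polynomial_function_diff real_polynomial_function_divide
        real_polynomial_function_norm2 real_polynomial_function.intros(2))
  have frac: "0 \<le> 1 - (norm z)\<^sup>2 / R\<^sup>2" if "z \<in> cball 0 R" for z :: "real ^ 'n"
  proof -
    have "(norm z)\<^sup>2 \<le> R\<^sup>2" using that by (intro power_mono) auto
    then show ?thesis using R by (simp add: divide_le_eq)
  qed
  have nn: "0 \<le> \<kappa>0 z" if "z \<in> cball 0 R" for z using frac[OF that] by (simp add: \<kappa>0_def)
  have int: "set_integrable lborel (cball 0 R) \<kappa>0" "set_integrable lborel (cball 0 R) (\<lambda>z. norm z * \<kappa>0 z)"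
    "set_integrable lborel (cball 0 r) (\<lambda>z :: real ^ 'n. c :: real)" for r c
    by (intro set_integrable_compact compact_cball continuous_intros continuous_on_polynomial poly)+
  define I where "I = (LINT z:cball 0 R|lborel. \<kappa>0 z)"
  have I: "I \<ge> b ^ k * vd"
  proof -
    have "b ^ k * vd = (LINT z:cball (0 :: real ^ 'n) (d / 4)|lborel. b ^ k)"
      by (simp add: set_lebesgue_integral_def vd_def mult.commute)
    also have "\<dots> \<le> I"
      unfolding I_def set_lebesgue_integral_def
    proof (rule integral_mono)
      fix z :: "real ^ 'n"
      show "indicat_real (cball 0 (d / 4)) z *\<^sub>R b ^ k \<le> indicat_real (cball 0 R) z *\<^sub>R \<kappa>0 z"
      proof (cases "z \<in> cball 0 (d / 4)")
        case True
        then have "(norm z)\<^sup>2 \<le> (d / 4)\<^sup>2" by (intro power_mono) auto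
        then have "b \<le> 1 - (norm z)\<^sup>2 / R\<^sup>2" using R by (simp add: b_def divide_right_mono)
        then have "b ^ k \<le> \<kappa>0 z" unfolding \<kappa>0_def using ab by (intro power_mono) auto
        moreover have "z \<in> cball 0 R" using True d by auto
        ultimately show ?thesis using True by simp
      next
        case False
        then show ?thesis using nn[of z] by (auto simp: indicator_def)
      qed
    qed (use int(1) int(3)[of "d / 4" "b ^ k"] in \<open>simp_all only: set_integrable_def\<close>)
    finally show ?thesis .
  qed
  have Ipos: "I > 0" using I ab vd by (intro less_le_trans[OF _ I]) simp
  have "(LINT z:cball 0 R|lborel. norm z * \<kappa>0 z) \<le> (LINT z:cball 0 R|lborel. d / 2 * \<kappa>0 z + R * a ^ k)"
  proof (rule set_integral_mono)
    fix z :: "real ^ 'n" assume z: "z \<in> cball 0 R"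
    show "norm z * \<kappa>0 z \<le> d / 2 * \<kappa>0 z + R * a ^ k"
    proof (cases "norm z \<le> d / 2")
      case True
      then have "norm z * \<kappa>0 z \<le> d / 2 * \<kappa>0 z" using nn[OF z] by (intro mult_right_mono)
      moreover have "0 \<le> R * a ^ k" using R ab by simp
      ultimately show ?thesis by linarith
    next
      case False
      then have "(d / 2)\<^sup>2 \<le> (norm z)\<^sup>2" using d by (intro power_mono) auto
      then have "1 - (norm z)\<^sup>2 / R\<^sup>2 \<le> a" using R by (simp add: a_def divide_right_mono)
      then have "\<kappa>0 z \<le> a ^ k" unfolding \<kappa>0_def using frac[OF z] by (intro power_mono) auto
      then have "norm z * \<kappa>0 z \<le> R * a ^ k" using z nn[OF z] R by (intro mult_mono) auto
      moreover have "0 \<le> d / 2 * \<kappa>0 z" using nn[OF z] d by simp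
      ultimately show ?thesis by linarith
    qed
  qed (intro set_integral_add int set_integrable_mult_right)+
  also have "\<dots> = d / 2 * I + R * a ^ k * vR"
    using int by (subst set_integral_add) (auto simp: I_def vR_def set_integral_mult_right set_lebesgue_integral_def)
  also have "R * a ^ k * vR = b ^ k * (R * vR * (a / b) ^ k)" using ab by (simp add: power_divide)
  also have "\<dots> \<le> b ^ k * (d / 2 * vd)" using k ab by (intro mult_left_mono) auto
  also have "\<dots> \<le> d / 2 * I" using mult_left_mono[OF I, of "d / 2"] d by (simp add: mult_ac)
  finally have J: "(LINT z:cball 0 R|lborel. norm z * \<kappa>0 z) \<le> d * I" by (simp add: mult.commute)
  have "real_polynomial_function (\<lambda>z. \<kappa>0 z / I)" by (intro real_polynomial_function_divide poly)
  moreover have "(LINT z:cball 0 R|lborel. \<kappa>0 z / I) = 1"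
    using Ipos by (simp add: set_integral_divide_zero flip: I_def)
  moreover have "(LINT z:cball 0 R|lborel. norm z * (\<kappa>0 z / I)) \<le> e"
  proof -
    have "(LINT z:cball 0 R|lborel. norm z * (\<kappa>0 z / I)) = (LINT z:cball 0 R|lborel. norm z * \<kappa>0 z) / I"
      by (simp add: set_integral_divide_zero)
    also have "\<dots> \<le> d" using J Ipos by (simp add: pos_divide_le_eq)
    finally show ?thesis using d by simp
  qed
  ultimately show ?thesis using nn Ipos by (intro exI[of _ "\<lambda>z. \<kappa>0 z / I"]) auto
qed

text \<open>Finite sums of products \<open>a(x) b(y)\<close>: integrating out \<open>y\<close>
  leaves a polynomial in \<open>x\<close>.\<close>

inductive separable :: "('a::real_normed_vector \<Rightarrow> 'a \<Rightarrow> real) \<Rightarrow> bool" where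
  prod: "real_polynomial_function a \<Longrightarrow> real_polynomial_function b \<Longrightarrow> separable (\<lambda>x y. a x * b y)"
| add: "separable F \<Longrightarrow> separable G \<Longrightarrow> separable (\<lambda>x y. F x y + G x y)"

lemma separable_mult: "separable F \<Longrightarrow> separable G \<Longrightarrow> separable (\<lambda>x y. F x y * G x y)"
proof (induction rule: separable.induct)
  case (prod a b)
  from prod.prems show ?case
  proof (induction rule: separable.induct)
    case (prod c d)
    have "separable (\<lambda>x y. (a x * c x) * (b y * d y))"
      using prod \<open>real_polynomial_function a\<close> \<open>real_polynomial_function b\<close>
      by (intro separable.prod real_polynomial_function.intros(4))
    then show ?case by (simp add: mult_ac)
  next
    case (add F G)
    then show ?case using separable.add[OF add.IH] by (simp add: algebra_simps)
  qed
next
  case (add F G)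
  then show ?case using separable.add[OF add.IH] by (simp add: algebra_simps)
qed

lemma separable_diff:
  assumes "real_polynomial_function p"
  shows "separable (\<lambda>x y. p (x - y))"
  using assms
proof (induction rule: real_polynomial_function.induct)
  case (linear h)
  have "separable (\<lambda>x y. h x * 1 + (- 1) * h y)"
    using linear by (intro separable.intros real_polynomial_function.intros)
  moreover have "h (x - y) = h x * 1 + (- 1) * h y" for x y using linear by (simp add: linear_diff bounded_linear.linear)
  ultimately show ?case by simp
next
  case (const c)
  have "separable (\<lambda>x y. (\<lambda>_. c) x * (\<lambda>_. 1) y)"
    by (intro separable.prod real_polynomial_function.intros)
  then show ?case by simp
qed (auto intro: separable.add separable_mult)

lemma separable_continuous: "separable F \<Longrightarrow> continuous_on S (F x)"
proof (induction rule: separable.induct)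
  case (prod a b)
  then show ?case by (intro continuous_on_mult_left continuous_on_polynomial)
next
  case (add F G)
  show ?case by (rule continuous_on_add[OF add.IH])
qed

lemma separable_integral:
  fixes F :: "real ^ 'n \<Rightarrow> real ^ 'n \<Rightarrow> real"
  assumes "separable F" and S: "compact S" and V: "continuous_on S V"
  shows "real_polynomial_function (\<lambda>x. LINT y:S|lborel. V y * F x y)"
  using assms(1)
proof (induction rule: separable.induct)
  case (prod a b)
  have "(LINT y:S|lborel. V y * (a x * b y)) = a x * (LINT y:S|lborel. V y * b y)" for x
  proof -
    have "(LINT y:S|lborel. V y * (a x * b y)) = (LINT y:S|lborel. a x * (V y * b y))" by (simp add: mult_ac)
    then show ?thesis by simp
  qed
  moreover have "real_polynomial_function (\<lambda>x. a x * (LINT y:S|lborel. V y * b y))"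
    by (intro real_polynomial_function.intros(2,4) prod)
  ultimately show ?case by simp
next
  case (add F G)
  have "(LINT y:S|lborel. V y * (F x y + G x y)) = (LINT y:S|lborel. V y * F x y) + (LINT y:S|lborel. V y * G x y)" for x
    unfolding distrib_left
    by (intro set_integral_add set_integrable_compact S continuous_intros V separable_continuous add)
  then show ?case using real_polynomial_function.intros(3)[OF add.IH] by simp
qed

lemma lborel_integral_reflect:
  fixes g :: "'a::euclidean_space \<Rightarrow> real"
  assumes "g \<in> borel_measurable borel"
  shows "(LINT y|lborel. g y) = (LINT z|lborel. g (x - z))"
proof -
  have "lborel = distr lborel borel (\<lambda>z :: 'a. x - z)"
    using lborel_affine[of "- 1" x] by (simp add: density_1 scaleR_minus_left)
  then have "(LINT y|lborel. g y) = (LINT y|distr lborel borel (\<lambda>z. x - z). g y)" by simp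
  also have "\<dots> = (LINT z|lborel. g (x - z))" using assms by (intro integral_distr) auto
  finally show ?thesis .
qed

section \<open>Smoothing the Lyapunov function\<close>

context polynomial_flow begin

text \<open>The mean value inequality twice: the trajectory moves at most \<open>M h\<close>, so its
  velocity varies by at most \<open>L M h\<close>.\<close>

lemma flow_short_time:
  assumes R: "\<And>s. 0 \<le> s \<Longrightarrow> s \<le> h \<Longrightarrow> norm (\<phi> w s) \<le> R" and h: "h \<ge> 0"
    and M: "\<And>u. u \<in> cball 0 R \<Longrightarrow> norm (f u) \<le> M"
    and L: "L \<ge> 0" "\<And>u v. u \<in> cball 0 R \<Longrightarrow> v \<in> cball 0 R \<Longrightarrow> norm (f u - f v) \<le> L * norm (u - v)"
  shows "norm (\<phi> w h - w - h *\<^sub>R f w) \<le> h * (L * (M * h))"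
proof -
  have der: "(\<phi> w has_derivative (\<lambda>k. k *\<^sub>R f (\<phi> w s))) (at s within {0..t})" if "s \<in> {0..t}" for s t
  proof -
    have "(\<phi> w has_derivative (\<lambda>k. k *\<^sub>R f (\<phi> w s))) (at s within {0..})"
      using flow_deriv[of s w] that by (simp add: has_vector_derivative_def)
    then show ?thesis by (rule has_derivative_subset) simp
  qed
  have sc: "onorm (\<lambda>k. k *\<^sub>R v) \<le> c" if "norm v \<le> c" for v :: "real ^ 'n" and c
    using that by (intro onorm_le) (simp add: mult.commute[of _ "norm v"] mult_right_mono)
  have d: "norm (\<phi> w t - w) \<le> M * t" if t: "0 \<le> t" "t \<le> h" for t
  proof -
    have "norm (\<phi> w t - \<phi> w 0) \<le> M * norm (t - 0)"
      by (rule differentiable_bound[of "{0..t}" "\<phi> w" "\<lambda>s k. k *\<^sub>R f (\<phi> w s)"])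
        (use t R in \<open>auto intro!: der sc M\<close>)
    then show ?thesis using t by (simp add: flow_0)
  qed
  have "norm ((\<phi> w h - h *\<^sub>R f w) - (\<phi> w 0 - 0 *\<^sub>R f w)) \<le> (L * (M * h)) * norm (h - 0)"
  proof (rule differentiable_bound[of "{0..h}" "\<lambda>s. \<phi> w s - s *\<^sub>R f w" "\<lambda>s k. k *\<^sub>R (f (\<phi> w s) - f w)"])
    fix s assume s: "s \<in> {0..h}"
    have "((\<lambda>s. \<phi> w s - s *\<^sub>R f w) has_derivative (\<lambda>k. k *\<^sub>R f (\<phi> w s) - k *\<^sub>R f w)) (at s within {0..h})"
      by (intro has_derivative_diff der s has_derivative_scaleR_left has_derivative_ident)
    then show "((\<lambda>s. \<phi> w s - s *\<^sub>R f w) has_derivative (\<lambda>k. k *\<^sub>R (f (\<phi> w s) - f w))) (at s within {0..h})"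
      by (simp add: scaleR_diff_right)
    have "norm (f (\<phi> w s) - f w) \<le> L * norm (\<phi> w s - w)"
      using R[of s] R[of 0] s h by (intro L(2)) (auto simp: flow_0)
    also have "\<dots> \<le> L * (M * h)"
    proof (intro mult_left_mono L(1))
      have "0 \<le> M" using M[of w] R[of 0] h order.trans[OF norm_ge_zero[of "f w"]] by (simp add: flow_0)
      then have "M * s \<le> M * h" using s by (intro mult_left_mono) auto
      then show "norm (\<phi> w s - w) \<le> M * h" using d[of s] s by auto
    qed
    finally show "onorm (\<lambda>k. k *\<^sub>R (f (\<phi> w s) - f w)) \<le> L * (M * h)" by (rule sc)
  qed (use h in auto)
  then show ?thesis using h by (simp add: flow_0 algebra_simps)
qed

text \<open>\<open>V\<close> need not be differentiable, so the gradient of the convolution is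
  estimated through difference quotients in the direction \<open>f x\<close>. For a shifted point
  \<open>w = x - z\<close>, an Euler step with \<open>f x\<close> is compared with the flow from
  \<open>w\<close>; the mismatch is of order \<open>|z|\<close> and is controlled by the first
  moment of the kernel.\<close>

theorem polynomial_smoothing:
  assumes K: "compact K" and L: "L > 0" "\<And>x y. \<bar>V x - V y\<bar> \<le> L * norm (x - y)" and V0: "\<And>x. V x \<ge> (0::real)"
    and supp: "\<And>x. norm x > \<rho> \<Longrightarrow> V x = 0" and \<eta>: "\<eta> > 0"
    and bd: "\<And>x y t. x \<in> K \<Longrightarrow> y \<in> ball x \<eta> \<Longrightarrow> t \<ge> 0 \<Longrightarrow> norm (\<phi> y t) \<le> R0"
    and decr: "\<And>x y h. x \<in> K \<Longrightarrow> y \<in> ball x \<eta> \<Longrightarrow> h \<in> {0..\<eta>} \<Longrightarrow> V (\<phi> y h) \<le> exp (- 2 * h) * V y"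
    and e: "e > 0"
  shows "\<exists>P. real_polynomial_function P \<and> (\<forall>x\<in>K. \<bar>P x - V x\<bar> \<le> e) \<and>
    (\<forall>x\<in>K. \<forall>D. GDERIV P x :> D \<longrightarrow> D \<bullet> f x \<le> - 2 * V x + e)"
proof -
  have "L-lipschitz_on UNIV V" using L by (intro lipschitz_onI) (auto simp: dist_norm)
  then have contV: "continuous_on S V" for S
    using lipschitz_on_continuous_on continuous_on_subset by blast
  obtain RK where RK: "\<And>x. x \<in> K \<Longrightarrow> norm x \<le> RK" using compact_imp_bounded[OF K] unfolding bounded_iff by blast
  have "continuous_on (cball 0 R0) f" using continuous_on_polymonial_function[OF poly] .
  then have "bounded (f ` cball 0 R0)" by (intro compact_imp_bounded compact_continuous_image) auto
  then obtain M where M: "M > 0" "\<And>u. u \<in> cball 0 R0 \<Longrightarrow> norm (f u) \<le> M" unfolding bounded_pos by auto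
  have "bounded (V ` K)" by (intro compact_imp_bounded compact_continuous_image contV K)
  then obtain N where N: "N > 0" "\<And>x. x \<in> K \<Longrightarrow> V x \<le> N" unfolding bounded_pos by (auto simp: abs_le_iff)
  obtain L' where L': "L' \<ge> 0" "\<And>u v. u \<in> cball 0 R0 \<Longrightarrow> v \<in> cball 0 R0 \<Longrightarrow> norm (f u - f v) \<le> L' * norm (u - v)"
    using polynomial_function_lipschitz[OF poly] by blast
  \<comment> \<open>\<open>L * L'\<close> pays for using \<open>f x\<close> in place of
    \<open>f (x - z)\<close>, \<open>2 * L\<close> for \<open>V x\<close> in place of
    \<open>V (x - z)\<close>, and the fraction for shifts with \<open>|z| \<ge> \<eta>\<close>,
    where no decay is known and \<open>|z| / \<eta> \<ge> 1\<close>. \<open>C2\<close> is the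
    second-order error of the Euler step.\<close>
  define C1 where "C1 = L * L' + 2 * L + (L * M + 2 * N) / \<eta>"
  define C2 where "C2 = L * L' * M"
  have C1: "C1 > 0" using L L' M N \<eta> by (simp add: C1_def add_nonneg_pos add_pos_pos)
  define \<rho>' where "\<rho>' = max \<rho> 0"
  \<comment> \<open>For \<open>x\<close> within distance 1 of the ball around \<open>K\<close>, a
    shift \<open>z\<close> that brings \<open>x - z\<close> into the support ball has norm at most
    \<open>R\<close>, so integrating over this ball loses nothing.\<close>
  define R where "R = \<rho>' + max RK 0 + 1"
  have R: "R > 0" by (simp add: R_def \<rho>'_def)
  define e' where "e' = e / (L + C1)"
  have e': "e' > 0" "L * e' \<le> e" "C1 * e' \<le> e"
    using e L C1 by (auto simp: e'_def field_simps)
  obtain \<kappa> :: "real ^ 'n \<Rightarrow> real" where \<kappa>: "real_polynomial_function \<kappa>" "\<And>z. z \<in> cball 0 R \<Longrightarrow> 0 \<le> \<kappa> z"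
    "(LINT z:cball 0 R|lborel. \<kappa> z) = 1" "(LINT z:cball 0 R|lborel. norm z * \<kappa> z) \<le> e'"
    using polynomial_kernel[OF R e'(1)] by blast
  have int: "set_integrable lborel (cball 0 R) (\<lambda>z. g z * \<kappa> z)" if "continuous_on UNIV g" for g
    by (intro set_integrable_compact compact_cball continuous_on_mult continuous_on_subset[OF that]
        continuous_on_polynomial[OF \<kappa>(1)]) simp
  have contsh: "continuous_on UNIV (\<lambda>z. V (x - z))" for x
    by (rule continuous_on_compose2[OF contV[of UNIV]]) (auto intro!: continuous_intros)
  define P where "P x = (LINT y:cball 0 \<rho>'|lborel. V y * \<kappa> (x - y))" for x
  have polyP: "real_polynomial_function P"
    unfolding P_def by (intro separable_integral[OF separable_diff[OF \<kappa>(1)]] contV compact_cball)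
  have P_eq: "P x = (LINT z:cball 0 R|lborel. V (x - z) * \<kappa> z)" if x: "norm x \<le> max RK 0 + 1" for x
  proof -
    have cont\<kappa>: "continuous_on UNIV \<kappa>" using \<kappa>(1) by (rule continuous_on_polynomial)
    have "continuous_on UNIV (\<lambda>y. V y * \<kappa> (x - y))"
      by (intro continuous_intros contV continuous_on_compose2[OF cont\<kappa>]) auto
    then have m: "(\<lambda>y. indicat_real (cball 0 \<rho>') y *\<^sub>R (V y * \<kappa> (x - y))) \<in> borel_measurable borel"
      by (intro borel_measurable_scaleR borel_measurable_indicator borel_measurable_continuous_onI) auto
    have eq: "indicat_real (cball 0 \<rho>') (x - z) *\<^sub>R (V (x - z) * \<kappa> (x - (x - z))) = indicat_real (cball 0 R) z *\<^sub>R (V (x - z) * \<kappa> z)" for z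
    proof (cases "norm (x - z) \<le> \<rho>'")
      case True
      moreover have "norm z \<le> norm x + norm (x - z)" by (metis norm_minus_commute norm_triangle_sub)
      ultimately have "norm z \<le> R" using x by (simp add: R_def)
      then show ?thesis using True by (simp add: indicator_def)
    next
      case False
      then have "V (x - z) = 0" using supp by (simp add: \<rho>'_def)
      then show ?thesis by simp
    qed
    show ?thesis
      unfolding P_def set_lebesgue_integral_def lborel_integral_reflect[OF m, of x] eq ..
  qed
  have mono: "(LINT z:cball 0 R|lborel. g z * \<kappa> z) \<le> (LINT z:cball 0 R|lborel. h z * \<kappa> z)"
    if "continuous_on UNIV g" "continuous_on UNIV h" "\<And>z. g z \<le> h z" for g h
    using that \<kappa>(2) by (intro set_integral_mono int mult_right_mono) auto
  have affine: "(LINT z:cball 0 R|lborel. (c + d * norm z) * \<kappa> z) \<le> c + d * e'" if "d \<ge> 0" for c d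
  proof -
    have "(LINT z:cball 0 R|lborel. (c + d * norm z) * \<kappa> z) = (LINT z:cball 0 R|lborel. c * \<kappa> z + d * (norm z * \<kappa> z))"
      by (simp add: algebra_simps)
    also have "\<dots> = c * (LINT z:cball 0 R|lborel. \<kappa> z) + d * (LINT z:cball 0 R|lborel. norm z * \<kappa> z)"
    proof -
      have "continuous_on UNIV (\<lambda>z :: real ^ 'n. d * norm z)" by (intro continuous_intros)
      from int[OF continuous_on_const, of c] int[OF this] show ?thesis
        by (subst set_integral_add) (simp_all add: mult.assoc)
    qed
    also have "\<dots> \<le> c + d * e'" using \<kappa>(3,4) that by (simp add: mult_left_mono)
    finally show ?thesis .
  qed
  have close: "\<bar>P x - V x\<bar> \<le> e" if x: "x \<in> K" for x
  proof -
    have nx: "norm x \<le> max RK 0 + 1" using RK[OF x] by simp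
    have V1: "V (x - z) \<le> V x + L * norm z" "- V (x - z) \<le> - V x + L * norm z" for z
      using L(2)[of "x - z" x] by (auto simp: abs_le_iff)
    have "(LINT z:cball 0 R|lborel. V (x - z) * \<kappa> z) \<le> V x + L * e'"
      using L(1) by (intro order.trans[OF mono[OF contsh _ V1(1)] affine] continuous_intros) simp
    moreover have "(LINT z:cball 0 R|lborel. - V (x - z) * \<kappa> z) \<le> - V x + L * e'"
      using L(1) by (intro order.trans[OF mono[OF continuous_on_minus[OF contsh] _ V1(2)] affine] continuous_intros) simp
    moreover have "(LINT z:cball 0 R|lborel. - V (x - z) * \<kappa> z) = - (LINT z:cball 0 R|lborel. V (x - z) * \<kappa> z)"
      by (simp add: set_lebesgue_integral_def)
    ultimately show ?thesis using e'(2) by (simp add: P_eq[OF nx] abs_le_iff)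
  qed
  have descent: "D \<bullet> f x \<le> - 2 * V x + e" if x: "x \<in> K" and D: "GDERIV P x :> D" for x D
  proof -
    define v where "v = f x"
    have x0: "x \<in> ball x \<eta>" using \<eta> by simp
    have xR: "x \<in> cball 0 R0" using bd[OF x x0, of 0] by (simp add: flow_0)
    have vM: "norm v \<le> M" using M(2)[OF xR] by (simp add: v_def)
    \<comment> \<open>The difference quotient of the decay factor; it tends to 2 as \<open>h\<close>
      tends to 0.\<close>
    define \<beta> where "\<beta> h = (1 - exp (- 2 * h)) / h" for h :: real
    have \<beta>: "0 \<le> \<beta> h" "\<beta> h \<le> 2" "h * \<beta> h = 1 - exp (- 2 * h)" "h * \<beta> h \<le> 2 * h" if "h > 0" for h
    proof -
      have "1 - exp (- 2 * h) \<le> 2 * h" using exp_ge_add_one_self[of "- 2 * h"] by simp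
      then show *: "\<beta> h \<le> 2" using that by (simp add: \<beta>_def pos_divide_le_eq)
      show "h * \<beta> h \<le> 2 * h" using mult_left_mono[OF *, of h] that by simp
      show "0 \<le> \<beta> h" "h * \<beta> h = 1 - exp (- 2 * h)" using that by (auto simp: \<beta>_def)
    qed
    have step: "V (x + h *\<^sub>R v - z) - V (x - z) \<le> h * (- \<beta> h * V x + C2 * h) + h * C1 * norm z"
      if h: "0 < h" "h \<le> \<eta>" for h z
    proof (cases "norm z < \<eta>")
      case True
      define w where "w = x - z"
      have w: "w \<in> ball x \<eta>" using True by (simp add: w_def dist_norm)
      have wR: "norm (\<phi> w s) \<le> R0" if "s \<ge> 0" for s using bd[OF x w that] .
      then have w0: "w \<in> cball 0 R0" using wR[of 0] by (simp add: flow_0)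
      have "norm (\<phi> w h - w - h *\<^sub>R f w) \<le> h * (L' * (M * h))"
        using wR h M(2) by (intro flow_short_time[of h w R0, OF _ _ _ L']) auto
      moreover have "norm (f w - v) \<le> L' * norm z"
        using L'(2)[OF w0 xR] by (simp add: v_def w_def)
      then have "norm (h *\<^sub>R (f w - v)) \<le> h * (L' * norm z)" using h by (simp add: mult_left_mono)
      moreover have "(w + h *\<^sub>R v) - \<phi> w h = - (\<phi> w h - w - h *\<^sub>R f w) - h *\<^sub>R (f w - v)"
        by (simp add: algebra_simps)
      then have "norm ((w + h *\<^sub>R v) - \<phi> w h) \<le> norm (\<phi> w h - w - h *\<^sub>R f w) + norm (h *\<^sub>R (f w - v))"
        by (metis norm_minus_cancel norm_triangle_ineq4)
      ultimately have n: "norm ((w + h *\<^sub>R v) - \<phi> w h) \<le> h * (L' * M * h + L' * norm z)"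
        by (simp add: algebra_simps)
      have "V (w + h *\<^sub>R v) \<le> V (\<phi> w h) + L * norm ((w + h *\<^sub>R v) - \<phi> w h)"
        using L(2)[of "w + h *\<^sub>R v" "\<phi> w h"] by (simp add: abs_le_iff)
      also have "\<dots> \<le> exp (- 2 * h) * V w + L * (h * (L' * M * h + L' * norm z))"
        using decr[OF x w, of h] h n L(1) by (intro add_mono mult_left_mono) auto
      also have "exp (- 2 * h) * V w = V w - (h * \<beta> h) * V w"
        unfolding \<beta>(3)[OF h(1)] by (simp add: left_diff_distrib)
      finally have "V (w + h *\<^sub>R v) - V w \<le> - (h * \<beta> h) * V w + L * (h * (L' * M * h + L' * norm z))"
        by simp
      also have "- (h * \<beta> h) * V w \<le> - (h * \<beta> h) * V x + 2 * h * (L * norm z)"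
      proof -
        have "V x - V w \<le> L * norm z" using L(2)[of x w] by (simp add: w_def abs_le_iff)
        then have "(h * \<beta> h) * (V x - V w) \<le> (h * \<beta> h) * (L * norm z)"
          by (rule mult_left_mono) (use h \<beta>(1)[OF h(1)] in simp)
        also have "\<dots> \<le> (2 * h) * (L * norm z)"
          using L(1) by (intro mult_right_mono \<beta>(4)[OF h(1)]) auto
        finally show ?thesis by (simp add: algebra_simps)
      qed
      finally have "V (w + h *\<^sub>R v) - V w \<le> h * (- \<beta> h * V x + C2 * h) + h * (L * L' + 2 * L) * norm z"
        by (simp add: C2_def algebra_simps)
      also have "\<dots> \<le> h * (- \<beta> h * V x + C2 * h) + h * C1 * norm z"
        using h L M N \<eta> unfolding C1_def by (intro add_left_mono mult_right_mono mult_left_mono) auto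
      finally show ?thesis by (simp add: w_def algebra_simps)
    next
      case False
      then have z1: "1 \<le> norm z / \<eta>" using \<eta> by simp
      have "V (x + h *\<^sub>R v - z) - V (x - z) \<le> L * norm (h *\<^sub>R v)"
        using L(2)[of "x + h *\<^sub>R v - z" "x - z"] by (simp add: abs_le_iff)
      also have "\<dots> \<le> h * (L * M) * 1" using vM L(1) h by (simp add: mult_left_mono)
      also have "\<dots> \<le> h * (L * M) * (norm z / \<eta>)" using z1 h L(1) M(1) by (intro mult_left_mono) auto
      finally have a: "V (x + h *\<^sub>R v - z) - V (x - z) \<le> h * (L * M) * (norm z / \<eta>)" .
      have "h * \<beta> h * V x \<le> h * 2 * N"
        using h \<beta>(1,2)[OF h(1)] N(2)[OF x] V0 by (intro mult_mono) auto
      also have "\<dots> = h * (2 * N) * 1" by simp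
      also have "\<dots> \<le> h * (2 * N) * (norm z / \<eta>)" using z1 h N(1) by (intro mult_left_mono) auto
      finally have "h * \<beta> h * V x \<le> h * (2 * N) * (norm z / \<eta>)" .
      moreover have "h * (L * M) * (norm z / \<eta>) + h * (2 * N) * (norm z / \<eta>) = h * ((L * M + 2 * N) / \<eta>) * norm z"
        by (simp add: add_divide_distrib algebra_simps)
      moreover have "h * ((L * M + 2 * N) / \<eta>) * norm z \<le> h * C1 * norm z"
        using h L L' unfolding C1_def by (intro mult_right_mono mult_left_mono) auto
      moreover have "0 \<le> h * (C2 * h)" using h L L' M by (simp add: C2_def)
      ultimately show ?thesis using a by (simp add: algebra_simps)
    qed
    \<comment> \<open>\<open>1 / M\<close> keeps \<open>x + h *\<^sub>R v\<close> within distance 1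
      of \<open>x\<close>, where \<open>P_eq\<close> is available.\<close>
    define h0 where "h0 = min \<eta> (1 / M)"
    have h0: "h0 > 0" using \<eta> M by (simp add: h0_def)
    have quot: "(P (x + h *\<^sub>R v) - P x) / h \<le> - \<beta> h * V x + C2 * h + C1 * e'" if h: "0 < h" "h < h0" for h
    proof -
      have "norm (h *\<^sub>R v) \<le> 1"
      proof -
        have "h * norm v \<le> (1 / M) * M" using h vM M(1) by (intro mult_mono) (auto simp: h0_def)
        then show ?thesis using h M(1) by simp
      qed
      then have n: "norm (x + h *\<^sub>R v) \<le> max RK 0 + 1" "norm x \<le> max RK 0 + 1"
        using RK[OF x] norm_triangle_ineq[of x "h *\<^sub>R v"] by simp_all
      have "P (x + h *\<^sub>R v) - P x = (LINT z:cball 0 R|lborel. (V (x + h *\<^sub>R v - z) - V (x - z)) * \<kappa> z)"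
        unfolding P_eq[OF n(1)] P_eq[OF n(2)] left_diff_distrib
        by (intro set_integral_diff(2)[symmetric] int contsh)
      also have "\<dots> \<le> (LINT z:cball 0 R|lborel. (h * (- \<beta> h * V x + C2 * h) + h * C1 * norm z) * \<kappa> z)"
        using step[of h] h by (intro mono continuous_on_diff contsh continuous_intros) (simp_all add: h0_def)
      also have "\<dots> \<le> h * (- \<beta> h * V x + C2 * h) + h * C1 * e'"
        using h C1 by (intro affine) simp
      also have "\<dots> = (- \<beta> h * V x + C2 * h + C1 * e') * h" by (simp add: algebra_simps)
      finally show ?thesis using h by (simp add: pos_divide_le_eq)
    qed
    have "((\<lambda>h. (P (x + h *\<^sub>R v) - P x) / h) \<longlongrightarrow> D \<bullet> v) (at_right 0)"
    proof -
      have "(P has_derivative (\<lambda>k. k \<bullet> D)) (at (x + 0 *\<^sub>R v))" using D by (simp add: gderiv_def)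
      moreover have "((\<lambda>h. x + h *\<^sub>R v) has_derivative (\<lambda>k. k *\<^sub>R v)) (at 0)"
        by (auto intro!: derivative_eq_intros)
      ultimately have "((\<lambda>h. P (x + h *\<^sub>R v)) has_derivative (\<lambda>k. (k *\<^sub>R v) \<bullet> D)) (at 0)"
        using has_derivative_compose[of "\<lambda>h. x + h *\<^sub>R v" "\<lambda>k. k *\<^sub>R v" 0 UNIV P "\<lambda>k. k \<bullet> D"] by simp
      then have "((\<lambda>h. P (x + h *\<^sub>R v)) has_real_derivative (D \<bullet> v)) (at 0)"
        unfolding has_field_derivative_def by (rule has_derivative_eq_rhs) (auto simp: inner_commute fun_eq_iff)
      then have "((\<lambda>h. (P (x + h *\<^sub>R v) - P x) / h) \<longlongrightarrow> D \<bullet> v) (at 0)"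
        by (simp add: has_field_derivative_iff)
      then show ?thesis by (rule tendsto_within_subset) simp
    qed
    moreover have "((\<lambda>h. - \<beta> h * V x + C2 * h + C1 * e') \<longlongrightarrow> - 2 * V x + C2 * 0 + C1 * e') (at_right 0)"
    proof -
      have "((\<lambda>h :: real. exp (- 2 * h)) has_real_derivative (- 2)) (at 0)"
        by (auto intro!: derivative_eq_intros)
      then have "((\<lambda>h :: real. (exp (- 2 * h) - 1) / h) \<longlongrightarrow> - 2) (at 0)"
        by (simp add: has_field_derivative_iff)
      then have "((\<lambda>h :: real. (exp (- 2 * h) - 1) / h) \<longlongrightarrow> - 2) (at_right 0)"
        by (rule tendsto_within_subset) simp
      moreover have "(exp (- 2 * h) - 1) / h = - \<beta> h" for h by (simp add: \<beta>_def minus_divide_left)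
      ultimately have "((\<lambda>h. - \<beta> h) \<longlongrightarrow> - 2) (at_right 0)" by (simp only:)
      then have "(\<beta> \<longlongrightarrow> 2) (at_right 0)" by (rule tendsto_minus_cancel)
      then show ?thesis by (intro tendsto_intros)
    qed
    moreover have "eventually (\<lambda>h. (P (x + h *\<^sub>R v) - P x) / h \<le> - \<beta> h * V x + C2 * h + C1 * e') (at_right 0)"
      unfolding eventually_at_right_field using quot h0 by blast
    ultimately have "D \<bullet> v \<le> - 2 * V x + C2 * 0 + C1 * e'"
      by (intro tendsto_le[OF trivial_limit_at_right_real])
    then show ?thesis using e'(3) by (simp add: v_def)
  qed
  show ?thesis using polyP close descent by blast
qed

end

section \<open>Sublevel sets of feasible functions\<close>

lemma ex_polynomial_gradient:
  fixes p :: "real ^ 'n \<Rightarrow> real"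
  assumes "real_polynomial_function p"
  shows "\<exists>q. polynomial_function q \<and> (\<forall>x. GDERIV p x :> q x)"
  using assms
proof (induction rule: real_polynomial_function.induct)
  case (linear h)
  define D where "D = (\<chi> i. h (axis i 1))"
  have hD: "h k = k \<bullet> D" for k
  proof -
    have "h k = h (\<Sum>i\<in>UNIV. k $ i *\<^sub>R axis i 1)"
      by (subst basis_expansion[symmetric]) (simp add: scalar_mult_eq_scaleR)
    also have "\<dots> = (\<Sum>i\<in>UNIV. k $ i * h (axis i 1))"
      using linear by (simp add: bounded_linear.linear linear_sum linear_cmul)
    finally show ?thesis by (simp add: D_def inner_vec_def)
  qed
  have "(h has_derivative (\<lambda>k. k \<bullet> D)) (at x)" for x
    using bounded_linear_imp_has_derivative[OF linear, of "at x"] by (rule has_derivative_eq_rhs) (simp add: hD fun_eq_iff)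
  then show ?case by (intro exI[of _ "\<lambda>_. D"]) (auto simp: gderiv_def)
next
  case (const c)
  show ?case by (intro exI[of _ "\<lambda>_. 0"]) (auto simp: GDERIV_const)
next
  case (add p q)
  then obtain u v where "polynomial_function u" "\<And>x. GDERIV p x :> u x" "polynomial_function v" "\<And>x. GDERIV q x :> v x" by blast
  then show ?case
    by (intro exI[of _ "\<lambda>x. u x + v x"] conjI allI GDERIV_add polynomial_function_add) auto
next
  case (mult p q)
  then obtain u v where uv: "polynomial_function u" "\<And>x. GDERIV p x :> u x" "polynomial_function v" "\<And>x. GDERIV q x :> v x" by blast
  have "polynomial_function p" "polynomial_function q" using mult.hyps by (simp_all add: real_polynomial_function_eq)
  then have "polynomial_function (\<lambda>x. p x *\<^sub>R v x + q x *\<^sub>R u x)"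
    using uv by (intro polynomial_function_add polynomial_function_mult)
  then show ?case using uv by (intro exI[of _ "\<lambda>x. p x *\<^sub>R v x + q x *\<^sub>R u x"] conjI allI GDERIV_mult)
qed

lemma GDERIV_gradient: "real_polynomial_function p \<Longrightarrow> GDERIV p x :> gradient p x"
  using ex_polynomial_gradient[of p] gradient_eq by metis

lemma real_polynomial_function_gradient_inner:
  fixes f :: "real ^ 'n \<Rightarrow> real ^ 'n"
  assumes "real_polynomial_function p" "polynomial_function f"
  shows "real_polynomial_function (\<lambda>x. gradient p x \<bullet> f x)"
proof -
  obtain q where q: "polynomial_function q" "\<And>x. GDERIV p x :> q x" using ex_polynomial_gradient[OF assms(1)] by blast
  then have "gradient p x = q x" for x using gradient_eq by blast
  then have "(\<lambda>x. gradient p x \<bullet> f x) = (\<lambda>x. \<Sum>i\<in>UNIV. q x $ i * f x $ i)" by (simp add: inner_vec_def)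
  then show ?thesis
    using polynomial_function_component[OF q(1)] polynomial_function_component[OF assms(2)]
    by (auto intro!: real_polynomial_function_sum real_polynomial_function.intros(4))
qed

lemma feasibleD:
  assumes "feasible f g d \<alpha> J"
  shows "real_polynomial_function J" "g x \<ge> 0 \<Longrightarrow> gradient J x \<bullet> f x \<le> - (J x - 1)"
    "g x = 0 \<Longrightarrow> 1 + \<alpha> \<le> J x"
proof -
  obtain s0 k0 k1 p0 where *: "J \<in> sos_deg_le d" "s0 \<in> sos_deg_le d" "k0 \<in> sos_deg_le d" "k1 \<in> sos_deg_le d"
    "\<And>x. k0 x = - (gradient J x \<bullet> f x) - (J x - 1) - s0 x * g x" "\<And>x. k1 x = (J x - 1 - \<alpha>) - p0 x * g x"
    using assms unfolding feasible_def by blast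
  then have s: "sos J" "sos s0" "sos k0" "sos k1" by (auto simp: sos_deg_le_def)
  show "real_polynomial_function J" by (rule sos_polynomial[OF s(1)])
  show "gradient J x \<bullet> f x \<le> - (J x - 1)" if "g x \<ge> 0"
    using sos_nonneg[OF s(3), of x] mult_nonneg_nonneg[OF sos_nonneg[OF s(2), of x] that] by (simp add: *(5))
  show "1 + \<alpha> \<le> J x" if "g x = 0"
    using sos_nonneg[OF s(4), of x] that by (simp add: *(6))
qed

context polynomial_flow begin

text \<open>\<open>(J - 1) * exp s\<close> is nonincreasing along the trajectory.\<close>

lemma decay_along_flow:
  assumes J: "real_polynomial_function J" and t: "0 \<le> t"
    and descent: "\<And>s. 0 \<le> s \<Longrightarrow> s \<le> t \<Longrightarrow> gradient J (\<phi> x s) \<bullet> f (\<phi> x s) \<le> - (J (\<phi> x s) - 1)"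
  shows "J (\<phi> x t) - 1 \<le> exp (- t) * (J x - 1)"
proof -
  define u where "u s = (J (\<phi> x s) - 1) * exp s" for s
  have "u t \<le> u 0"
  proof (rule DERIV_nonpos_imp_decreasing_open[OF t])
    show "continuous_on {0..t} u"
      unfolding u_def
      by (intro continuous_intros continuous_on_compose2[OF continuous_on_polynomial[OF J, of UNIV]] flow_continuous_on) auto
    fix s assume s: "0 < s" "s < t"
    define G where "G = gradient J (\<phi> x s) \<bullet> f (\<phi> x s)"
    have "(\<phi> x has_derivative (\<lambda>k. k *\<^sub>R f (\<phi> x s))) (at s)"
      using flow_deriv_at[OF s(1)] by (simp add: has_vector_derivative_def)
    moreover have "(J has_derivative (\<lambda>k. k \<bullet> gradient J (\<phi> x s))) (at (\<phi> x s))"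
      using GDERIV_gradient[OF J] by (simp add: gderiv_def)
    ultimately have "((\<lambda>s. J (\<phi> x s)) has_derivative (\<lambda>k. (k *\<^sub>R f (\<phi> x s)) \<bullet> gradient J (\<phi> x s))) (at s)"
      by (rule has_derivative_compose)
    then have "((\<lambda>s. J (\<phi> x s)) has_real_derivative G) (at s)"
      unfolding has_field_derivative_def G_def by (rule has_derivative_eq_rhs) (auto simp: inner_commute fun_eq_iff)
    then have "DERIV u s :> G * exp s + (J (\<phi> x s) - 1) * exp s"
      unfolding u_def by (auto intro!: derivative_eq_intros simp: algebra_simps)
    moreover have "G * exp s + (J (\<phi> x s) - 1) * exp s = (G + (J (\<phi> x s) - 1)) * exp s" by (simp add: algebra_simps)
    moreover have "(G + (J (\<phi> x s) - 1)) * exp s \<le> 0"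
      using descent[of s] s by (intro mult_nonpos_nonneg) (auto simp: G_def)
    ultimately show "\<exists>z. DERIV u s :> z \<and> z \<le> 0" by auto
  qed
  then show ?thesis by (simp add: u_def flow_0 exp_minus field_simps)
qed

text \<open>Shared by the cases \<open>C = \<Omega>\<close> and \<open>C = A\<close>. The function
  \<open>max (infdist z C) (J z - 1)\<close> is positive on the compact set of points near
  \<open>C\<close> but at distance at least \<open>e\<close> from \<open>B\<close>, so being nearly
  in \<open>C\<close> with \<open>J\<close> nearly at most 1 forces being near
  \<open>B\<close>.\<close>

lemma attractor_set_sublevel:
  assumes C: "compact C" and J: "continuous_on UNIV J" and B: "B = {z \<in> C. J z \<le> (1 :: real)}" "B \<noteq> {}"
    and inv: "\<And>x t. x \<in> B \<Longrightarrow> 0 \<le> t \<Longrightarrow> \<phi> x t \<in> B"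
    and stable: "\<And>e. e > 0 \<Longrightarrow> \<exists>d>0. \<forall>x\<in>B. \<forall>y\<in>ball x d. \<forall>t\<ge>0. infdist (\<phi> y t) C \<le> e \<and> J (\<phi> y t) \<le> 1 + e"
    and attr: "\<And>x. x \<in> B \<Longrightarrow> \<exists>d>0. \<forall>e>0. \<exists>T\<ge>0. \<forall>y\<in>ball x d. \<forall>t\<ge>T. infdist (\<phi> y t) C \<le> e \<and> J (\<phi> y t) \<le> 1 + e"
  shows "attractor_set \<phi> B"
proof -
  have Cne: "C \<noteq> {}" using B by auto
  have "closed {z. J z \<le> 1}" using J by (intro closed_Collect_le) (auto intro: continuous_on_const)
  moreover have "B = C \<inter> {z. J z \<le> 1}" using B(1) by auto
  ultimately have cB: "compact B" using C by (auto intro: compact_Int_closed)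
  have key: "\<exists>h>0. \<forall>z. infdist z C \<le> h \<and> J z \<le> 1 + h \<longrightarrow> infdist z B < e" if e: "e > 0" for e
  proof -
    define Q where "Q = {z. infdist z C \<le> 1} \<inter> {z. e \<le> infdist z B}"
    have "compact {z. infdist z C \<le> 1}" using compact_infdist_le[OF Cne C, of 1] by simp
    moreover have "closed {z. e \<le> infdist z B}"
      by (intro closed_Collect_le continuous_on_const continuous_on_infdist continuous_on_id)
    ultimately have Q: "compact Q" unfolding Q_def by (rule compact_Int_closed)
    define F where "F z = max (infdist z C) (J z - 1)" for z
    have F: "continuous_on Q F"
      unfolding F_def by (intro continuous_intros continuous_on_infdist continuous_on_subset[OF J]) auto
    have Fpos: "F z > 0" if "z \<in> Q" for z
    proof (rule ccontr)
      assume "\<not> F z > 0"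
      then have "infdist z C \<le> 0" "J z \<le> 1" by (auto simp: F_def)
      then have "infdist z C = 0" using infdist_nonneg[of z C] by simp
      then have "z \<in> C" using in_closed_iff_infdist_zero[OF compact_imp_closed[OF C] Cne] by blast
      then have "z \<in> B" using \<open>J z \<le> 1\<close> B by simp
      then show False using that e by (simp add: Q_def)
    qed
    show ?thesis
    proof (cases "Q = {}")
      case True
      then have "infdist z B < e" if "infdist z C \<le> 1" for z using that by (force simp: Q_def)
      then show ?thesis by (intro exI[of _ 1]) auto
    next
      case False
      obtain z0 where z0: "z0 \<in> Q" "\<And>z. z \<in> Q \<Longrightarrow> F z0 \<le> F z"
        using continuous_attains_inf[OF Q False F] by blast
      define h where "h = min 1 (F z0 / 2)"
      have h: "h > 0" "h \<le> 1" "h < F z0" using Fpos[OF z0(1)] by (auto simp: h_def)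
      have "infdist z B < e" if "infdist z C \<le> h" "J z \<le> 1 + h" for z
      proof (rule ccontr)
        assume "\<not> infdist z B < e"
        then have "z \<in> Q" using that h by (auto simp: Q_def)
        then have "F z0 \<le> F z" by (rule z0(2))
        also have "\<dots> \<le> h" using that by (auto simp: F_def)
        finally show False using h by simp
      qed
      then show ?thesis using h(1) by blast
    qed
  qed
  show ?thesis
    unfolding attractor_set_def
  proof (intro conjI ballI allI impI)
    show "compact B" "B \<noteq> {}" by (rule cB, rule B(2))
    show "\<phi> x t \<in> B" if "x \<in> B" "0 \<le> t" for x t using inv that .
  next
    fix x assume "x \<in> B"
    then obtain d where d: "d > 0" "\<And>e. e > 0 \<Longrightarrow> \<exists>T\<ge>0. \<forall>y\<in>ball x d. \<forall>t\<ge>T. infdist (\<phi> y t) C \<le> e \<and> J (\<phi> y t) \<le> 1 + e"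
      using attr by blast
    have "\<exists>T\<ge>0. \<forall>y\<in>ball x d. \<forall>t\<ge>T. infdist (\<phi> y t) B < e" if e: "e > 0" for e
    proof -
      obtain h where "h > 0" "\<And>z. infdist z C \<le> h \<Longrightarrow> J z \<le> 1 + h \<Longrightarrow> infdist z B < e" using key[OF e] by blast
      then show ?thesis using d(2)[of h] by meson
    qed
    then show "\<exists>d>0. \<forall>e>0. \<exists>T\<ge>0. \<forall>y\<in>ball x d. \<forall>t\<ge>T. infdist (\<phi> y t) B < e" using d(1) by blast
  next
    fix e :: real assume "e > 0"
    then obtain h where h: "h > 0" "\<And>z. infdist z C \<le> h \<Longrightarrow> J z \<le> 1 + h \<Longrightarrow> infdist z B < e" using key by blast
    obtain d where "d > 0" "\<And>x y t. x \<in> B \<Longrightarrow> y \<in> ball x d \<Longrightarrow> t \<ge> 0 \<Longrightarrow> infdist (\<phi> y t) C \<le> h \<and> J (\<phi> y t) \<le> 1 + h"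
      using stable[OF h(1)] by blast
    then show "\<exists>d>0. \<forall>x\<in>nhd B d. \<forall>t\<ge>0. infdist (\<phi> x t) B < e"
      using h(2) unfolding nhd_def by (intro exI[of _ d]) blast
  qed
qed

lemma exp_minus_small:
  assumes "e > 0"
  shows "\<exists>T\<ge>0. \<forall>t\<ge>T. exp (- t) * c \<le> (e :: real)"
proof -
  define T where "T = max 0 (ln ((\<bar>c\<bar> + 1) / e))"
  have "exp (- t) * c \<le> e" if "t \<ge> T" for t
  proof -
    have pos: "(\<bar>c\<bar> + 1) / e > 0" using assms by (simp add: add_nonneg_pos)
    have "(\<bar>c\<bar> + 1) / e = exp (ln ((\<bar>c\<bar> + 1) / e))" using pos by simp
    also have "\<dots> \<le> exp t" using that by (simp add: T_def)
    finally have "\<bar>c\<bar> + 1 \<le> e * exp t" using assms by (simp add: pos_divide_le_eq mult.commute)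
    then have "c \<le> e * exp t" by simp
    then show ?thesis by (simp add: exp_minus field_simps)
  qed
  then show ?thesis by (intro exI[of _ T]) (auto simp: T_def)
qed

text \<open>The boundary is a barrier. A trajectory starting in \<Omega> with
  \<open>J \<le> 1 + \<alpha> / 2\<close> keeps this bound up to the first time it meets
  \<open>g = 0\<close>, where \<open>J \<ge> 1 + \<alpha>\<close>; so it never leaves \<Omega>, and
  \<open>J - 1\<close> obeys the exponential estimate for all time.\<close>

lemma sublevel_attractor:
  assumes g: "real_polynomial_function g" and \<Omega>: "compact \<Omega>" "\<Omega> = {x. g x \<ge> 0}"
    and feas: "feasible f g d \<alpha> J" and \<alpha>: "\<alpha> > 0" and ne: "{x \<in> \<Omega>. J x \<le> 1} \<noteq> {}"
  shows "attractor_set \<phi> {x \<in> \<Omega>. J x \<le> 1}"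
proof -
  have J: "real_polynomial_function J" using feasibleD(1)[OF feas] .
  have contJ: "continuous_on S J" and contg: "continuous_on S g" for S
    using J g by (auto intro: continuous_on_polynomial)
  define B where "B = {x \<in> \<Omega>. J x \<le> 1}"
  have stay: "\<phi> y t \<in> \<Omega> \<and> J (\<phi> y t) - 1 \<le> exp (- t) * (J y - 1)" if y: "y \<in> \<Omega>" "J y \<le> 1 + \<alpha> / 2" and t: "t \<ge> 0" for y t
  proof -
    have contgf: "continuous_on {0..s} (\<lambda>s. g (\<phi> y s))" for s
      by (rule continuous_on_compose2[OF contg[of UNIV]]) (auto intro: flow_continuous_on)
    have in\<Omega>: "g (\<phi> y t) \<ge> 0" if t: "t \<ge> 0" for t
    proof (rule ccontr)
      assume neg: "\<not> g (\<phi> y t) \<ge> 0"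
      define S where "S = {0..t} \<inter> (\<lambda>s. g (\<phi> y s)) -` {0}"
      have "closed S" unfolding S_def by (intro continuous_closed_preimage contgf) auto
      then have "compact S" unfolding S_def by (metis bounded_Int bounded_closed_interval compact_eq_bounded_closed)
      moreover have "S \<noteq> {}"
        using IVT2'[of "\<lambda>s. g (\<phi> y s)" t 0 0] neg y t contgf \<Omega>(2) by (auto simp: S_def flow_0)
      ultimately have "\<exists>\<tau>\<in>S. \<forall>s\<in>S. \<tau> \<le> s" by (rule compact_attains_inf)
      then obtain \<tau> where \<tau>: "\<tau> \<in> S" "\<And>s. s \<in> S \<Longrightarrow> \<tau> \<le> s" by blast
      have nn: "g (\<phi> y s) \<ge> 0" if s: "0 \<le> s" "s \<le> \<tau>" for s
      proof (rule ccontr)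
        assume "\<not> g (\<phi> y s) \<ge> 0"
        then obtain r where r: "0 \<le> r" "r \<le> s" "g (\<phi> y r) = 0"
          using IVT2'[of "\<lambda>s. g (\<phi> y s)" s 0 0] y s contgf \<Omega>(2) by (auto simp: flow_0)
        then have "r \<in> S" using s \<tau>(1) by (auto simp: S_def)
        then have "r = s" using \<tau>(2)[of r] s r by simp
        then show False using r \<open>\<not> g (\<phi> y s) \<ge> 0\<close> by simp
      qed
      have \<tau>0: "0 \<le> \<tau>" "g (\<phi> y \<tau>) = 0" using \<tau>(1) by (auto simp: S_def)
      have "J (\<phi> y \<tau>) - 1 \<le> exp (- \<tau>) * (J y - 1)"
        using nn by (intro decay_along_flow J \<tau>0 feasibleD(2)[OF feas]) auto
      also have "\<dots> \<le> exp (- \<tau>) * (\<alpha> / 2)" using y by (intro mult_left_mono) auto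
      also have "\<dots> \<le> 1 * (\<alpha> / 2)" using \<tau>0 \<alpha> by (intro mult_right_mono) auto
      finally show False using feasibleD(3)[OF feas \<tau>0(2)] \<alpha> by simp
    qed
    then have "J (\<phi> y t) - 1 \<le> exp (- t) * (J y - 1)"
      by (intro decay_along_flow J t feasibleD(2)[OF feas]) auto
    then show ?thesis using in\<Omega>[OF t] \<Omega>(2) by simp
  qed
  have cB: "compact B"
  proof -
    have "closed {z. J z \<le> 1}" using contJ by (intro closed_Collect_le continuous_on_const)
    moreover have "B = \<Omega> \<inter> {z. J z \<le> 1}" by (auto simp: B_def)
    ultimately show ?thesis using \<Omega> by (auto intro: compact_Int_closed)
  qed
  have near: "\<exists>d>0. \<forall>x\<in>B. \<forall>y\<in>ball x d. y \<in> \<Omega> \<and> J y < 1 + e" if "e > 0" for e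
  proof -
    have "open {y. 0 < g y}" "open {y. J y < 1 + e}"
      using contJ contg by (auto intro!: open_Collect_less continuous_on_const)
    then have op: "open ({y. 0 < g y} \<inter> {y. J y < 1 + e})" by (rule open_Int)
    \<comment> \<open>On \<open>g = 0\<close> the value of \<open>J\<close> exceeds 1, so the
      sublevel set avoids the boundary and a whole neighbourhood of it lies in \<Omega>.\<close>
    have sub: "B \<subseteq> {y. 0 < g y} \<inter> {y. J y < 1 + e}"
    proof
      fix x assume "x \<in> B"
      then have "g x \<ge> 0" "J x \<le> 1" using \<Omega>(2) by (auto simp: B_def)
      moreover have "g x \<noteq> 0" using feasibleD(3)[OF feas, of x] \<open>J x \<le> 1\<close> \<alpha> by auto
      ultimately show "x \<in> {y. 0 < g y} \<inter> {y. J y < 1 + e}" using that by auto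
    qed
    obtain d where "d > 0" "(\<Union>x\<in>B. ball x d) \<subseteq> {y. 0 < g y} \<inter> {y. J y < 1 + e}"
      by (rule compact_subset_open_imp_ball_epsilon_subset[OF cB op sub])
    then show ?thesis using \<Omega>(2) by (intro exI[of _ d]) (auto simp: less_imp_le)
  qed
  show ?thesis
    unfolding B_def[symmetric]
  proof (rule attractor_set_sublevel[OF \<Omega>(1) contJ B_def])
    show "B \<noteq> {}" using ne by (simp add: B_def)
    show "\<phi> x t \<in> B" if "x \<in> B" "0 \<le> t" for x t
    proof -
      have "J x \<le> 1" using that by (simp add: B_def)
      then have "exp (- t) * (J x - 1) \<le> 0" by (intro mult_nonneg_nonpos) auto
      then show ?thesis using stay[of x t] that \<alpha> \<open>J x \<le> 1\<close> by (auto simp: B_def)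
    qed
  next
    fix e :: real assume e: "e > 0"
    obtain d where d: "d > 0" "\<And>x y. x \<in> B \<Longrightarrow> y \<in> ball x d \<Longrightarrow> y \<in> \<Omega> \<and> J y < 1 + min e (\<alpha> / 2)"
      using near[of "min e (\<alpha> / 2)"] e \<alpha> by (auto simp: Ball_def)
    have "infdist (\<phi> y t) \<Omega> \<le> e \<and> J (\<phi> y t) \<le> 1 + e" if "x \<in> B" "y \<in> ball x d" "t \<ge> 0" for x y t
    proof -
      have y: "y \<in> \<Omega>" "J y < 1 + e" "J y \<le> 1 + \<alpha> / 2" using d(2)[OF that(1,2)] by auto
      have "exp (- t) * (J y - 1) \<le> exp (- t) * e" using y by (intro mult_left_mono) auto
      also have "\<dots> \<le> 1 * e" using e that by (intro mult_right_mono) auto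
      finally show ?thesis using stay[OF y(1,3) that(3)] e by simp
    qed
    then show "\<exists>d>0. \<forall>x\<in>B. \<forall>y\<in>ball x d. \<forall>t\<ge>0. infdist (\<phi> y t) \<Omega> \<le> e \<and> J (\<phi> y t) \<le> 1 + e"
      using d(1) by blast
  next
    fix x assume x: "x \<in> B"
    obtain d where d: "d > 0" "\<And>y. y \<in> ball x d \<Longrightarrow> y \<in> \<Omega> \<and> J y < 1 + \<alpha> / 2"
      using near[of "\<alpha> / 2"] \<alpha> x by auto
    have "\<exists>T\<ge>0. \<forall>y\<in>ball x d. \<forall>t\<ge>T. infdist (\<phi> y t) \<Omega> \<le> e \<and> J (\<phi> y t) \<le> 1 + e" if e: "e > 0" for e
    proof -
      obtain T where T: "T \<ge> 0" "\<And>t. t \<ge> T \<Longrightarrow> exp (- t) * (\<alpha> / 2) \<le> e" using exp_minus_small[OF e] by blast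
      have "infdist (\<phi> y t) \<Omega> \<le> e \<and> J (\<phi> y t) \<le> 1 + e" if yt: "y \<in> ball x d" "t \<ge> T" for y t
      proof -
        have y: "y \<in> \<Omega>" "J y \<le> 1 + \<alpha> / 2" using d(2)[OF yt(1)] by auto
        have "exp (- t) * (J y - 1) \<le> exp (- t) * (\<alpha> / 2)" using y by (intro mult_left_mono) auto
        also have "\<dots> \<le> e" using T(2) yt by simp
        finally show ?thesis using stay[OF y, of t] yt T(1) e by simp
      qed
      then show ?thesis using T(1) by blast
    qed
    then show "\<exists>d>0. \<forall>e>0. \<exists>T\<ge>0. \<forall>y\<in>ball x d. \<forall>t\<ge>T. infdist (\<phi> y t) \<Omega> \<le> e \<and> J (\<phi> y t) \<le> 1 + e"
      using d(1) by blast
  qed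
qed

text \<open>The part of \<open>A\<close> where \<open>J \<le> 1\<close> is again an attractor set, so minimality forces it to be all of \<open>A\<close>.\<close>

lemma minimal_attractor_subset_sublevel:
  assumes A: "minimal_attractor_set \<phi> A" and \<sigma>: "\<sigma> > 0" "nhd A \<sigma> \<subseteq> {x. g x \<ge> 0}"
    and feas: "feasible f g d \<alpha> J"
  shows "A \<subseteq> {x. J x \<le> 1}"
proof -
  have att: "attractor_set \<phi> A" using A by (simp add: minimal_attractor_set_def)
  note AD = attractor_setD[OF att]
  have J: "real_polynomial_function J" using feasibleD(1)[OF feas] .
  have contJ: "continuous_on S J" for S using J by (rule continuous_on_polynomial)
  have Ag: "g z \<ge> 0" if "infdist z A < \<sigma>" for z using infdist_less_nhd[OF AD(2) that] \<sigma>(2) by blast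
  have decay: "J (\<phi> y t) - 1 \<le> exp (- t) * (J y - 1)" if "\<And>s. 0 \<le> s \<Longrightarrow> infdist (\<phi> y s) A < \<sigma>" "t \<ge> 0" for y t
    using that Ag by (intro decay_along_flow J feasibleD(2)[OF feas]) auto
  have inA: "infdist (\<phi> x s) A < \<sigma>" if "x \<in> A" "0 \<le> s" for x s using AD(3)[OF that] \<sigma>(1) by simp
  define B where "B = {z \<in> A. J z \<le> 1}"
  have "B \<noteq> {}"
  proof -
    \<comment> \<open>At a minimum of \<open>J\<close> on the invariant set \<open>A\<close>,
      following the flow for one unit of time gives
      \<open>J z - 1 \<le> exp (- 1) * (J z - 1)\<close>, so \<open>J z \<le> 1\<close>.\<close>
    obtain z where z: "z \<in> A" "\<And>x. x \<in> A \<Longrightarrow> J z \<le> J x" using continuous_attains_inf[OF AD(1,2) contJ] by blast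
    have "J z - 1 \<le> J (\<phi> z 1) - 1" using z AD(3)[OF z(1), of 1] by simp
    also have "\<dots> \<le> exp (- 1) * (J z - 1)" using inA[OF z(1)] by (intro decay) auto
    finally have "(1 - exp (- 1)) * (J z - 1) \<le> 0" by (simp add: algebra_simps)
    moreover have "1 - exp (- 1 :: real) > 0" by simp
    ultimately have "J z \<le> 1" by (simp add: mult_le_0_iff)
    then show ?thesis using z by (auto simp: B_def)
  qed
  have cB: "compact B"
  proof -
    have "closed {z. J z \<le> 1}" using contJ by (intro closed_Collect_le continuous_on_const)
    moreover have "B = A \<inter> {z. J z \<le> 1}" by (auto simp: B_def)
    ultimately show ?thesis using AD(1) by (auto intro: compact_Int_closed)
  qed
  have near: "\<exists>d>0. \<forall>x\<in>B. \<forall>y\<in>ball x d. J y < 1 + e" if "e > 0" for e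
  proof -
    have op: "open {y. J y < 1 + e}" using contJ by (auto intro!: open_Collect_less continuous_on_const)
    have sub: "B \<subseteq> {y. J y < 1 + e}" using that by (auto simp: B_def)
    obtain d where "d > 0" "(\<Union>x\<in>B. ball x d) \<subseteq> {y. J y < 1 + e}"
      by (rule compact_subset_open_imp_ball_epsilon_subset[OF cB op sub])
    then show ?thesis by (intro exI[of _ d]) auto
  qed
  have "attractor_set \<phi> B"
  proof (rule attractor_set_sublevel[OF AD(1) contJ B_def \<open>B \<noteq> {}\<close>])
    show "\<phi> x t \<in> B" if "x \<in> B" "0 \<le> t" for x t
    proof -
      have x: "x \<in> A" "J x \<le> 1" using that by (auto simp: B_def)
      have "J (\<phi> x t) - 1 \<le> exp (- t) * (J x - 1)" using inA[OF x(1)] that by (intro decay) auto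
      also have "\<dots> \<le> 0" using x by (intro mult_nonneg_nonpos) auto
      finally show ?thesis using AD(3)[OF x(1) that(2)] by (simp add: B_def)
    qed
  next
    fix e :: real assume e: "e > 0"
    obtain d1 where d1: "d1 > 0" "\<And>z t. z \<in> nhd A d1 \<Longrightarrow> t \<ge> 0 \<Longrightarrow> infdist (\<phi> z t) A < min e \<sigma>"
      using AD(5)[of "min e \<sigma>"] e \<sigma>(1) by auto
    obtain d2 where d2: "d2 > 0" "\<And>x y. x \<in> B \<Longrightarrow> y \<in> ball x d2 \<Longrightarrow> J y < 1 + e" using near[OF e] by blast
    have "infdist (\<phi> y t) A \<le> e \<and> J (\<phi> y t) \<le> 1 + e" if xy: "x \<in> B" "y \<in> ball x (min d1 d2)" "t \<ge> 0" for x y t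
    proof -
      have "y \<in> nhd A d1" using xy by (auto simp: nhd_def B_def)
      then have i: "infdist (\<phi> y s) A < min e \<sigma>" if "s \<ge> 0" for s using d1(2) that by blast
      have "J (\<phi> y t) - 1 \<le> exp (- t) * (J y - 1)" using i xy by (intro decay) auto
      also have "\<dots> \<le> exp (- t) * e" using d2(2)[OF xy(1), of y] xy by (intro mult_left_mono) auto
      also have "\<dots> \<le> 1 * e" using e xy by (intro mult_right_mono) auto
      finally show ?thesis using i[OF xy(3)] by simp
    qed
    then show "\<exists>d>0. \<forall>x\<in>B. \<forall>y\<in>ball x d. \<forall>t\<ge>0. infdist (\<phi> y t) A \<le> e \<and> J (\<phi> y t) \<le> 1 + e"
      using d1(1) d2(1) by (intro exI[of _ "min d1 d2"]) auto
  next
    fix x assume x: "x \<in> B"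
    then have xA: "x \<in> A" by (simp add: B_def)
    obtain d1 where d1: "d1 > 0" "\<And>z t. z \<in> nhd A d1 \<Longrightarrow> t \<ge> 0 \<Longrightarrow> infdist (\<phi> z t) A < \<sigma>"
      using AD(5)[OF \<sigma>(1)] by auto
    obtain d2 where d2: "d2 > 0" "\<And>y. y \<in> ball x d2 \<Longrightarrow> J y < 1 + 1" using near[of 1] x by auto
    obtain d3 where d3: "d3 > 0" "\<And>e. e > 0 \<Longrightarrow> \<exists>T\<ge>0. \<forall>y\<in>ball x d3. \<forall>t\<ge>T. infdist (\<phi> y t) A < e"
      using AD(4)[OF xA] by blast
    define d where "d = min d1 (min d2 d3)"
    have "\<exists>T\<ge>0. \<forall>y\<in>ball x d. \<forall>t\<ge>T. infdist (\<phi> y t) A \<le> e \<and> J (\<phi> y t) \<le> 1 + e" if e: "e > 0" for e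
    proof -
      obtain T1 where T1: "T1 \<ge> 0" "\<And>y t. y \<in> ball x d3 \<Longrightarrow> t \<ge> T1 \<Longrightarrow> infdist (\<phi> y t) A < e" using d3(2)[OF e] by blast
      obtain T2 where T2: "T2 \<ge> 0" "\<And>t. t \<ge> T2 \<Longrightarrow> exp (- t) * 1 \<le> e" using exp_minus_small[OF e] by blast
      have "infdist (\<phi> y t) A \<le> e \<and> J (\<phi> y t) \<le> 1 + e" if yt: "y \<in> ball x d" "t \<ge> max T1 T2" for y t
      proof -
        have "y \<in> nhd A d1" using yt xA by (auto simp: nhd_def d_def)
        then have "J (\<phi> y t) - 1 \<le> exp (- t) * (J y - 1)" using d1(2) yt T1(1) by (intro decay) auto
        also have "\<dots> \<le> exp (- t) * 1" using d2(2)[of y] yt by (intro mult_left_mono) (auto simp: d_def)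
        also have "\<dots> \<le> e" using T2 yt by simp
        finally show ?thesis using T1(2)[of y t] yt by (simp add: d_def)
      qed
      then show ?thesis using T1(1) by (intro exI[of _ "max T1 T2"]) auto
    qed
    moreover have "d > 0" using d1 d2 d3 by (simp add: d_def)
    ultimately show "\<exists>d>0. \<forall>e>0. \<exists>T\<ge>0. \<forall>y\<in>ball x d. \<forall>t\<ge>T. infdist (\<phi> y t) A \<le> e \<and> J (\<phi> y t) \<le> 1 + e"
      by blast
  qed
  then have "\<not> B \<subset> A" using A unfolding minimal_attractor_set_def by blast
  then show ?thesis by (auto simp: B_def)
qed

end

section \<open>Existence of feasible functions close to the attractor\<close>

lemma feasible_mono: "feasible f g d \<alpha> J \<Longrightarrow> d \<le> e \<Longrightarrow> feasible f g e \<alpha> J"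
  unfolding feasible_def sos_deg_le_def using poly_deg_le_mono by blast

lemma feasibleI:
  assumes "sos J" "sos s0" "sos k0" "sos k1" "real_polynomial_function p0"
    and "\<And>x. k0 x = - (gradient J x \<bullet> f x) - (J x - 1) - s0 x * g x" "\<And>x. k1 x = (J x - 1 - \<alpha>) - p0 x * g x"
  shows "\<exists>d. feasible f g d \<alpha> J"
proof -
  have "\<exists>d. p \<in> poly_deg_le d" if "real_polynomial_function p" for p :: "real ^ 'n \<Rightarrow> real"
    using that real_polynomial_function_iff_poly_deg_le by blast
  then obtain a b c d e where deg: "J \<in> poly_deg_le a" "s0 \<in> poly_deg_le b" "k0 \<in> poly_deg_le c" "k1 \<in> poly_deg_le d" "p0 \<in> poly_deg_le e"
    using assms sos_polynomial by metis
  define n where "n = a + b + c + d + e"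
  have "J \<in> sos_deg_le n" "s0 \<in> sos_deg_le n" "k0 \<in> sos_deg_le n" "k1 \<in> sos_deg_le n" "p0 \<in> poly_deg_le n"
    using assms(1-4) deg by (auto simp: sos_deg_le_def n_def intro: poly_deg_le_mono)
  then show ?thesis unfolding feasible_def using assms(6,7) by blast
qed

text \<open>With \<open>W = 1 - \<delta> + Y\<close>, where \<open>Y \<ge> - q\<close> decays along the flow at rate \<open>2\<close> up to \<open>q\<close>, the square
  \<open>J = W\<^sup>2\<close> satisfies the decay condition with a margin.\<close>

lemma square_margin:
  fixes W Y \<delta> q G :: real
  assumes W: "W = 1 - \<delta> + Y" and "0 < \<delta>" "\<delta> \<le> 1/4" "0 \<le> q" "10 * q \<le> \<delta>" "- q \<le> Y" and G: "G \<le> - 2 * Y + 3 * q"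
  shows "0 < - (2 * W * G) - (W\<^sup>2 - 1)" "W > 1/2"
proof -
  show W2: "W > 1/2" using assms by linarith
  have "2 * W * G \<le> 2 * W * (- 2 * Y + 3 * q)" using G W2 by (intro mult_left_mono) auto
  moreover have "- (2 * W * (- 2 * Y + 3 * q)) - (W\<^sup>2 - 1) = \<delta> * (1 + W) + Y * (3 * W - 1) - 6 * W * q"
    unfolding W by (simp add: power2_eq_square algebra_simps)
  moreover have "- q * (3 * W - 1) \<le> Y * (3 * W - 1)" using assms W2 by (intro mult_right_mono) auto
  \<comment> \<open>The losses \<open>q (3 W - 1)\<close> and \<open>6 W q\<close> add up to
    \<open>q (9 W - 1)\<close>, which stays below the gain \<open>\<delta> (1 + W)\<close>.\<close>
  moreover have "q * (9 * W - 1) \<le> (\<delta> / 10) * (9 * W - 1)" using assms W2 by (intro mult_right_mono) auto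
  moreover have "(\<delta> / 10) * (9 * W - 1) < (\<delta> / 10) * (10 + 10 * W)" using assms W2 by (intro mult_strict_left_mono) auto
  ultimately show "0 < - (2 * W * G) - (W\<^sup>2 - 1)" by (simp add: algebra_simps)
qed

context polynomial_flow begin

text \<open>A steep enough slope \<open>c\<close> lifts \<open>J\<close> above
  \<open>1 + \<alpha>\<close> on the boundary, however large \<alpha> is; the shift \<delta> is then
  taken so small that the level \<open>J = 1\<close> remains close to \<open>A\<close>.\<close>

lemma ex_feasible:
  assumes A: "attractor_set \<phi> A" and \<sigma>: "\<sigma> > 0" "nhd A \<sigma> \<subseteq> \<Omega>" and \<Omega>: "compact \<Omega>" "\<Omega> = {x. g x \<ge> 0}"
    and basin: "\<Omega> \<subseteq> basin_of_attraction \<phi> A" and g: "real_polynomial_function g"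
    and bdry: "frontier \<Omega> = {x. g x = 0}" and \<alpha>: "\<alpha> > 0" and \<rho>: "\<rho> > 0"
  shows "\<exists>d J. feasible f g d \<alpha> J \<and> (\<forall>x\<in>\<Omega>. J x \<le> 1 \<longrightarrow> infdist x A \<le> 2 * \<rho>)"
proof -
  define r where "r = min \<rho> (\<sigma> / 2)"
  have r: "r > 0" "r \<le> \<rho>" "r \<le> \<sigma> / 2" using \<rho> \<sigma> by (auto simp: r_def)
  have Ane: "A \<noteq> {}" using attractor_setD(2)[OF A] .
  have ne: "\<Omega> \<noteq> {}" using Ane \<sigma> by (auto simp: nhd_def)
  from converse_lyapunov[OF A \<Omega>(1) ne basin r(1)]
  obtain V L \<eta> \<rho>' R where "L > 0" "\<eta> > 0" "\<forall>x y. \<bar>V x - V y\<bar> \<le> L * norm (x - y)" "\<forall>x. V x \<ge> (0::real)"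
    "\<forall>x. norm x > \<rho>' \<longrightarrow> V x = 0" "\<forall>x\<in>\<Omega>. infdist x A - r \<le> V x"
    "\<forall>x\<in>\<Omega>. \<forall>y\<in>ball x \<eta>. \<forall>t\<ge>0. norm (\<phi> y t) \<le> R"
    "\<forall>x\<in>\<Omega>. \<forall>y\<in>ball x \<eta>. \<forall>h\<in>{0..\<eta>}. V (\<phi> y h) \<le> exp (- 2 * h) * V y"
    by (elim exE conjE) (rule that; assumption)
  then have V: "L > 0" "\<eta> > 0" "\<And>x y. \<bar>V x - V y\<bar> \<le> L * norm (x - y)" "\<And>x. V x \<ge> (0::real)"
    "\<And>x. norm x > \<rho>' \<Longrightarrow> V x = 0" "\<And>x. x \<in> \<Omega> \<Longrightarrow> infdist x A - r \<le> V x"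
    "\<And>x y t. x \<in> \<Omega> \<Longrightarrow> y \<in> ball x \<eta> \<Longrightarrow> t \<ge> 0 \<Longrightarrow> norm (\<phi> y t) \<le> R"
    "\<And>x y h. x \<in> \<Omega> \<Longrightarrow> y \<in> ball x \<eta> \<Longrightarrow> h \<in> {0..\<eta>} \<Longrightarrow> V (\<phi> y h) \<le> exp (- 2 * h) * V y"
    by blast+
  \<comment> \<open>Boundary points are at distance at least \<sigma> from \<open>A\<close>, so
    \<open>V \<ge> \<sigma> / 2\<close> there. This slope gives
    \<open>c * \<sigma> / 2 = \<alpha> + 2\<close>, one unit more than needed to absorb \<delta> and
    the smoothing error.\<close>
  define c where "c = (2 * \<alpha> + 4) / \<sigma>"
  have c: "c > 0" using \<alpha> \<sigma> by (simp add: c_def)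
  \<comment> \<open>\<open>1/4\<close> is what \<open>square_margin\<close> allows, and
    \<open>c * r / 2\<close> turns \<open>J \<le> 1\<close> into
    \<open>P \<le> r / 2\<close>.\<close>
  define \<delta> where "\<delta> = min (1/4) (c * r / 2)"
  have \<delta>: "\<delta> > 0" "\<delta> \<le> 1/4" "\<delta> \<le> c * r / 2" using c r by (auto simp: \<delta>_def)
  \<comment> \<open>Scaled by \<open>c\<close>, the smoothing error becomes
    \<open>\<delta> / 10\<close>, the error that \<open>square_margin\<close> tolerates.\<close>
  define e where "e = \<delta> / (10 * c)"
  have e: "e > 0" using \<delta> c by (simp add: e_def)
  have ce: "c * e = \<delta> / 10" using c by (simp add: e_def)
  have "\<exists>P. real_polynomial_function P \<and> (\<forall>x\<in>\<Omega>. \<bar>P x - V x\<bar> \<le> e) \<and>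
      (\<forall>x\<in>\<Omega>. \<forall>D. GDERIV P x :> D \<longrightarrow> D \<bullet> f x \<le> - 2 * V x + e)"
    by (rule polynomial_smoothing[OF \<Omega>(1) V(1) _ V(4) _ V(2) _ _ e]) (rule V; assumption)+
  then obtain P where P: "real_polynomial_function P" "\<And>x. x \<in> \<Omega> \<Longrightarrow> \<bar>P x - V x\<bar> \<le> e"
    "\<And>x D. x \<in> \<Omega> \<Longrightarrow> GDERIV P x :> D \<Longrightarrow> D \<bullet> f x \<le> - 2 * V x + e"
    by blast
  define W where "W x = 1 - \<delta> + c * P x" for x
  define J where "J x = (W x)\<^sup>2" for x
  have W: "real_polynomial_function W"
    unfolding W_def by (intro real_polynomial_function.intros(2-4) P(1))
  have sosJ: "sos J" unfolding J_def by (rule sos_square[OF W])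
  have J: "real_polynomial_function J" by (rule sos_polynomial[OF sosJ])
  have gradJ: "gradient J x = (2 * W x * c) *\<^sub>R gradient P x" for x
  proof (rule gradient_eq)
    have "(P has_derivative (\<lambda>h. h \<bullet> gradient P x)) (at x)"
      using GDERIV_gradient[OF P(1)] by (simp add: gderiv_def)
    then have "(J has_derivative (\<lambda>h. h \<bullet> ((2 * W x * c) *\<^sub>R gradient P x))) (at x)"
      unfolding J_def W_def by (auto intro!: derivative_eq_intros simp: fun_eq_iff)
    then show "GDERIV J x :> (2 * W x * c) *\<^sub>R gradient P x" by (simp add: gderiv_def)
  qed
  have near: "- e \<le> P x" "V x \<le> P x + e" "P x \<le> V x + e" if "x \<in> \<Omega>" for x
    using P(2)[OF that] V(4)[of x] by (auto simp: abs_le_iff)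
  have margin: "0 < - (gradient J x \<bullet> f x) - (J x - 1)" "W x > 1/2" if x: "x \<in> \<Omega>" for x
  proof -
    have cP: "- (\<delta> / 10) \<le> c * P x"
      using mult_left_mono[OF near(1)[OF x], of c] c ce by simp
    have "gradient P x \<bullet> f x \<le> - 2 * P x + 3 * e"
      using P(3)[OF x GDERIV_gradient[OF P(1)]] near(3)[OF x] by simp
    then have "c * (gradient P x \<bullet> f x) \<le> c * (- 2 * P x + 3 * e)" using c by (intro mult_left_mono) auto
    then have G: "c * (gradient P x \<bullet> f x) \<le> - 2 * (c * P x) + 3 * (\<delta> / 10)" using ce by (simp add: algebra_simps)
    note m = square_margin[OF W_def \<delta>(1,2) _ _ cP G]
    show "W x > 1/2" using m(2) \<delta>(1) by simp
    show "0 < - (gradient J x \<bullet> f x) - (J x - 1)" using m(1) \<delta>(1) by (simp add: gradJ J_def mult.assoc)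
  qed
  define p where "p x = - (gradient J x \<bullet> f x) - (J x - 1)" for x
  have "real_polynomial_function p"
    unfolding p_def
    by (intro real_polynomial_function_diff real_polynomial_function_minus real_polynomial_function_gradient_inner J poly real_polynomial_function.intros(2))
  moreover have bd: "bounded {x. g x \<ge> 0}" using \<Omega> compact_imp_bounded by blast
  ultimately have "p \<in> quad_module g"
    using margin(1) \<Omega>(2) by (intro positivstellensatz_compact g) (auto simp: p_def)
  then obtain k0 s0 where k0: "sos k0" "sos s0" "\<And>x. p x = k0 x + s0 x * g x"
    unfolding quad_module_def by (auto dest: fun_cong)
  have contJ: "continuous_on S J" and contg: "continuous_on S g" for S
    using J g by (auto intro: continuous_on_polynomial)
  have bdry_gt: "J x > 1 + \<alpha>" if x: "g x = 0" for x
  proof -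
    have fr: "x \<in> frontier \<Omega>" using bdry x by blast
    have x\<Omega>: "x \<in> \<Omega>" using x \<Omega>(2) by simp
    have "open (nhd A \<sigma>)" unfolding nhd_def by auto
    then have "nhd A \<sigma> \<subseteq> interior \<Omega>" using \<sigma>(2) by (intro interior_maximal)
    then have "x \<notin> nhd A \<sigma>" using fr by (auto simp: frontier_def)
    then have "\<sigma> \<le> infdist x A" using infdist_less_nhd[OF Ane] by (meson not_le)
    then have "\<sigma> / 2 - e \<le> P x" using V(6)[OF x\<Omega>] r near(2)[OF x\<Omega>] by simp
    then have "c * (\<sigma> / 2 - e) \<le> c * P x" using c by (intro mult_left_mono) auto
    moreover have "c * \<sigma> = 2 * \<alpha> + 4" using \<sigma> by (simp add: c_def)
    then have "c * (\<sigma> / 2 - e) = \<alpha> + 2 - \<delta> / 10" by (simp add: right_diff_distrib ce)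
    ultimately have W: "W x \<ge> 1 + \<alpha> + 1" using \<delta> by (simp add: W_def)
    then have "W x * 1 \<le> W x * W x" using \<alpha> by (intro mult_left_mono) auto
    then show ?thesis using W by (simp add: J_def power2_eq_square)
  qed
  define Q where "Q = \<Omega> \<inter> {x. J x \<le> 1 + \<alpha>}"
  have cQ: "compact Q"
    unfolding Q_def by (intro compact_Int_closed \<Omega>(1) closed_Collect_le contJ continuous_on_const)
  have "\<exists>m>0. \<forall>x\<in>Q. m \<le> g x"
  proof (cases "Q = {}")
    case False
    then obtain x0 where x0: "x0 \<in> Q" "\<And>x. x \<in> Q \<Longrightarrow> g x0 \<le> g x" using continuous_attains_inf[OF cQ _ contg] by blast
    then have "g x0 \<ge> 0" "g x0 \<noteq> 0" using \<Omega>(2) bdry_gt[of x0] by (auto simp: Q_def)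
    then show ?thesis using x0 by (intro exI[of _ "g x0"]) auto
  qed (auto intro: exI[of _ 1])
  then obtain m where m: "m > 0" "\<And>x. x \<in> Q \<Longrightarrow> m \<le> g x" by blast
  \<comment> \<open>The multiplier \<open>p0\<close> has no sign constraint, so a multiple of
    \<open>g\<close> may be added first. Where \<open>J \<le> 1 + \<alpha>\<close>, \<open>g\<close>
    is at least \<open>m\<close>, and \<open>C * m = 2 + \<alpha>\<close> outweighs
    \<open>J - 1 - \<alpha> \<ge> - 1 - \<alpha>\<close>.\<close>
  define C where "C = (2 + \<alpha>) / m"
  have C: "C > 0" using m \<alpha> by (simp add: C_def)
  define q where "q x = J x - 1 - \<alpha> + C * g x" for x
  have "real_polynomial_function q"
    unfolding q_def by (intro real_polynomial_function.intros(2-4) real_polynomial_function_diff J g)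
  moreover have "q x > 0" if gx: "g x \<ge> 0" for x
  proof (cases "J x \<le> 1 + \<alpha>")
    case True
    then have "m \<le> g x" using m(2)[of x] gx \<Omega>(2) by (auto simp: Q_def)
    then have "C * m \<le> C * g x" using C by (intro mult_left_mono) auto
    then have "2 + \<alpha> \<le> C * g x" using m(1) by (simp add: C_def)
    moreover have "J x \<ge> 0" by (simp add: J_def)
    ultimately show ?thesis by (simp add: q_def)
  next
    case False
    then show ?thesis using C gx by (simp add: q_def add_pos_nonneg)
  qed
  ultimately have "q \<in> quad_module g" by (intro positivstellensatz_compact g bd)
  then obtain k1 t1 where k1: "sos k1" "sos t1" "\<And>x. q x = k1 x + t1 x * g x"
    unfolding quad_module_def by (auto dest: fun_cong)
  have "real_polynomial_function (\<lambda>x. t1 x - C)"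
    by (intro real_polynomial_function_diff sos_polynomial[OF k1(2)] real_polynomial_function.intros(2))
  moreover have "k0 x = - (gradient J x \<bullet> f x) - (J x - 1) - s0 x * g x" for x using k0(3)[of x] by (simp add: p_def)
  moreover have "k1 x = (J x - 1 - \<alpha>) - (t1 x - C) * g x" for x using k1(3)[of x] by (simp add: q_def algebra_simps)
  ultimately have "\<exists>d. feasible f g d \<alpha> J" using sosJ k0(1,2) k1(1) by (intro feasibleI)
  moreover have "infdist x A \<le> 2 * \<rho>" if x: "x \<in> \<Omega>" and "J x \<le> 1" for x
  proof -
    have "(W x)\<^sup>2 \<le> 1\<^sup>2" using \<open>J x \<le> 1\<close> by (simp add: J_def)
    then have "W x \<le> 1" by (rule power2_le_imp_le) simp
    then have "c * P x \<le> c * r / 2" using \<delta>(3) by (simp add: W_def)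
    then have "c * P x \<le> c * (r / 2)" by simp
    then have "P x \<le> r / 2" using c by (simp only: mult_le_cancel_left_pos)
    moreover have "e \<le> r / 2"
    proof -
      have "c * e \<le> c * (r / 2)" using ce \<delta> by simp
      then show ?thesis using c by (simp only: mult_le_cancel_left_pos)
    qed
    ultimately have "V x \<le> r" using near(2)[OF x] by simp
    then show ?thesis using V(6)[OF x] r by simp
  qed
  ultimately show ?thesis by blast
qed

end

section \<open>Volume of shrinking neighbourhoods, and the conclusion\<close>

lemma emeasure_shrinking_nhd:
  fixes A :: "(real ^ 'n) set"
  assumes A: "compact A" "A \<noteq> {}" and e: "(e :: ennreal) > 0"
  shows "\<exists>\<rho>>0. emeasure lebesgue ({x. infdist x A \<le> 2 * \<rho>} - A) < e"
proof -
  define D where "D n = {x. infdist x A \<le> 2 * (1 / real (Suc n))} - A" for n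
  have cpt: "compact {x. infdist x A \<le> 2 * (1 / real (Suc n))}" for n
    using compact_infdist_le[OF A(2,1)] by simp
  have bor: "{x. infdist x A \<le> 2 * (1 / real (Suc n))} \<in> sets borel" "A \<in> sets borel" for n
    using cpt A(1) borel_compact by blast+
  then have meas: "D n \<in> sets lebesgue" for n unfolding D_def by (intro sets.Diff sets_completionI_sets) simp_all
  have "(\<lambda>n. emeasure lebesgue (D n)) \<longlonglongrightarrow> emeasure lebesgue (\<Inter>n. D n)"
  proof (rule Lim_emeasure_decseq)
    show "range D \<subseteq> sets lebesgue" using meas by blast
    show "decseq D"
    proof (rule decseq_SucI)
      fix n
      have "1 / real (Suc (Suc n)) \<le> 1 / real (Suc n)" by (intro divide_left_mono) auto
      then have "2 * (1 / real (Suc (Suc n))) \<le> 2 * (1 / real (Suc n))" by simp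
      then show "D (Suc n) \<subseteq> D n" unfolding D_def using order.trans by blast
    qed
    fix n
    have "emeasure lebesgue (D n) \<le> emeasure lebesgue {x. infdist x A \<le> 2 * (1 / real (Suc n))}"
      using bor unfolding D_def by (intro emeasure_mono sets_completionI_sets) auto
    also have "\<dots> = emeasure lborel {x. infdist x A \<le> 2 * (1 / real (Suc n))}" using bor by simp
    also have "\<dots> < \<infinity>" using cpt[of n] by (intro emeasure_bounded_finite compact_imp_bounded)
    finally show "emeasure lebesgue (D n) \<noteq> \<infinity>" by simp
  qed
  moreover have "(\<Inter>n. D n) = {}"
  proof (rule ccontr)
    assume "(\<Inter>n. D n) \<noteq> {}"
    then obtain x where x: "\<And>n. infdist x A \<le> 2 * (1 / real (Suc n))" "x \<notin> A" by (auto simp: D_def)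
    have "infdist x A \<le> 0"
    proof (rule field_le_epsilon)
      fix d :: real assume "d > 0"
      then obtain n where "1 / real (Suc n) < d / 2" using nat_approx_posE[of "d / 2"] by auto
      then show "infdist x A \<le> 0 + d" using x(1)[of n] by linarith
    qed
    then have "infdist x A = 0" using infdist_nonneg[of x A] by simp
    then show False using x(2) in_closed_iff_infdist_zero[OF compact_imp_closed[OF A(1)] A(2)] by blast
  qed
  ultimately have "(\<lambda>n. emeasure lebesgue (D n)) \<longlonglongrightarrow> 0" by simp
  then have "eventually (\<lambda>n. emeasure lebesgue (D n) < e) sequentially" using e by (rule order_tendstoD(2))
  then obtain n where "emeasure lebesgue (D n) < e" by (auto simp: eventually_sequentially)
  then show ?thesis unfolding D_def by (intro exI[of _ "1 / real (Suc n)"]) auto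
qed

theorem corollary12:
  fixes f :: "real ^ 'n \<Rightarrow> real ^ 'n"
    and \<phi> :: "real ^ 'n \<Rightarrow> real \<Rightarrow> real ^ 'n"
    and A \<Omega> :: "(real ^ 'n) set"
    and g :: "real ^ 'n \<Rightarrow> real"
    and \<sigma> :: real
    and J :: "nat \<Rightarrow> real \<Rightarrow> real ^ 'n \<Rightarrow> real"
  assumes "polynomial_function f"
    and "unique_solution_map f \<phi>"
    and "minimal_attractor_set \<phi> A"
    and "\<sigma> > 0"
    and "compact \<Omega>"
    and "nhd A \<sigma> \<subseteq> \<Omega>"
    and "\<Omega> \<subseteq> basin_of_attraction \<phi> A"
    and "real_polynomial_function g"
    and "\<Omega> = {x. g x \<ge> 0}"
    and "frontier \<Omega> = {x. g x = 0}"
  shows "(\<forall>d. \<forall>\<alpha>>0. solves f g \<Omega> d \<alpha> (J d \<alpha>) \<longrightarrow> attractor_set \<phi> {x\<in>\<Omega>. J d \<alpha> x \<le> 1})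
    \<and> (\<forall>d. \<forall>\<alpha>>0. solves f g \<Omega> d \<alpha> (J d \<alpha>) \<longrightarrow> A \<subseteq> {x\<in>\<Omega>. J d \<alpha> x \<le> 1})
    \<and> (\<exists>\<beta>>0. \<forall>\<alpha>\<in>{0<..<\<beta>}. (\<forall>\<^sub>F d in sequentially. solves f g \<Omega> d \<alpha> (J d \<alpha>)) \<longrightarrow>
          (\<lambda>d. vol_dist A {x\<in>\<Omega>. J d \<alpha> x \<le> 1}) \<longlonglongrightarrow> 0)"
proof -
  interpret polynomial_flow f \<phi>
    using assms(1,2) by unfold_locales (auto simp: unique_solution_map_def)
  have att: "attractor_set \<phi> A" using assms(3) by (simp add: minimal_attractor_set_def)
  note AD = attractor_setD[OF att]
  have A\<Omega>: "A \<subseteq> \<Omega>" using assms(4,6) by (force simp: nhd_def)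
  have sub: "A \<subseteq> {x\<in>\<Omega>. K x \<le> 1}" if "feasible f g d \<alpha> K" for d \<alpha> K
    using minimal_attractor_subset_sublevel[OF assms(3,4) _ that] assms(6,9) A\<Omega> by blast
  have feas: "feasible f g d \<alpha> K" if "solves f g \<Omega> d \<alpha> K" for d \<alpha> K
    using that by (simp add: solves_def is_arg_min_def)
  have bor: "{x\<in>\<Omega>. K x \<le> 1} \<in> sets lebesgue" if "feasible f g d \<alpha> K" for d \<alpha> K
  proof -
    have "continuous_on UNIV K" using feasibleD(1)[OF that] by (rule continuous_on_polynomial)
    then have "compact (\<Omega> \<inter> {x. K x \<le> 1})"
      by (intro compact_Int_closed assms(5) closed_Collect_le continuous_on_const)
    moreover have "\<Omega> \<inter> {x. K x \<le> 1} = {x\<in>\<Omega>. K x \<le> 1}" by auto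
    ultimately show ?thesis using borel_compact by (metis sets_completionI_sets sets_lborel)
  qed
  have borA: "A \<in> sets lebesgue" using AD(1) borel_compact by (metis sets_completionI_sets sets_lborel)
  have fin\<Omega>: "emeasure lebesgue S < \<infinity>" if "S \<subseteq> \<Omega>" for S
  proof -
    have "\<Omega> \<in> sets borel" using assms(5) borel_compact by blast
    then have "emeasure lebesgue S \<le> emeasure lborel \<Omega>"
      using emeasure_mono[OF that, of lebesgue] by (simp add: sets_completionI_sets)
    also have "\<dots> < \<infinity>" using assms(5) by (intro emeasure_bounded_finite compact_imp_bounded)
    finally show ?thesis .
  qed
  \<comment> \<open>Since \<open>A\<close> lies in the sublevel set and has finite measure,
    minimizing the volume of the sublevel set minimizes its volume distance to
    \<open>A\<close>.\<close>
  have vol: "vol_dist A {x\<in>\<Omega>. K x \<le> 1} = emeasure lebesgue {x\<in>\<Omega>. K x \<le> 1} - emeasure lebesgue A"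
    if K: "feasible f g d \<alpha> K" for d \<alpha> K
  proof -
    have "(A - {x\<in>\<Omega>. K x \<le> 1}) \<union> ({x\<in>\<Omega>. K x \<le> 1} - A) = {x\<in>\<Omega>. K x \<le> 1} - A" using sub[OF K] by blast
    then show ?thesis
      unfolding vol_dist_def using emeasure_Diff[OF _ bor[OF K] borA sub[OF K]] fin\<Omega>[OF A\<Omega>] by simp
  qed
  have part3: "(\<lambda>d. vol_dist A {x\<in>\<Omega>. J d \<alpha> x \<le> 1}) \<longlonglongrightarrow> 0"
    if \<alpha>: "\<alpha> > 0" and ev: "\<forall>\<^sub>F d in sequentially. solves f g \<Omega> d \<alpha> (J d \<alpha>)" for \<alpha>
  proof (rule order_tendstoI)
    show "\<forall>\<^sub>F d in sequentially. a < vol_dist A {x\<in>\<Omega>. J d \<alpha> x \<le> 1}" if "a < 0" for a using that by simp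
    fix e :: ennreal assume "0 < e"
    then obtain \<rho> where \<rho>: "\<rho> > 0" "emeasure lebesgue ({x. infdist x A \<le> 2 * \<rho>} - A) < e"
      using emeasure_shrinking_nhd[OF AD(1,2)] by blast
    obtain d0 K where K: "feasible f g d0 \<alpha> K" "\<And>x. x \<in> \<Omega> \<Longrightarrow> K x \<le> 1 \<Longrightarrow> infdist x A \<le> 2 * \<rho>"
      using ex_feasible[OF att assms(4,6,5,9,7,8,10) \<alpha> \<rho>(1)] by blast
    have cpt: "compact {x. infdist x A \<le> 2 * \<rho>}" using compact_infdist_le[OF AD(2,1)] \<rho>(1) by simp
    have "vol_dist A {x\<in>\<Omega>. K x \<le> 1} \<le> emeasure lebesgue ({x. infdist x A \<le> 2 * \<rho>} - A)"
      unfolding vol_dist_def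
    proof (rule emeasure_mono)
      show "(A - {x\<in>\<Omega>. K x \<le> 1}) \<union> ({x\<in>\<Omega>. K x \<le> 1} - A) \<subseteq> {x. infdist x A \<le> 2 * \<rho>} - A"
        using K(2) sub[OF K(1)] by blast
      show "{x. infdist x A \<le> 2 * \<rho>} - A \<in> sets lebesgue"
        using borel_compact[OF cpt] by (intro sets.Diff borA) (simp add: sets_completionI_sets)
    qed
    then have Ke: "vol_dist A {x\<in>\<Omega>. K x \<le> 1} < e" using \<rho>(2) by (rule le_less_trans)
    \<comment> \<open>From degree \<open>d0\<close> on, \<open>K\<close> competes with the optimal
      \<open>J d \<alpha>\<close>, whose sublevel set is then at least as close to
      \<open>A\<close>.\<close>
    have "\<forall>\<^sub>F d in sequentially. d0 \<le> d" by (rule eventually_ge_at_top)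
    with ev show "\<forall>\<^sub>F d in sequentially. vol_dist A {x\<in>\<Omega>. J d \<alpha> x \<le> 1} < e"
    proof eventually_elim
      case (elim d)
      have "feasible f g d \<alpha> K" using K(1) elim(2) by (rule feasible_mono)
      then have "emeasure lebesgue {x\<in>\<Omega>. J d \<alpha> x \<le> 1} \<le> emeasure lebesgue {x\<in>\<Omega>. K x \<le> 1}"
        using elim(1) unfolding solves_def is_arg_min_def by (meson not_le)
      then have "vol_dist A {x\<in>\<Omega>. J d \<alpha> x \<le> 1} \<le> vol_dist A {x\<in>\<Omega>. K x \<le> 1}"
        unfolding vol[OF feas[OF elim(1)]] vol[OF K(1)] by (rule ennreal_minus_mono) simp
      then show ?case using Ke by (rule le_less_trans)
    qed
  qed
  show ?thesis
  proof (intro conjI allI impI)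
    fix d \<alpha> assume *: "\<alpha> > (0 :: real)" "solves f g \<Omega> d \<alpha> (J d \<alpha>)"
    show "A \<subseteq> {x\<in>\<Omega>. J d \<alpha> x \<le> 1}" using sub feas[OF *(2)] .
    then have "{x\<in>\<Omega>. J d \<alpha> x \<le> 1} \<noteq> {}" using AD(2) by blast
    then show "attractor_set \<phi> {x\<in>\<Omega>. J d \<alpha> x \<le> 1}"
      by (rule sublevel_attractor[OF assms(8,5,9) feas[OF *(2)] *(1)])
  next
    show "\<exists>\<beta>>0. \<forall>\<alpha>\<in>{0<..<\<beta>}. (\<forall>\<^sub>F d in sequentially. solves f g \<Omega> d \<alpha> (J d \<alpha>)) \<longrightarrow>
        (\<lambda>d. vol_dist A {x\<in>\<Omega>. J d \<alpha> x \<le> 1}) \<longlonglongrightarrow> 0"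
      \<comment> \<open>Convergence holds for every positive \<alpha>, so the bound 1 is an
        arbitrary choice.\<close>
      using part3 by (intro exI[of _ 1]) auto
  qed
qed

end
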